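(* Let $P(\lambda)=\sum_{i=0}^k\lambda^iA_i$ be an $n\times n$ matrix polynomial of degree $k$ with $A_i\in\mathbb{C}^{n\times n}$, let $\lambda_0\in\mathbb{C}$, and let $r$ be an integer with $1\leqslant r<kn$. Let $\mathcal{S}(P,\lambda_0)$ be the collection of all $n\times n$ matrix polynomials $\Delta P(\lambda)=\sum_{i=0}^k\lambda^i\Delta A_i$ such that the block Toeplitz matrix $T(P+\Delta P,\lambda_0)$ has rank at most $(r+1)(n-1)$. Then for any choice of norm $|||\cdot|||$ (on the space of $n\times n$ complex matrix polynomials $\sum_{i=0}^k\lambda^iB_i$), the distance from $P(\lambda)$ to a nearest matrix polynomial with an elementary divisor $(\lambda-\lambda_0)^j$, $j\geqslant r+1$, is given by $$\inf\{|||\Delta P|||:\Delta P(\lambda)\in\mathcal{S}(P,\lambda_0)\}.$$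
   Context: For an $n\times n$ matrix polynomial $Q(\lambda)$ and $\alpha\in\mathbb{C}$, with $Q^i$ denoting the $i$-th derivative, $T(Q,\alpha)$ is the $(r+1)n\times(r+1)n$ block lower triangular Toeplitz matrix whose $n\times n$ block in block position $(i,j)$, $1\leqslant i,j\leqslant r+1$, is $\frac{Q^{i-j}(\alpha)}{(i-j)!}$ if $i\geqslant j$ and $0$ if $i<j$. Elementary divisors are defined via the Smith form: $P(\lambda)=E(\lambda)D(\lambda)F(\lambda)$ with $E,F$ matrix polynomials with nonzero constant determinants and $D(\lambda)=\mathrm{diag}(d_1(\lambda),\dots,d_t(\lambda),0,\dots,0)$, with $d_i$ monic and $d_{i-1}\mid d_i$. If $d_i(\lambda)=\prod_j(\lambda-\lambda_{ij})^{c_{ij}}$ with distinct $\lambda_{ij}$ and $c_{ij}\geqslant1$, the factors $(\lambda-\lambda_{ij})^{c_{ij}}$ are the elementary divisors. The distance from $P(\lambda)$ to a nearest matrix polynomial with an elementary divisor $(\lambda-\lambda_0)^j$, $j\geqslant r+1$, with respect to $|||\cdot|||$ is the infimum of $|||\Delta P|||$ over all $\Delta P(\lambda)=\sum_{i=0}^k\lambda^i\Delta A_i$, $\Delta A_i\in\mathbb{C}^{n\times n}$ (any of the $\Delta A_i$ may be zero), such that $P+\Delta P$ has an elementary divisor $(\lambda-\lambda_0)^j$ for some $j\geqslant r+1$. *)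

theory Defs
  imports
    "HOL-Library.Extended_Real"
    "Jordan_Normal_Form.Determinant"
    "Jordan_Normal_Form.DL_Rank"
begin

text \<open>A matrix polynomial \<open>\<Sum>\<^sub>i \<lambda>^i A\<^sub>i\<close> is represented by the matrix of its polynomial entries;
  \<open>coeff_mat Q i\<close> recovers the coefficient \<open>A\<^sub>i\<close>.\<close>

definition coeff_mat :: "complex poly mat \<Rightarrow> nat \<Rightarrow> complex mat" where
  "coeff_mat Q i = map_mat (\<lambda>p. coeff p i) Q"

text \<open>The space of all \<open>\<Sum>i\<le>k. \<lambda>^i B\<^sub>i\<close> with \<open>B\<^sub>i\<close> an arbitrary \<open>n \<times> n\<close> matrix; in particular
  \<open>B\<^sub>k\<close> may be zero.\<close>

definition mat_polys :: "nat \<Rightarrow> nat \<Rightarrow> complex poly mat set" where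
  "mat_polys n k = {Q \<in> carrier_mat n n. \<forall>i>k. coeff_mat Q i = 0\<^sub>m n n}"

definition mat_poly_of_degree :: "nat \<Rightarrow> nat \<Rightarrow> complex poly mat \<Rightarrow> bool" where
  "mat_poly_of_degree n k Q \<longleftrightarrow> Q \<in> mat_polys n k \<and> coeff_mat Q k \<noteq> 0\<^sub>m n n"

text \<open>Norms on the complex vector space \<^term>\<open>mat_polys n k\<close>; nothing is required of \<open>N\<close>
  outside this space. The scalar \<open>c\<close> acts as the constant polynomial \<open>[:c:]\<close>.\<close>

definition is_norm_on_mat_polys :: "nat \<Rightarrow> nat \<Rightarrow> (complex poly mat \<Rightarrow> real) \<Rightarrow> bool" where
  "is_norm_on_mat_polys n k N \<longleftrightarrow>
     (\<forall>X \<in> mat_polys n k. 0 \<le> N X) \<and>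
     (\<forall>X \<in> mat_polys n k. N X = 0 \<longleftrightarrow> X = 0\<^sub>m n n) \<and>
     (\<forall>c. \<forall>X \<in> mat_polys n k. N ([:c:] \<cdot>\<^sub>m X) = cmod c * N X) \<and>
     (\<forall>X \<in> mat_polys n k. \<forall>Y \<in> mat_polys n k. N (X + Y) \<le> N X + N Y)"

definition mat_poly_deriv_at :: "complex poly mat \<Rightarrow> nat \<Rightarrow> complex \<Rightarrow> complex mat" where
  "mat_poly_deriv_at Q m \<alpha> = map_mat (\<lambda>p. poly ((pderiv ^^ m) p) \<alpha>) Q"

text \<open>Row \<open>a\<close> of the block matrix is row \<open>a mod n\<close> of block row \<open>a div n\<close> (counted from zero),
  and likewise for columns.\<close>

definition block_toeplitz :: "nat \<Rightarrow> nat \<Rightarrow> complex poly mat \<Rightarrow> complex \<Rightarrow> complex mat" where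
  "block_toeplitz n r Q \<alpha> =
     mat ((r + 1) * n) ((r + 1) * n) (\<lambda>(a, b).
       let i = a div n; j = b div n in
       if j \<le> i then mat_poly_deriv_at Q (i - j) \<alpha> $$ (a mod n, b mod n) / fact (i - j)
       else 0)"

definition unimodular_mat_poly :: "nat \<Rightarrow> complex poly mat \<Rightarrow> bool" where
  "unimodular_mat_poly n E \<longleftrightarrow> E \<in> carrier_mat n n \<and> (\<exists>c. c \<noteq> 0 \<and> det E = [:c:])"

text \<open>\<open>ds\<close> is the list of the invariant polynomials \<open>d\<^sub>1, \<dots>, d\<^sub>t\<close> in the Smith form of \<open>Q\<close>.
  The matrix \<open>Q\<close> may be singular, in which case \<open>t < n\<close>.\<close>

definition smith_form :: "nat \<Rightarrow> complex poly mat \<Rightarrow> complex poly list \<Rightarrow> bool" where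
  "smith_form n Q ds \<longleftrightarrow>
     length ds \<le> n \<and>
     (\<forall>d \<in> set ds. lead_coeff d = 1) \<and>
     (\<forall>i. Suc i < length ds \<longrightarrow> ds ! i dvd ds ! Suc i) \<and>
     (\<exists>E F. unimodular_mat_poly n E \<and> unimodular_mat_poly n F \<and>
        Q = E * mat_diag n (\<lambda>i. if i < length ds then ds ! i else 0) * F)"

text \<open>The polynomial \<open>f\<close> is one of the factors \<open>(\<lambda> - \<mu>)^c\<^sub>\<mu>\<close> in the factorisation
  \<open>d\<^sub>i = \<Prod>\<mu>\<in>R. (\<lambda> - \<mu>)^c\<^sub>\<mu>\<close> of some invariant polynomial into powers of distinct linear factors.\<close>

definition elementary_divisor :: "nat \<Rightarrow> complex poly mat \<Rightarrow> complex poly \<Rightarrow> bool" where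
  "elementary_divisor n Q f \<longleftrightarrow>
     (\<exists>ds. smith_form n Q ds \<and>
       (\<exists>d \<in> set ds. \<exists>R c. finite R \<and> (\<forall>\<mu> \<in> R. 1 \<le> c \<mu>) \<and>
          d = (\<Prod>\<mu>\<in>R. [:- \<mu>, 1:] ^ c \<mu>) \<and> (\<exists>\<mu> \<in> R. f = [:- \<mu>, 1:] ^ c \<mu>)))"

text \<open>The infima are taken in the extended reals, where the infimum of the empty set is
  \<open>\<infinity>\<close>.\<close>

definition elementary_divisor_distance ::
  "nat \<Rightarrow> nat \<Rightarrow> (complex poly mat \<Rightarrow> real) \<Rightarrow> complex poly mat \<Rightarrow> complex \<Rightarrow> nat \<Rightarrow> ereal" where
  "elementary_divisor_distance n k N P z\<^sub>0 r =
     (INF \<Delta> \<in> {\<Delta> \<in> mat_polys n k.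
                 \<exists>j \<ge> r + 1. elementary_divisor n (P + \<Delta>) ([:- z\<^sub>0, 1:] ^ j)}. ereal (N \<Delta>))"

definition rank_deficient_perturbations ::
  "nat \<Rightarrow> nat \<Rightarrow> complex poly mat \<Rightarrow> complex \<Rightarrow> nat \<Rightarrow> complex poly mat set" where
  "rank_deficient_perturbations n k P z\<^sub>0 r =
     {\<Delta> \<in> mat_polys n k.
        vec_space.rank ((r + 1) * n) (block_toeplitz n r (P + \<Delta>) z\<^sub>0) \<le> (r + 1) * (n - 1)}"

end

theory Submission
  imports Defs "HOL-Computational_Algebra.Fundamental_Theorem_Algebra"
begin

text \<open>
  Write \<open>Q = P + \<Delta>\<close> and \<open>z\<close> for the point in question. The rank condition forces
  \<open>(x - z)\<^bsup>r+1\<^esup>\<close> to divide \<open>det Q\<close>, the case \<open>det Q = 0\<close> included: the block Toeplitz matrix is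
  multiplication by \<open>Q\<close> on vectors of polynomials in \<open>x - z\<close> modulo \<open>(x - z)\<^bsup>r+1\<^esup>\<close>, and each root of the
  determinant at \<open>z\<close> raises its nullity by at most one. An elementary divisor
  \<open>(x - z)\<^sup>j\<close> with \<open>j \<ge> r + 1\<close> implies the rank condition, because the corresponding column of the inverse right
  Smith factor and its multiples by powers of \<open>x - z\<close> are \<open>r + 1\<close> independent kernel vectors
  (\<open>smith_form_imp_rank_le\<close>, \<open>det_dvd_if_rank_le\<close>).

  The converse implication fails, for instance when the power of \<open>x - z\<close> is spread over several invariant
  polynomials or when \<open>Q\<close> is singular, and the two infima agree because the converse holds
  after an arbitrarily small perturbation that does not raise the degree (\<open>elementary_divisor_dense\<close>). Any norm is
  bounded by the size of the coefficients, so small means small in every norm.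

  If \<open>det Q \<noteq> 0\<close>, a root \<open>\<mu>\<close> of \<open>det Q\<close> with \<open>Q(\<mu>) v = 0\<close> can be moved to \<open>z\<close> by passing to
  \<open>Q (I + (\<mu> - z) / (x - \<mu>) v f)\<close> with a functional \<open>f\<close> such that \<open>f \<bullet> v = 1\<close>. This keeps the degree, costs a
  constant times \<open>\<bar>\<mu> - z\<bar>\<close>, and with a suitable \<open>f\<close> keeps the kernel at \<open>z\<close> at most one-dimensional
  (\<open>move_root\<close>). Shifting the variable slightly moves the roots off \<open>z\<close>; moving them back one by one yields a
  matrix whose kernel at \<open>z\<close> is a line, so that a single invariant polynomial contains all of the
  power of \<open>x - z\<close> (\<open>gather_roots\<close>, \<open>elementary_divisor_if_kernel_line\<close>). The same argument applies
  whenever \<open>Q\<close> is a limit of regular matrices with \<open>r + 1\<close> roots tending to \<open>z\<close>.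

  If \<open>det Q = 0\<close>, such regular matrices exist with all \<open>k n > r\<close> roots near \<open>z\<close>. One factors \<open>Q = B C\<close> through rank
  \<open>n - 1\<close> with complementary degrees: at most \<open>d\<^sub>l\<close> in column \<open>l\<close> of \<open>B\<close> and at most \<open>k - d\<^sub>l\<close> in row \<open>l\<close>
  of \<open>C\<close> (\<open>singular_degree_factorization\<close>). All products with these degree bounds
  are singular of degree at most \<open>k\<close>, and they form an irreducible family. For one bidiagonal member the
  derivative of the determinant maps onto all polynomials of degree at most \<open>k n\<close>, hence it does so for members
  arbitrarily close to \<open>Q\<close>; perturbing such a member in a direction with derivative
  \<open>(x - z)\<^bsup>k n\<^esup>\<close> gives a determinant close to a multiple of \<open>(x - z)\<^bsup>k n\<^esup>\<close>
  (\<open>singular_perturbation_surjective_derivative\<close>, \<open>singular_regular_approximable\<close>).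
\<close>

section \<open>Smith normal form over the complex polynomials\<close>

definition unimod_equiv :: "nat \<Rightarrow> complex poly mat \<Rightarrow> complex poly mat \<Rightarrow> bool" where
  "unimod_equiv n A B \<longleftrightarrow>
     (\<exists>E F. unimodular_mat_poly n E \<and> unimodular_mat_poly n F \<and> B = E * A * F)"

lemma unimodular_carrier: "unimodular_mat_poly n E \<Longrightarrow> E \<in> carrier_mat n n"
  by (simp add: unimodular_mat_poly_def)

lemma unimodular_one: "unimodular_mat_poly n (1\<^sub>m n)"
  unfolding unimodular_mat_poly_def by (auto simp: one_pCons intro!: exI[of _ 1])

lemma unimodular_mult:
  assumes "unimodular_mat_poly n E" "unimodular_mat_poly n F"
  shows "unimodular_mat_poly n (E * F)"
proof -
  have E: "E \<in> carrier_mat n n" and F: "F \<in> carrier_mat n n"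
    using assms unimodular_carrier by auto
  obtain c d where "c \<noteq> 0" "det E = [:c:]" "d \<noteq> 0" "det F = [:d:]"
    using assms unfolding unimodular_mat_poly_def by auto
  then show ?thesis unfolding unimodular_mat_poly_def
    using E F by (auto simp: det_mult intro!: exI[of _ "c * d"])
qed

lemma unimodular_transpose:
  "unimodular_mat_poly n E \<Longrightarrow> unimodular_mat_poly n E\<^sup>T"
  unfolding unimodular_mat_poly_def by (auto simp: det_transpose)

lemma unimodular_inverse:
  assumes "unimodular_mat_poly n E"
  obtains E' where "unimodular_mat_poly n E'" "E' * E = 1\<^sub>m n" "E * E' = 1\<^sub>m n"
proof -
  have E: "E \<in> carrier_mat n n" using assms unimodular_carrier by auto
  obtain c where c: "c \<noteq> 0" "det E = [:c:]"
    using assms unfolding unimodular_mat_poly_def by auto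
  define E' where "E' = [:inverse c:] \<cdot>\<^sub>m adj_mat E"
  have E': "E' \<in> carrier_mat n n" unfolding E'_def using adj_mat(1)[OF E] by auto
  have ic: "[:inverse c:] * [:c:] = 1" using c by (simp add: one_pCons)
  have l: "E' * E = 1\<^sub>m n"
    unfolding E'_def using adj_mat[OF E] E c ic
    by (auto simp: mult_smult_assoc_mat[of _ n n] intro!: eq_matI)
  have r: "E * E' = 1\<^sub>m n"
    unfolding E'_def using adj_mat[OF E] E c ic
    by (auto simp: mult_smult_distrib[of _ n n] intro!: eq_matI)
  have "det E' * [:c:] = 1"
    using det_mult[OF E' E] l c by simp
  then have "[:c:] * det E' = 1" by (simp add: mult.commute)
  then have "Polynomial.smult c (det E') = 1" by simp
  then have "Polynomial.smult (inverse c) (Polynomial.smult c (det E')) = Polynomial.smult (inverse c) 1" by simp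
  then have "det E' = [:inverse c:]" using c by simp
  then have "unimodular_mat_poly n E'"
    unfolding unimodular_mat_poly_def using E' c by (auto intro!: exI[of _ "inverse c"])
  then show thesis using that l r by blast
qed

lemma unimod_equiv_carrier:
  assumes "unimod_equiv n A B" shows "B \<in> carrier_mat n n"
proof -
  obtain E F where "unimodular_mat_poly n E" "unimodular_mat_poly n F" "B = E * A * F"
    using assms unfolding unimod_equiv_def by auto
  then show ?thesis using unimodular_carrier by (auto intro!: carrier_matI dest!: unimodular_carrier)
qed

lemma unimod_equiv_refl: "A \<in> carrier_mat n n \<Longrightarrow> unimod_equiv n A A"
  unfolding unimod_equiv_def using unimodular_one by (auto intro!: exI[of _ "1\<^sub>m n"])

lemma unimod_equiv_mult:
  assumes "unimod_equiv n A B" "A \<in> carrier_mat n n"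
    and "unimodular_mat_poly n E" "unimodular_mat_poly n F"
  shows "unimod_equiv n A (E * B * F)"
proof -
  obtain E' F' where u: "unimodular_mat_poly n E'" "unimodular_mat_poly n F'"
    and B: "B = E' * A * F'"
    using assms unfolding unimod_equiv_def by auto
  have c: "E' \<in> carrier_mat n n" "F' \<in> carrier_mat n n" "E \<in> carrier_mat n n" "F \<in> carrier_mat n n"
    using u assms unimodular_carrier by auto
  have "E * B * F = (E * E') * A * (F' * F)"
    unfolding B using c assms(2) by (simp add: assoc_mult_mat[of _ n n _ n _ n])
  then show ?thesis unfolding unimod_equiv_def
    using unimodular_mult u assms(3,4) by blast
qed

lemma unimod_equiv_trans:
  assumes "unimod_equiv n A B" "unimod_equiv n B C" "A \<in> carrier_mat n n"
  shows "unimod_equiv n A C"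
  using assms unimod_equiv_mult unfolding unimod_equiv_def[of n B C] by blast

lemma unimod_equiv_sym:
  assumes "unimod_equiv n A B" "A \<in> carrier_mat n n"
  shows "unimod_equiv n B A"
proof -
  obtain E F where u: "unimodular_mat_poly n E" "unimodular_mat_poly n F"
    and B: "B = E * A * F"
    using assms unfolding unimod_equiv_def by auto
  obtain E' where E': "unimodular_mat_poly n E'" "E' * E = 1\<^sub>m n"
    using unimodular_inverse[OF u(1)] by blast
  obtain F' where F': "unimodular_mat_poly n F'" "F * F' = 1\<^sub>m n"
    using unimodular_inverse[OF u(2)] by blast
  have c: "E' \<in> carrier_mat n n" "F' \<in> carrier_mat n n" "E \<in> carrier_mat n n" "F \<in> carrier_mat n n"
    using u E' F' unimodular_carrier by auto
  have "E' * B * F' = (E' * E) * A * (F * F')"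
    unfolding B using c assms(2) by (simp add: assoc_mult_mat[of _ n n _ n _ n])
  then have "A = E' * B * F'" using E' F' assms(2) by simp
  then show ?thesis unfolding unimod_equiv_def using E' F' by blast
qed

lemma unimod_equiv_transpose:
  assumes "unimod_equiv n A B" "A \<in> carrier_mat n n"
  shows "unimod_equiv n A\<^sup>T B\<^sup>T"
proof -
  obtain E F where u: "unimodular_mat_poly n E" "unimodular_mat_poly n F"
    and B: "B = E * A * F"
    using assms unfolding unimod_equiv_def by auto
  have c: "E \<in> carrier_mat n n" "F \<in> carrier_mat n n"
    using u unimodular_carrier by auto
  have "B\<^sup>T = F\<^sup>T * A\<^sup>T * E\<^sup>T"
    unfolding B using c assms(2)
    by (simp add: transpose_mult[of _ n n _ n] assoc_mult_mat[of _ n n _ n _ n])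
  then show ?thesis unfolding unimod_equiv_def
    using u unimodular_transpose by blast
qed

lemma unimod_equiv_addrow:
  assumes "unimod_equiv n A B" "A \<in> carrier_mat n n" "k \<noteq> l" "l < n"
  shows "unimod_equiv n A (addrow a k l B)"
proof -
  have B: "B \<in> carrier_mat n n" using assms(1) unimod_equiv_carrier by blast
  have "unimodular_mat_poly n (addrow_mat n a k l)"
    unfolding unimodular_mat_poly_def
    using det_addrow_mat[OF assms(3), of n a] by (auto simp: one_pCons intro!: exI[of _ 1])
  then have "unimod_equiv n A (addrow_mat n a k l * B * 1\<^sub>m n)"
    using unimod_equiv_mult[OF assms(1,2)] unimodular_one by blast
  then show ?thesis using addrow_mat[OF B assms(4), of a k] B by simp
qed

lemma unimod_equiv_swaprows:
  assumes "unimod_equiv n A B" "A \<in> carrier_mat n n" "k < n" "l < n"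
  shows "unimod_equiv n A (swaprows k l B)"
proof (cases "k = l")
  case True
  have B: "B \<in> carrier_mat n n" using assms(1) unimod_equiv_carrier by blast
  have "swaprows k l B = B" using B True by (auto intro!: eq_matI)
  then show ?thesis using assms by simp
next
  case False
  have B: "B \<in> carrier_mat n n" using assms(1) unimod_equiv_carrier by blast
  have "unimodular_mat_poly n (swaprows_mat n k l)"
    unfolding unimodular_mat_poly_def
    using det_swaprows_mat[OF assms(3,4) False, where 'a="complex poly"]
    by (auto simp: one_pCons intro!: exI[of _ "-1"])
  then have "unimod_equiv n A (swaprows_mat n k l * B * 1\<^sub>m n)"
    using unimod_equiv_mult[OF assms(1,2)] unimodular_one by blast
  then show ?thesis using swaprows_mat[OF B assms(3,4)] B by simp
qed

text \<open>One row swap and one column swap suffice; the latter is a row swap of the transpose.\<close>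

lemma unimod_equiv_move_entry_to_corner:
  assumes "unimod_equiv n A B" "A \<in> carrier_mat n n" "i < n" "j < n"
  obtains C where "unimod_equiv n A C" "C $$ (0,0) = B $$ (i,j)"
proof -
  have B: "B \<in> carrier_mat n n" using assms(1) unimod_equiv_carrier by blast
  have n: "0 < n" using assms by auto
  define B1 where "B1 = swaprows 0 i B"
  have B1: "unimod_equiv n A B1" "B1 \<in> carrier_mat n n"
    unfolding B1_def using unimod_equiv_swaprows[OF assms(1,2) n assms(3)] B by auto
  have "unimod_equiv n A\<^sup>T (swaprows 0 j B1\<^sup>T)"
    using unimod_equiv_swaprows[OF unimod_equiv_transpose[OF B1(1) assms(2)] _ n assms(4)]
      assms(2) by simp
  from unimod_equiv_transpose[OF this]
  have "unimod_equiv n A (swaprows 0 j B1\<^sup>T)\<^sup>T" using assms(2) by simp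
  moreover have "(swaprows 0 j B1\<^sup>T)\<^sup>T $$ (0,0) = B $$ (i,j)"
    using B B1 n assms(3,4) unfolding B1_def by auto
  ultimately show thesis using that by blast
qed

definition corner_minimal :: "nat \<Rightarrow> complex poly mat \<Rightarrow> complex poly mat \<Rightarrow> bool" where
  "corner_minimal n A B \<longleftrightarrow> unimod_equiv n A B \<and> B $$ (0,0) \<noteq> 0 \<and>
     (\<forall>C i j. unimod_equiv n A C \<longrightarrow> i < n \<longrightarrow> j < n \<longrightarrow> C $$ (i,j) \<noteq> 0 \<longrightarrow>
        degree (B $$ (0,0)) \<le> degree (C $$ (i,j)))"

lemma corner_minimal_exists:
  assumes A: "A \<in> carrier_mat n n" and "A \<noteq> 0\<^sub>m n n"
  obtains B where "corner_minimal n A B"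
proof -
  obtain i j where ij: "i < n" "j < n" "A $$ (i,j) \<noteq> 0"
    using assms by (metis eq_matI carrier_matD index_zero_mat)
  obtain B0 where B0: "unimod_equiv n A B0" "B0 $$ (0,0) \<noteq> 0"
    using unimod_equiv_move_entry_to_corner[OF unimod_equiv_refl[OF A] A ij(1,2)] ij(3) by metis
  define P where "P = (\<lambda>B. unimod_equiv n A B \<and> B $$ (0,0) \<noteq> 0)"
  obtain B where B: "P B" "\<And>C. P C \<Longrightarrow> degree (B $$ (0,0)) \<le> degree (C $$ (0,0))"
    using ex_has_least_nat[of P B0 "\<lambda>B. degree (B $$ (0,0))"] B0 unfolding P_def by blast
  have "degree (B $$ (0,0)) \<le> degree (C $$ (i,j))"
    if "unimod_equiv n A C" "i < n" "j < n" "C $$ (i,j) \<noteq> 0" for C i j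
    using unimod_equiv_move_entry_to_corner[OF that(1) A that(2,3)] B(2) that(4)
    unfolding P_def by metis
  then have "corner_minimal n A B"
    using B(1) unfolding corner_minimal_def P_def by blast
  then show thesis using that by blast
qed

lemma corner_minimal_transpose:
  assumes "corner_minimal n A B" "A \<in> carrier_mat n n" "0 < n"
  shows "corner_minimal n A\<^sup>T B\<^sup>T"
proof -
  have B: "unimod_equiv n A B" "B \<in> carrier_mat n n" 
    using assms unimod_equiv_carrier unfolding corner_minimal_def by auto
  have B00: "B\<^sup>T $$ (0,0) = B $$ (0,0)" using B assms(3) by auto
  have "degree (B $$ (0,0)) \<le> degree (C $$ (i,j))"
    if C: "unimod_equiv n A\<^sup>T C" "i < n" "j < n" "C $$ (i,j) \<noteq> 0" for C i j
  proof -
    have "unimod_equiv n A C\<^sup>T"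
      using unimod_equiv_transpose[OF C(1)] assms(2) by simp
    moreover have "C\<^sup>T $$ (j,i) = C $$ (i,j)"
      using C unimod_equiv_carrier[OF C(1)] by auto
    ultimately show ?thesis
      using assms(1) C unfolding corner_minimal_def by metis
  qed
  then show ?thesis using unimod_equiv_transpose[OF B(1) assms(2)] assms(1)
    unfolding corner_minimal_def B00 by blast
qed

text \<open>Division with remainder by the corner would produce an entry of smaller degree.\<close>

lemma corner_minimal_dvd_column:
  assumes "corner_minimal n A B" "A \<in> carrier_mat n n" "i < n"
  shows "B $$ (0,0) dvd B $$ (i,0)"
proof (cases "i = 0")
  case False
  let ?p = "B $$ (0,0)"
  have B: "unimod_equiv n A B" "B \<in> carrier_mat n n" "?p \<noteq> 0"
    using assms unimod_equiv_carrier unfolding corner_minimal_def by auto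
  let ?C = "addrow (- (B $$ (i,0) div ?p)) i 0 B"
  have C: "unimod_equiv n A ?C"
    using unimod_equiv_addrow[OF B(1) assms(2) False] assms(3) by auto
  have e: "?C $$ (i,0) = B $$ (i,0) mod ?p"
    using B(2) assms(3) by (simp add: minus_div_mult_eq_mod[symmetric])
  have "B $$ (i,0) mod ?p = 0"
  proof (rule ccontr)
    assume nz: "B $$ (i,0) mod ?p \<noteq> 0"
    have "?C $$ (i,0) \<noteq> 0" using nz e by metis
    then have "degree ?p \<le> degree (?C $$ (i,0))"
      using assms(1,3) C unfolding corner_minimal_def by (metis neq0_conv less_trans)
    moreover have "degree (B $$ (i,0) mod ?p) < degree ?p"
      using degree_mod_less[OF B(3), of "B $$ (i,0)"] nz by auto
    ultimately show False unfolding e by simp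
  qed
  then show ?thesis by (simp add: mod_eq_0_iff_dvd)
qed simp

lemma corner_minimal_dvd_row:
  assumes "corner_minimal n A B" "A \<in> carrier_mat n n" "j < n"
  shows "B $$ (0,0) dvd B $$ (0,j)"
proof -
  have B: "B \<in> carrier_mat n n"
    using assms unimod_equiv_carrier unfolding corner_minimal_def by auto
  show ?thesis
    using corner_minimal_dvd_column[OF corner_minimal_transpose[OF assms(1,2)] _ assms(3)]
      assms(2,3) B by auto
qed

lemma unimodular_four_block:
  assumes "unimodular_mat_poly m E1" "unimodular_mat_poly n E2"
    and "X \<in> carrier_mat n m" "Y \<in> carrier_mat m n" "X = 0\<^sub>m n m \<or> Y = 0\<^sub>m m n"
  shows "unimodular_mat_poly (m + n) (four_block_mat E1 Y X E2)"
proof -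
  have E: "E1 \<in> carrier_mat m m" "E2 \<in> carrier_mat n n"
    using assms unimodular_carrier by auto
  obtain c d where "c \<noteq> 0" "det E1 = [:c:]" "d \<noteq> 0" "det E2 = [:d:]"
    using assms unfolding unimodular_mat_poly_def by auto
  moreover have "det (four_block_mat E1 Y X E2) = det E1 * det E2"
    using assms(5)
  proof
    assume "X = 0\<^sub>m n m" then show ?thesis
      using det_four_block_mat_lower_left_zero[OF E(1) assms(4) _ E(2)] by simp
  next
    assume "Y = 0\<^sub>m m n" then show ?thesis
      using det_four_block_mat_upper_right_zero[OF E(1) _ assms(3) E(2)] by simp
  qed
  ultimately show ?thesis using E unfolding unimodular_mat_poly_def
    by (auto intro!: exI[of _ "c * d"])
qed

text \<open>As the corner divides its row and its column, one unimodular factor on each side clears them.\<close>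

lemma corner_minimal_clear:
  assumes B: "corner_minimal (Suc n) A B" and A: "A \<in> carrier_mat (Suc n) (Suc n)"
  obtains M where "M \<in> carrier_mat n n"
    "unimod_equiv (Suc n) A (four_block_mat (mat 1 1 (\<lambda>_. B $$ (0,0))) (0\<^sub>m 1 n) (0\<^sub>m n 1) M)"
proof -
  define p where "p = B $$ (0,0)"
  have Be: "unimod_equiv (Suc n) A B" and Bc: "B \<in> carrier_mat (Suc n) (Suc n)"
    using B unimod_equiv_carrier unfolding corner_minimal_def by auto
  define c where "c = mat n 1 (\<lambda>(i,_). B $$ (Suc i,0) div p)"
  define b where "b = mat 1 n (\<lambda>(_,j). B $$ (0,Suc j) div p)"
  define M0 where "M0 = mat n n (\<lambda>(i,j). B $$ (Suc i,Suc j))"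
  define P where "P = mat 1 1 (\<lambda>_. p)"
  have car: "c \<in> carrier_mat n 1" "b \<in> carrier_mat 1 n" "M0 \<in> carrier_mat n n"
    "P \<in> carrier_mat 1 1"
    unfolding c_def b_def M0_def P_def by auto
  have dc: "p dvd B $$ (i,0)" and dr: "p dvd B $$ (0,i)" if "i < Suc n" for i
    using corner_minimal_dvd_column[OF B A that] corner_minimal_dvd_row[OF B A that]
    unfolding p_def by auto
  have Bb: "B = four_block_mat P (P * b) (c * P) M0"
    using Bc dc dr unfolding P_def b_def c_def M0_def
    by (auto simp: scalar_prod_def p_def[symmetric] intro!: eq_matI)
  define E where "E = four_block_mat (1\<^sub>m 1) (0\<^sub>m 1 n) (- c) (1\<^sub>m n)"
  define F where "F = four_block_mat (1\<^sub>m 1) (- b) (0\<^sub>m n 1) (1\<^sub>m n)"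
  have uE: "unimodular_mat_poly (Suc n) E" and uF: "unimodular_mat_poly (Suc n) F"
    using unimodular_four_block[OF unimodular_one unimodular_one, of "- c" n 1 "0\<^sub>m 1 n"]
      unimodular_four_block[OF unimodular_one unimodular_one, of "0\<^sub>m n 1" n 1 "- b"] car
    unfolding E_def F_def by auto
  define M where "M = M0 - c * P * b"
  have M: "M \<in> carrier_mat n n" unfolding M_def using car by auto
  have z1: "- (c * P) + c * P = 0\<^sub>m n (Suc 0)" using car by (auto intro!: eq_matI simp: scalar_prod_def)
  have z2: "- (P * b) + P * b = 0\<^sub>m (Suc 0) n" using car by (auto intro!: eq_matI simp: scalar_prod_def)
  have z3: "- (c * (P * b)) + M0 = M" using car unfolding M_def
    by (auto intro!: eq_matI simp: scalar_prod_def)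
  have EB: "E * B = four_block_mat P (P * b) (0\<^sub>m n 1) M"
    unfolding Bb E_def using car
    by (subst mult_four_block_mat[of _ 1 1 _ n _ n _ _ 1 _ n])
      (auto simp: z1 z3)
  have "E * B * F = four_block_mat P (0\<^sub>m 1 n) (0\<^sub>m n 1) M"
    unfolding EB F_def using car M
    by (subst mult_four_block_mat[of _ 1 1 _ n _ n _ _ 1 _ n])
      (auto simp: z2)
  then have "unimod_equiv (Suc n) A (four_block_mat P (0\<^sub>m 1 n) (0\<^sub>m n 1) M)"
    using unimod_equiv_mult[OF Be A uE uF] by simp
  then show thesis using that M unfolding P_def p_def by blast
qed

text \<open>Adding a lower row to the first one keeps the corner, so minimality makes the corner divide that
  row as well.\<close>

lemma corner_minimal_split:
  assumes B: "corner_minimal (Suc n) A B" and A: "A \<in> carrier_mat (Suc n) (Suc n)"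
  obtains M where "M \<in> carrier_mat n n"
    "unimod_equiv (Suc n) A (four_block_mat (mat 1 1 (\<lambda>_. B $$ (0,0))) (0\<^sub>m 1 n) (0\<^sub>m n 1) M)"
    "\<And>i j. i < n \<Longrightarrow> j < n \<Longrightarrow> B $$ (0,0) dvd M $$ (i,j)"
proof -
  obtain M where M: "M \<in> carrier_mat n n"
    "unimod_equiv (Suc n) A (four_block_mat (mat 1 1 (\<lambda>_. B $$ (0,0))) (0\<^sub>m 1 n) (0\<^sub>m n 1) M)"
    using corner_minimal_clear[OF B A] by blast
  let ?C = "four_block_mat (mat 1 1 (\<lambda>_. B $$ (0,0))) (0\<^sub>m 1 n) (0\<^sub>m n 1) M"
  have "B $$ (0,0) dvd M $$ (i,j)" if ij: "i < n" "j < n" for i j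
  proof -
    let ?D = "addrow 1 0 (Suc i) ?C"
    have "unimod_equiv (Suc n) A ?D"
      using unimod_equiv_addrow[OF M(2) A, of 0 "Suc i"] ij by auto
    moreover have e: "?D $$ (0,0) = B $$ (0,0)" using ij M(1) by auto
    ultimately have D: "corner_minimal (Suc n) A ?D"
      using B unfolding corner_minimal_def by auto
    have "?D $$ (0,Suc j) = M $$ (i,j)" using ij M(1) by auto
    then show ?thesis
      using corner_minimal_dvd_row[OF D A, of "Suc j"] ij e by auto
  qed
  then show thesis using that M by blast
qed

lemma unimod_equiv_dvd_entries:
  assumes "unimod_equiv n A B" "A \<in> carrier_mat n n"
    and "\<And>i j. i < n \<Longrightarrow> j < n \<Longrightarrow> p dvd A $$ (i,j)" and ij: "i < n" "j < n"
  shows "p dvd B $$ (i,j)"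
proof -
  obtain E F where u: "unimodular_mat_poly n E" "unimodular_mat_poly n F"
    and B: "B = E * A * F"
    using assms unfolding unimod_equiv_def by auto
  have c: "E \<in> carrier_mat n n" "F \<in> carrier_mat n n"
    using u unimodular_carrier by auto
  have 1: "p dvd (E * A) $$ (i,j)" if "i < n" "j < n" for i j
    using c assms(2,3) that by (auto simp: scalar_prod_def intro!: dvd_sum)
  have "E * A \<in> carrier_mat n n" using c assms(2) by auto
  then show ?thesis
    unfolding B using c 1 ij by (auto simp: scalar_prod_def intro!: dvd_sum)
qed

text \<open>The constant \<open>c\<close> serves to make the corner monic.\<close>

lemma unimod_equiv_four_block:
  assumes "unimod_equiv n M D" "M \<in> carrier_mat n n" "c \<noteq> 0"
  shows "unimod_equiv (Suc n) (four_block_mat (mat 1 1 (\<lambda>_. p)) (0\<^sub>m 1 n) (0\<^sub>m n 1) M)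
    (four_block_mat (mat 1 1 (\<lambda>_. Polynomial.smult c p)) (0\<^sub>m 1 n) (0\<^sub>m n 1) D)"
proof -
  obtain E F where u: "unimodular_mat_poly n E" "unimodular_mat_poly n F"
    and D: "D = E * M * F"
    using assms unfolding unimod_equiv_def by auto
  have car: "E \<in> carrier_mat n n" "F \<in> carrier_mat n n"
    using u unimodular_carrier by auto
  define C where "C = mat 1 1 (\<lambda>_. [:c:])"
  have C: "C \<in> carrier_mat 1 1" unfolding C_def by simp
  have uC: "unimodular_mat_poly 1 C"
    unfolding unimodular_mat_poly_def using assms(3) det_single[OF C]
    by (auto simp: C_def)
  let ?E = "four_block_mat C (0\<^sub>m 1 n) (0\<^sub>m n 1) E"
  let ?F = "four_block_mat (1\<^sub>m 1) (0\<^sub>m 1 n) (0\<^sub>m n 1) F"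
  let ?M = "four_block_mat (mat 1 1 (\<lambda>_. p)) (0\<^sub>m 1 n) (0\<^sub>m n 1) M"
  have uE: "unimodular_mat_poly (Suc n) ?E"
    using unimodular_four_block[OF uC u(1), of "0\<^sub>m n 1" "0\<^sub>m 1 n"] by simp
  have uF: "unimodular_mat_poly (Suc n) ?F"
    using unimodular_four_block[OF unimodular_one u(2), of "0\<^sub>m n 1" 1 "0\<^sub>m 1 n"] by simp
  have CP: "C * mat 1 1 (\<lambda>_. p) = mat 1 1 (\<lambda>_. Polynomial.smult c p)"
    unfolding C_def by (auto intro!: eq_matI simp: scalar_prod_def)
  have "?E * ?M = four_block_mat (mat 1 1 (\<lambda>_. Polynomial.smult c p)) (0\<^sub>m 1 n) (0\<^sub>m n 1) (E * M)"
    using car C assms(2)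
    by (subst mult_four_block_mat[of _ 1 1 _ n _ n _ _ 1 _ n]) (auto simp: CP[simplified])
  moreover have "\<dots> * ?F = four_block_mat (mat 1 1 (\<lambda>_. Polynomial.smult c p)) (0\<^sub>m 1 n) (0\<^sub>m n 1) D"
    using car assms(2)
    by (subst mult_four_block_mat[of _ 1 1 _ n _ n _ _ 1 _ n]) (auto simp: D)
  ultimately show ?thesis unfolding unimod_equiv_def
    using uE uF by metis
qed

definition diag_of_list :: "nat \<Rightarrow> complex poly list \<Rightarrow> complex poly mat" where
  "diag_of_list n ds = mat_diag n (\<lambda>i. if i < length ds then ds ! i else 0)"

lemma four_block_diag_of_list:
  "four_block_mat (mat 1 1 (\<lambda>_. d)) (0\<^sub>m 1 n) (0\<^sub>m n 1) (diag_of_list n ds) =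
     diag_of_list (Suc n) (d # ds)"
  unfolding diag_of_list_def mat_diag_def by (rule eq_matI) (auto simp: nth_Cons')

text \<open>Induction on the size: the corner divides all entries of the remaining block, hence, as
  equivalence preserves common divisors of the entries, also the next diagonal entry.\<close>

lemma unimod_equiv_diagonal:
  assumes "A \<in> carrier_mat n n"
  shows "\<exists>ds. length ds \<le> n \<and> (\<forall>d \<in> set ds. lead_coeff d = 1) \<and>
     (\<forall>i. Suc i < length ds \<longrightarrow> ds ! i dvd ds ! Suc i) \<and> unimod_equiv n A (diag_of_list n ds)"
  using assms
proof (induction n arbitrary: A)
  case 0
  have "A = diag_of_list 0 []" using 0 by (auto intro!: eq_matI simp: diag_of_list_def mat_diag_def)
  then show ?case using unimod_equiv_refl[OF 0] by (intro exI[of _ "[]"]) auto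
next
  case (Suc n)
  show ?case
  proof (cases "A = 0\<^sub>m (Suc n) (Suc n)")
    case True
    have "A = diag_of_list (Suc n) []"
      using True by (auto intro!: eq_matI simp: diag_of_list_def mat_diag_def)
    then show ?thesis using unimod_equiv_refl[OF Suc.prems] by (intro exI[of _ "[]"]) auto
  next
    case False
    obtain B where B: "corner_minimal (Suc n) A B"
      using corner_minimal_exists[OF Suc.prems False] by blast
    define p where "p = B $$ (0,0)"
    obtain M where M: "M \<in> carrier_mat n n"
      "unimod_equiv (Suc n) A (four_block_mat (mat 1 1 (\<lambda>_. p)) (0\<^sub>m 1 n) (0\<^sub>m n 1) M)"
      "\<And>i j. i < n \<Longrightarrow> j < n \<Longrightarrow> p dvd M $$ (i,j)"
      using corner_minimal_split[OF B Suc.prems] unfolding p_def by blast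
    have p: "p \<noteq> 0" using B unfolding corner_minimal_def p_def by auto
    obtain ds where ds: "length ds \<le> n" "\<forall>d \<in> set ds. lead_coeff d = 1"
      "\<forall>i. Suc i < length ds \<longrightarrow> ds ! i dvd ds ! Suc i" "unimod_equiv n M (diag_of_list n ds)"
      using Suc.IH[OF M(1)] by blast
    let ?c = "inverse (lead_coeff p)"
    let ?d = "Polynomial.smult ?c p"
    have c: "?c \<noteq> 0" using p by simp
    have "unimod_equiv (Suc n) A (diag_of_list (Suc n) (?d # ds))"
      using unimod_equiv_trans[OF M(2) unimod_equiv_four_block[OF ds(4) M(1) c] Suc.prems]
      unfolding four_block_diag_of_list .
    moreover have "p dvd ds ! 0" if "0 < length ds"
    proof -
      have "p dvd diag_of_list n ds $$ (0,0)"
        using unimod_equiv_dvd_entries[OF ds(4) M(1) M(3)] that ds(1) by auto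
      then show ?thesis using that ds(1) by (auto simp: diag_of_list_def mat_diag_def)
    qed
    then have "\<forall>i. Suc i < length (?d # ds) \<longrightarrow> (?d # ds) ! i dvd (?d # ds) ! Suc i"
      using ds(3) c by (auto simp: nth_Cons smult_dvd_iff split: nat.splits)
    moreover have "lead_coeff ?d = 1" using p by simp
    ultimately show ?thesis using ds(1,2)
      by (intro exI[of _ "?d # ds"]) auto
  qed
qed

lemma smith_form_exists:
  assumes "A \<in> carrier_mat n n"
  obtains ds where "smith_form n A ds"
proof -
  obtain ds where ds: "length ds \<le> n" "\<forall>d \<in> set ds. lead_coeff d = 1"
    "\<forall>i. Suc i < length ds \<longrightarrow> ds ! i dvd ds ! Suc i" "unimod_equiv n A (diag_of_list n ds)"
    using unimod_equiv_diagonal[OF assms] by blast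
  then have "smith_form n A ds"
    using unimod_equiv_sym[OF ds(4) assms]
    unfolding smith_form_def unimod_equiv_def diag_of_list_def by auto
  then show thesis using that by blast
qed

section \<open>Rank and kernel of complex matrices\<close>

text \<open>Gaussian elimination, removing one equation and one unknown at a time.\<close>

lemma underdetermined_system:
  fixes a :: "'k \<Rightarrow> 'i \<Rightarrow> complex"
  assumes "finite K" "finite I" "card K < card I"
  shows "\<exists>c. (\<exists>i\<in>I. c i \<noteq> 0) \<and> (\<forall>k\<in>K. (\<Sum>i\<in>I. a k i * c i) = 0)"
  using assms
proof (induction K arbitrary: I a rule: finite_induct)
  case empty
  then obtain i where "i \<in> I" by fastforce
  then show ?case by (intro exI[of _ "\<lambda>_. 1"]) auto
next
  case (insert k K)
  show ?case
  proof (cases "\<forall>i\<in>I. a k i = 0")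
    case True
    obtain c where "\<exists>i\<in>I. c i \<noteq> 0" "\<forall>k\<in>K. (\<Sum>i\<in>I. a k i * c i) = 0"
      using insert.IH[of I a] insert.prems insert.hyps by auto
    then show ?thesis using True by (intro exI[of _ c]) auto
  next
    case False
    then obtain i0 where i0: "i0 \<in> I" "a k i0 \<noteq> 0" by auto
    define J where "J = I - {i0}"
    have J: "finite J" "card K < card J" "I = insert i0 J" "i0 \<notin> J"
      unfolding J_def using insert.prems insert.hyps i0 by auto
    \<comment> \<open>Eliminate the unknown \<open>i0\<close> with the equation \<open>k\<close>.\<close>
    define b where "b = (\<lambda>l i. a l i - a l i0 * a k i / a k i0)"
    obtain c where c: "\<exists>i\<in>J. c i \<noteq> 0" "\<forall>l\<in>K. (\<Sum>i\<in>J. b l i * c i) = 0"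
      using insert.IH[OF J(1,2), of b] by auto
    define s where "s = (\<Sum>i\<in>J. a k i * c i)"
    define d where "d = c(i0 := - s / a k i0)"
    have dJ: "(\<Sum>i\<in>J. a l i * d i) = (\<Sum>i\<in>J. a l i * c i)" for l
      by (rule sum.cong) (use J in \<open>auto simp: d_def\<close>)
    have "(\<Sum>i\<in>I. a l i * d i) = 0" if "l \<in> insert k K" for l
    proof -
      have e: "(\<Sum>i\<in>I. a l i * d i) = (\<Sum>i\<in>J. a l i * c i) - a l i0 * s / a k i0"
        unfolding J(3) using J(1,4) dJ by (simp add: d_def)
      show ?thesis
      proof (cases "l = k")
        case True then show ?thesis using e i0 unfolding s_def by simp
      next
        case False
        have "(\<Sum>i\<in>J. b l i * c i) = (\<Sum>i\<in>J. a l i * c i) - a l i0 / a k i0 * s"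
          unfolding s_def b_def sum_distrib_left sum_subtractf[symmetric]
          by (rule sum.cong) (auto simp: algebra_simps)
        then show ?thesis using e c(2) False that by auto
      qed
    qed
    moreover have "\<exists>i\<in>I. d i \<noteq> 0" using c(1) J by (auto simp: d_def)
    ultimately show ?thesis by blast
  qed
qed

text \<open>A maximal independent subset of the columns, as a set of column indices: equal columns may occur,
  so the basis of the column space has to be pulled back to indices.\<close>

lemma column_basis:
  fixes A :: "complex mat"
  assumes A: "A \<in> carrier_mat N N'"
  obtains J where "J \<subseteq> {..<N'}" "card J = vec_space.rank N A"
    "\<And>x j. (\<And>i. i < N \<Longrightarrow> (\<Sum>j\<in>J. A $$ (i,j) * x j) = 0) \<Longrightarrow> j \<in> J \<Longrightarrow> x j = 0"
    "\<And>l. l < N' \<Longrightarrow> \<exists>x. \<forall>i<N. A $$ (i,l) = (\<Sum>j\<in>J. A $$ (i,j) * x j)"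
proof -
  note result = that
  interpret vec_space "TYPE(complex)" N .
  let ?C = "set (cols A)"
  have C: "?C \<subseteq> carrier_vec N" using A cols_dim by blast
  obtain S where S: "maximal S (\<lambda>T. T \<subseteq> ?C \<and> lin_indpt T)"
    using maximal_exists_superset[of ?C "\<lambda>T. T \<subseteq> ?C \<and> lin_indpt T" "{}"]
    by (auto simp: lin_dep_def)
  have SC: "S \<subseteq> ?C" "lin_indpt S" using S unfolding maximal_def by auto
  have fS: "finite S" using SC finite_subset by blast
  have Sc: "S \<subseteq> carrier_vec N" using SC C by auto
  have "\<forall>s\<in>S. \<exists>j<N'. col A j = s"
    using SC(1) A by (force simp: cols_def)
  then obtain f where f: "\<And>s. s \<in> S \<Longrightarrow> f s < N' \<and> col A (f s) = s" by metis
  have inj: "inj_on f S" using f by (metis inj_on_def)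
  define J where "J = f ` S"
  have sumJ: "(\<Sum>j\<in>J. A $$ (i,j) * x j) = lincomb (\<lambda>s. x (f s)) S $ i" if "i < N" for i x
  proof -
    have "(\<Sum>j\<in>J. A $$ (i,j) * x j) = (\<Sum>s\<in>S. A $$ (i,f s) * x (f s))"
      unfolding J_def using inj by (simp add: sum.reindex)
    also have "\<dots> = (\<Sum>s\<in>S. x (f s) * s $ i)"
    proof (rule sum.cong)
      fix s assume s: "s \<in> S"
      have "col A (f s) $ i = A $$ (i, f s)"
        using f[OF s] A that by (intro index_col) auto
      then have "s $ i = A $$ (i, f s)" using f[OF s] by simp
      then show "A $$ (i,f s) * x (f s) = x (f s) * s $ i" by simp
    qed simp
    finally show ?thesis using lincomb_index[OF that Sc] by simp
  qed
  have ind: "x j = 0"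
    if zero: "\<And>i. i < N \<Longrightarrow> (\<Sum>j\<in>J. A $$ (i,j) * x j) = 0" and j: "j \<in> J" for x j
  proof (rule ccontr)
    assume nz: "x j \<noteq> 0"
    obtain s where s: "s \<in> S" "j = f s" using j unfolding J_def by auto
    have zl: "lincomb (\<lambda>s. x (f s)) S = 0\<^sub>v N"
    proof (rule eq_vecI)
      fix i assume "i < dim_vec (0\<^sub>v N :: complex vec)"
      then have i: "i < N" by simp
      show "lincomb (\<lambda>s. x (f s)) S $ i = 0\<^sub>v N $ i"
        using zero[OF i] sumJ[OF i, of x] i by simp
    qed (use lincomb_dim[OF fS Sc] in simp)
    have "lin_dep S"
      by (rule lin_dep_crit[OF fS subset_refl _ s(1) _ zl]) (use nz s(2) in simp_all)
    then show False using SC by simp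
  qed
  have span: "\<exists>x. \<forall>i<N. A $$ (i,l) = (\<Sum>j\<in>J. A $$ (i,j) * x j)" if l: "l < N'" for l
  proof -
    have lC: "col A l \<in> ?C" using A l by (auto simp: cols_def)
    have "col A l \<in> span S"
    proof (cases "col A l \<in> S")
      case True
      then show ?thesis using in_own_span[of S] Sc by (simp add: subset_iff)
    next
      case False
      have "lin_dep (S \<union> {col A l})"
        using S lC False unfolding maximal_def by blast
      then show ?thesis
        using lin_dep_iff_in_span[OF _ SC(2) _ False] Sc lC C by (simp add: subset_iff)
    qed
    then obtain a where a: "lincomb a S = col A l"
      using finite_in_span[OF fS, of "col A l"] Sc by auto
    have "A $$ (i,l) = (\<Sum>j\<in>J. A $$ (i,j) * a (the_inv_into S f j))" if i: "i < N" for i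
    proof -
      have "A $$ (i,l) = lincomb a S $ i" unfolding a using A i l by auto
      also have "\<dots> = lincomb (\<lambda>s. a (the_inv_into S f (f s))) S $ i"
        unfolding lincomb_index[OF i Sc] 
        by (rule sum.cong) (auto simp: the_inv_into_f_f[OF inj])
      finally show ?thesis using sumJ[OF i] by simp
    qed
    then show ?thesis by (intro exI[of _ "\<lambda>j. a (the_inv_into S f j)"] allI impI)
  qed
  have Jc: "card J = rank A"
    using rank_card_indpt[OF A S] card_image[OF inj] unfolding J_def by simp
  have Js: "J \<subseteq> {..<N'}" using f unfolding J_def by auto
  show thesis by (rule result[OF Js Jc]) (fact ind, fact span)
qed

text \<open>If rank and nullity together exceeded the number of columns, some nonzero kernel vector
  would be supported on a set of independent columns.\<close>

lemma rank_add_nullity_le: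
  fixes A :: "complex mat"
  assumes A: "A \<in> carrier_mat N N'"
    and ker: "\<And>s i. s < q \<Longrightarrow> i < N \<Longrightarrow> (\<Sum>l<N'. A $$ (i,l) * u s l) = 0"
    and ind: "\<And>c s. (\<And>l. l < N' \<Longrightarrow> (\<Sum>s<q. c s * u s l) = 0) \<Longrightarrow> s < q \<Longrightarrow> c s = 0"
  shows "vec_space.rank N A + q \<le> N'"
proof (rule ccontr)
  assume less: "\<not> ?thesis"
  obtain J where J: "J \<subseteq> {..<N'}" "card J = vec_space.rank N A"
    "\<And>x j. (\<And>i. i < N \<Longrightarrow> (\<Sum>j\<in>J. A $$ (i,j) * x j) = 0) \<Longrightarrow> j \<in> J \<Longrightarrow> x j = 0"
    using column_basis[OF A] by metis
  have "card ({..<N'} - J) < q"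
    using J(1,2) less card_mono[OF _ J(1)]
    by (simp add: card_Diff_subset finite_subset[OF J(1)])
  then obtain c where c: "\<exists>s\<in>{..<q}. c s \<noteq> 0"
    "\<forall>l\<in>{..<N'} - J. (\<Sum>s<q. u s l * c s) = 0"
    using underdetermined_system[of "{..<N'} - J" "{..<q}" "\<lambda>l s. u s l"] by auto
  define w where "w = (\<lambda>l. \<Sum>s<q. u s l * c s)"
  have "(\<Sum>j\<in>J. A $$ (i,j) * w j) = 0" if "i < N" for i
  proof -
    have "(\<Sum>j\<in>J. A $$ (i,j) * w j) = (\<Sum>j<N'. A $$ (i,j) * w j)"
      by (rule sum.mono_neutral_left) (use J c in \<open>auto simp: w_def\<close>)
    also have "\<dots> = (\<Sum>j<N'. \<Sum>s<q. c s * (A $$ (i,j) * u s j))"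
      unfolding w_def sum_distrib_left by (simp add: ac_simps)
    also have "\<dots> = (\<Sum>s<q. \<Sum>j<N'. c s * (A $$ (i,j) * u s j))"
      by (rule sum.swap)
    also have "\<dots> = (\<Sum>s<q. c s * (\<Sum>j<N'. A $$ (i,j) * u s j))"
      by (simp add: sum_distrib_left)
    also have "\<dots> = 0" using ker that by simp
    finally show ?thesis .
  qed
  then have "w j = 0" if "j \<in> J" for j using J(3) that by blast
  then have "w l = 0" if "l < N'" for l using c(2) that by (cases "l \<in> J") (auto simp: w_def)
  then have "c s = 0" if "s < q" for s
    using ind[of c s] that unfolding w_def by (simp add: mult.commute)
  then show False using c(1) by auto
qed

text \<open>Each column outside a column basis yields a kernel vector with a private nonzero entry;
  fewer linear conditions than such columns leave a nonzero combination.\<close>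

lemma kernel_vector_with_constraints:
  fixes A :: "complex mat" and \<phi> :: "nat \<Rightarrow> nat \<Rightarrow> complex"
  assumes A: "A \<in> carrier_mat N N'" and less: "vec_space.rank N A + m < N'"
  obtains w where "\<exists>l<N'. w l \<noteq> 0" "\<And>i. i < N \<Longrightarrow> (\<Sum>l<N'. A $$ (i,l) * w l) = 0"
    "\<And>k. k < m \<Longrightarrow> (\<Sum>l<N'. \<phi> k l * w l) = 0"
proof -
  obtain J where J: "J \<subseteq> {..<N'}" "card J = vec_space.rank N A"
    "\<And>l. l < N' \<Longrightarrow> \<exists>x. \<forall>i<N. A $$ (i,l) = (\<Sum>j\<in>J. A $$ (i,j) * x j)"
    using column_basis[OF A] by metis
  obtain x where x: "\<And>l i. l < N' \<Longrightarrow> i < N \<Longrightarrow> A $$ (i,l) = (\<Sum>j\<in>J. A $$ (i,j) * x l j)"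
    using J(3) by metis
  define I where "I = {..<N'} - J"
  have I: "finite I" "m < card I" "{..<N'} = I \<union> J" "I \<inter> J = {}" "finite J"
    using J(1,2) less unfolding I_def
    by (auto simp: card_Diff_subset finite_subset[OF J(1)])
  define a where "a = (\<lambda>k l. \<phi> k l - (\<Sum>j\<in>J. \<phi> k j * x l j))"
  obtain c where c: "\<exists>i\<in>I. c i \<noteq> 0" "\<forall>k\<in>{..<m}. (\<Sum>i\<in>I. a k i * c i) = 0"
    using underdetermined_system[of "{..<m}" I a] I by auto
  define w where "w = (\<lambda>l. if l \<in> I then c l else - (\<Sum>i\<in>I. x i l * c i))"
  have key: "(\<Sum>l<N'. \<psi> l * w l) = (\<Sum>i\<in>I. (\<psi> i - (\<Sum>j\<in>J. \<psi> j * x i j)) * c i)" for \<psi>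
  proof -
    have "(\<Sum>l<N'. \<psi> l * w l) = (\<Sum>l\<in>I. \<psi> l * w l) + (\<Sum>l\<in>J. \<psi> l * w l)"
      unfolding I(3) using I by (simp add: sum.union_disjoint)
    also have "(\<Sum>l\<in>J. \<psi> l * w l) = (\<Sum>l\<in>J. - (\<Sum>i\<in>I. \<psi> l * x i l * c i))"
      by (rule sum.cong) (use I in \<open>auto simp: w_def sum_distrib_left mult.assoc\<close>)
    also have "\<dots> = - (\<Sum>i\<in>I. \<Sum>l\<in>J. \<psi> l * x i l * c i)"
      unfolding sum_negf by (subst sum.swap) simp
    also have "(\<Sum>l\<in>I. \<psi> l * w l) = (\<Sum>l\<in>I. \<psi> l * c l)"
      by (rule sum.cong) (auto simp: w_def)
    finally show ?thesis
      by (simp add: left_diff_distrib sum_subtractf sum_distrib_right)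
  qed
  have "\<exists>l<N'. w l \<noteq> 0" using c(1) unfolding w_def I_def by auto
  moreover have "(\<Sum>l<N'. A $$ (i,l) * w l) = 0" if "i < N" for i
  proof -
    have "A $$ (i,l) - (\<Sum>j\<in>J. A $$ (i,j) * x l j) = 0" if "l \<in> I" for l
      using x[of l i] \<open>i < N\<close> that unfolding I_def by auto
    then show ?thesis unfolding key by simp
  qed
  moreover have "(\<Sum>l<N'. \<phi> k l * w l) = 0" if "k < m" for k
    unfolding key using c(2) that unfolding a_def by simp
  ultimately show thesis using that by blast
qed

section \<open>Splitting a root off the determinant\<close>

text \<open>Both sides are the determinant of the block matrix with blocks \<open>I, -u, w, 1\<close>, cleared by row
  operations in two ways.\<close>

lemma det_one_plus_rank_one:
  fixes u w :: "nat \<Rightarrow> 'a :: idom"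
  shows "det (mat n n (\<lambda>(a,b). (if a = b then 1 else 0) + u a * w b)) = 1 + (\<Sum>a<n. w a * u a)"
proof -
  define U where "U = mat n 1 (\<lambda>(a,_). u a)"
  define V where "V = mat 1 n (\<lambda>(_,b). w b)"
  have U: "U \<in> carrier_mat n 1" and V: "V \<in> carrier_mat 1 n" unfolding U_def V_def by auto
  let ?M = "four_block_mat (1\<^sub>m n) (- U) V (1\<^sub>m 1)"
  let ?L = "four_block_mat (1\<^sub>m n) (0\<^sub>m n 1) (- V) (1\<^sub>m 1)"
  let ?R = "four_block_mat (1\<^sub>m n) U (0\<^sub>m 1 n) (1\<^sub>m 1)"
  have M: "?M \<in> carrier_mat (n + 1) (n + 1)" and L: "?L \<in> carrier_mat (n + 1) (n + 1)"
    and R: "?R \<in> carrier_mat (n + 1) (n + 1)" using U V by auto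
  have dL: "det ?L = 1" 
    using det_four_block_mat_upper_right_zero[of "1\<^sub>m n" n "0\<^sub>m n 1" 1 "- V" "1\<^sub>m 1"] V by simp
  have dR: "det ?R = 1" 
    using det_four_block_mat_lower_left_zero[of "1\<^sub>m n" n U 1 "0\<^sub>m 1 n" "1\<^sub>m 1"] U by simp
  have LM: "?L * ?M = four_block_mat (1\<^sub>m n) (- U) (0\<^sub>m 1 n) (V * U + 1\<^sub>m 1)"
    using U V by (subst mult_four_block_mat[of _ n n _ 1 _ 1 _ _ n _ 1]) auto
  have RM: "?R * ?M = four_block_mat (U * V + 1\<^sub>m n) (0\<^sub>m n 1) V (1\<^sub>m 1)"
    using U V 
    by (subst mult_four_block_mat[of _ n n _ 1 _ 1 _ _ n _ 1]) 
      (auto simp: comm_add_mat[of "1\<^sub>m n" n n])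
  have "det ?M = det (V * U + 1\<^sub>m 1)"
    using det_mult[OF L M] dL U V unfolding LM
    by (subst (asm) det_four_block_mat_lower_left_zero[of _ n _ 1]) auto
  moreover have "det ?M = det (U * V + 1\<^sub>m n)"
    using det_mult[OF R M] dR U V unfolding RM
    by (subst (asm) det_four_block_mat_upper_right_zero[of _ n _ 1]) auto
  moreover have "det (V * U + 1\<^sub>m 1) = 1 + (\<Sum>a<n. w a * u a)"
  proof -
    have "V * U + 1\<^sub>m 1 \<in> carrier_mat 1 1" using U V by auto
    from det_single[OF this] show ?thesis
      unfolding U_def V_def by (simp add: scalar_prod_def atLeast0LessThan)
  qed
  moreover have "U * V + 1\<^sub>m n = mat n n (\<lambda>(a,b). (if a = b then 1 else 0) + u a * w b)"
    unfolding U_def V_def by (rule eq_matI) (auto simp: scalar_prod_def)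
  ultimately show ?thesis by simp
qed

text \<open>For \<open>f \<bullet> v = 1\<close> this is similar to the diagonal matrix with entries \<open>x - \<nu>, 1, \<dots>, 1\<close>:
  it scales \<open>v\<close> by \<open>x - \<nu>\<close> and fixes the kernel of the functional \<open>f\<close>.\<close>

definition elementary_factor ::
  "nat \<Rightarrow> (nat \<Rightarrow> complex) \<Rightarrow> (nat \<Rightarrow> complex) \<Rightarrow> complex \<Rightarrow> complex poly mat" where
  "elementary_factor n v f \<nu> =
     mat n n (\<lambda>(a,b). (if a = b then 1 else 0) + ([:-\<nu>, 1:] - 1) * [:v a:] * [:f b:])"

lemma elementary_factor_carrier [simp]: "elementary_factor n v f \<nu> \<in> carrier_mat n n"
  unfolding elementary_factor_def by simp

lemma constant_pairing:
  fixes f v :: "nat \<Rightarrow> complex"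
  assumes "(\<Sum>b<n. f b * v b) = 1"
  shows "(\<Sum>b<n. [:f b:] * [:v b:]) = 1"
proof -
  have "(\<Sum>b<n. [:f b:] * [:v b:]) = [:\<Sum>b<n. f b * v b:]" by (induction n) auto
  then show ?thesis using assms by (simp add: one_pCons)
qed

lemma det_elementary_factor:
  assumes "(\<Sum>a<n. f a * v a) = 1"
  shows "det (elementary_factor n v f \<nu>) = [:-\<nu>, 1:]"
proof -
  have "(\<Sum>a<n. [:f a:] * (([:-\<nu>, 1:] - 1) * [:v a:])) =
      ([:-\<nu>, 1:] - 1) * (\<Sum>a<n. [:f a:] * [:v a:])"
    unfolding sum_distrib_left by (rule sum.cong) (auto simp: algebra_simps)
  also have "\<dots> = [:-\<nu>, 1:] - 1" unfolding constant_pairing[OF assms] by simp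
  finally show ?thesis
    unfolding elementary_factor_def
    using det_one_plus_rank_one[of n "\<lambda>a. ([:-\<nu>, 1:] - 1) * [:v a:]" "\<lambda>b. [:f b:]"]
    by (simp add: one_pCons)
qed

text \<open>Dividing \<open>Q\<close> from the right by the elementary factor at \<open>\<mu>\<close> gives \<open>Q + (1 / (x - \<mu>) - 1) Q v f\<close>,
  which is polynomial because \<open>x - \<mu>\<close> divides \<open>Q v\<close>; multiplying by the factor at \<open>\<nu>\<close> instead
  then changes \<open>Q\<close> by \<open>(\<mu> - \<nu>) R f\<close>.\<close>

lemma split_off_root:
  assumes Q: "Q \<in> carrier_mat n n"
    and fv: "(\<Sum>b<n. f b * v b) = (1 :: complex)"
    and R: "\<And>a. a < n \<Longrightarrow> (\<Sum>b<n. Q $$ (a,b) * [:v b:]) = [:-\<mu>, 1:] * R a"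
  obtains H where "H \<in> carrier_mat n n" "Q = H * elementary_factor n v f \<mu>"
    "\<And>\<nu>. H * elementary_factor n v f \<nu> =
       mat n n (\<lambda>(a,b). Q $$ (a,b) + [:\<mu> - \<nu>:] * R a * [:f b:])"
proof -
  define H where "H = mat n n (\<lambda>(a,b). Q $$ (a,b) + (1 - [:-\<mu>, 1:]) * R a * [:f b:])"
  have H: "H \<in> carrier_mat n n" unfolding H_def by simp
  note fv' = constant_pairing[OF fv]
  have Hv: "(\<Sum>b<n. H $$ (a,b) * [:v b:]) = R a" if "a < n" for a
  proof -
    have "(\<Sum>b<n. H $$ (a,b) * [:v b:]) =
        (\<Sum>b<n. Q $$ (a,b) * [:v b:]) + (1 - [:-\<mu>, 1:]) * R a * (\<Sum>b<n. [:f b:] * [:v b:])"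
      unfolding sum_distrib_left sum.distrib[symmetric]
      by (rule sum.cong) (use that in \<open>auto simp: H_def algebra_simps Polynomial.smult_add_right\<close>)
    also have "\<dots> = R a" unfolding R[OF that] fv' by (simp add: algebra_simps)
    finally show ?thesis .
  qed
  have ring: "q + (1 - X) * r * y + (Y - 1) * y * r = q + (Y - X) * r * y"
    for q X Y r y :: "complex poly" by (simp add: algebra_simps)
  have main: "(H * elementary_factor n v f \<nu>) $$ (a,b) = Q $$ (a,b) + [:\<mu> - \<nu>:] * R a * [:f b:]"
    if ab: "a < n" "b < n" for a b \<nu>
  proof -
    have "(H * elementary_factor n v f \<nu>) $$ (a,b) =
        (\<Sum>c<n. H $$ (a,c) * ((if c = b then 1 else 0) + ([:-\<nu>, 1:] - 1) * [:v c:] * [:f b:]))"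
      using H ab unfolding elementary_factor_def
      by (simp add: scalar_prod_def atLeast0LessThan)
    also have "\<dots> = (\<Sum>c<n. H $$ (a,c) * (if c = b then 1 else 0))
        + ([:-\<nu>, 1:] - 1) * [:f b:] * (\<Sum>c<n. H $$ (a,c) * [:v c:])"
      unfolding sum_distrib_left sum.distrib[symmetric]
      by (rule sum.cong) (auto simp: algebra_simps)
    also have "(\<Sum>c<n. H $$ (a,c) * (if c = b then 1 else 0)) = H $$ (a,b)"
      using ab by (simp add: if_distrib[of "\<lambda>x. _ * x"] cong: if_cong)
    also have "H $$ (a,b) + ([:-\<nu>, 1:] - 1) * [:f b:] * (\<Sum>c<n. H $$ (a,c) * [:v c:]) =
        Q $$ (a,b) + ([:-\<nu>, 1:] - [:-\<mu>, 1:]) * R a * [:f b:]"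
      unfolding Hv[OF ab(1)] unfolding H_def
      by (simp only: index_mat(1)[OF ab] case_prod_conv ring)
    also have "[:-\<nu>, 1:] - [:-\<mu>, 1:] = [:\<mu> - \<nu>:]" by simp
    finally show ?thesis .
  qed
  have HE: "H * elementary_factor n v f \<nu> \<in> carrier_mat n n" for \<nu>
    by (rule mult_carrier_mat[OF H elementary_factor_carrier])
  have "Q = H * elementary_factor n v f \<mu>"
    using main[of _ _ \<mu>] Q carrier_matD[OF HE]
    by (intro eq_matI) (auto simp del: index_mult_mat)
  moreover have "H * elementary_factor n v f \<nu> =
       mat n n (\<lambda>(a,b). Q $$ (a,b) + [:\<mu> - \<nu>:] * R a * [:f b:])" for \<nu>
    using main[of _ _ \<nu>] carrier_matD[OF HE]
    by (intro eq_matI) (auto simp del: index_mult_mat)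
  ultimately show thesis using that H by blast
qed

lemma det_root_kernel_vector:
  fixes Q :: "complex poly mat"
  assumes Q: "Q \<in> carrier_mat n n" and "poly (det Q) \<mu> = 0"
  obtains v where "\<exists>b<n. v b \<noteq> 0" "\<And>a. a < n \<Longrightarrow> [:-\<mu>, 1:] dvd (\<Sum>b<n. Q $$ (a,b) * [:v b:])"
proof -
  interpret ph: comm_ring_hom "\<lambda>p :: complex poly. poly p \<mu>" by standard auto
  let ?M = "map_mat (\<lambda>p. poly p \<mu>) Q"
  have "det ?M = 0" using assms by simp
  moreover have M: "?M \<in> carrier_mat n n" using Q by simp
  ultimately obtain v where v: "v \<in> carrier_vec n" "v \<noteq> 0\<^sub>v n" "?M *\<^sub>v v = 0\<^sub>v n"
    using det_0_iff_vec_prod_zero[OF M] by auto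
  have "[:-\<mu>, 1:] dvd (\<Sum>b<n. Q $$ (a,b) * [:v $ b:])" if a: "a < n" for a
  proof -
    have "(\<Sum>b<n. poly (Q $$ (a,b)) \<mu> * v $ b) = (?M *\<^sub>v v) $ a"
      using a Q v(1) by (simp add: scalar_prod_def atLeast0LessThan)
    also have "\<dots> = 0" using v(3) a by simp
    finally have "poly (\<Sum>b<n. Q $$ (a,b) * [:v $ b:]) \<mu> = 0" by (simp add: poly_sum mult.commute)
    then show ?thesis by (simp add: poly_eq_0_iff_dvd)
  qed
  moreover have "\<exists>b<n. v $ b \<noteq> 0" using v(1,2) by (auto simp: vec_eq_iff)
  ultimately show thesis using that[of "\<lambda>b. v $ b"] by blast
qed

section \<open>The block Toeplitz matrix as multiplication of truncated power series\<close>

lemma linear_power_dvd_mult_cancel: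
  fixes p q :: "complex poly"
  assumes "[:-z, 1:] ^ m dvd p * q" "poly q z \<noteq> 0"
  shows "[:-z, 1:] ^ m dvd p"
proof (cases "p = 0")
  case False
  have "q \<noteq> 0" "order z q = 0" using assms(2) by (auto simp: order_root)
  then show ?thesis using assms(1) False
    by (simp add: order_divides order_mult)
qed simp

lemma taylor_coeff:
  fixes p :: "complex poly"
  shows "poly ((pderiv ^^ m) p) z / fact m = coeff (pcompose p [:z, 1:]) m"
proof -
  have "(pderiv ^^ m) (pcompose p [:z, 1:]) = pcompose ((pderiv ^^ m) p) [:z, 1:]"
    by (induction m) (simp_all add: pderiv_pcompose pderiv_pCons)
  then have "poly ((pderiv ^^ m) p) z = poly ((pderiv ^^ m) (pcompose p [:z, 1:])) 0"
    by (simp add: poly_pcompose)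
  also have "\<dots> = coeff ((pderiv ^^ m) (pcompose p [:z, 1:])) 0"
    by (simp add: poly_0_coeff_0)
  also have "\<dots> = fact m * coeff (pcompose p [:z, 1:]) m"
    unfolding coeff_higher_pderiv by (simp add: pochhammer_fact)
  finally show ?thesis by simp
qed

definition shift_mat :: "complex \<Rightarrow> complex poly mat \<Rightarrow> complex poly mat" where
  "shift_mat z Q = map_mat (\<lambda>p. pcompose p [:z, 1:]) Q"

lemma shift_mat_carrier [simp]: "shift_mat z Q \<in> carrier_mat n m \<longleftrightarrow> Q \<in> carrier_mat n m"
  unfolding shift_mat_def by auto

lemma shift_mat_index:
  assumes "Q \<in> carrier_mat n m" "a < n" "b < m"
  shows "shift_mat z Q $$ (a,b) = pcompose (Q $$ (a,b)) [:z, 1:]"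
  using assms unfolding shift_mat_def by auto

lemma pcompose_linear_power: "pcompose ([:-z, 1:] ^ m :: complex poly) [:z, 1:] = [:0, 1:] ^ m"
proof (induction m)
  case (Suc m)
  have "pcompose [:-z, 1:] [:z, 1:] = [:0, 1 :: complex:]" by (simp add: pcompose_pCons)
  then show ?case using Suc by (simp only: power_Suc pcompose_mult)
qed (simp add: pcompose_1)

lemma det_shift_mat: "det (shift_mat z Q) = pcompose (det Q) [:z, 1:]"
proof -
  interpret ph: comm_ring_hom "\<lambda>p :: complex poly. pcompose p [:z, 1:]"
    by standard (auto simp: pcompose_add pcompose_mult pcompose_1)
  show ?thesis unfolding shift_mat_def by simp
qed

lemma block_index_less:
  assumes "j \<le> r" "b < n" shows "j * n + b < (r + 1) * (n :: nat)"
proof -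
  have "j * n + b < (j + 1) * n" using assms(2) by simp
  also have "\<dots> \<le> (r + 1) * n" by (rule mult_le_mono1) (use assms(1) in simp)
  finally show ?thesis .
qed

text \<open>The block Toeplitz matrix represents multiplication by the Taylor expansion of \<open>Q\<close> at
  \<open>z\<close>, modulo \<open>x\<^bsup>r+1\<^esup>\<close>.\<close>

lemma block_toeplitz_mult:
  assumes Q: "Q \<in> carrier_mat n n" and i: "i \<le> r" and a: "a < n"
    and X: "\<And>j b. j \<le> r \<Longrightarrow> b < n \<Longrightarrow> coeff (X b) j = w (j * n + b)"
  shows "(\<Sum>l<(r + 1) * n. block_toeplitz n r Q z $$ (i * n + a, l) * w l) =
    coeff (\<Sum>b<n. shift_mat z Q $$ (a,b) * X b) i"
proof -
  let ?T = "block_toeplitz n r Q z"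
  have ia: "i * n + a < (r + 1) * n" by (rule block_index_less[OF i a])
  have T: "?T $$ (i * n + a, j * n + b) =
      (if j \<le> i then coeff (shift_mat z Q $$ (a,b)) (i - j) else 0)"
    if "j \<le> r" "b < n" for j b
  proof -
    have "j * n + b < (r + 1) * n" by (rule block_index_less[OF that])
    then show ?thesis
      using ia a that Q unfolding block_toeplitz_def mat_poly_deriv_at_def shift_mat_def
      by (simp add: Let_def taylor_coeff)
  qed
  have "(\<Sum>l<(r + 1) * n. ?T $$ (i * n + a, l) * w l) =
      (\<Sum>j<r + 1. \<Sum>l\<in>{j * n..<j * n + n}. ?T $$ (i * n + a, l) * w l)"
    by (rule sum.nat_group[symmetric])
  also have "\<dots> = (\<Sum>j<r + 1. \<Sum>b<n. ?T $$ (i * n + a, j * n + b) * w (j * n + b))"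
    by (rule sum.cong[OF refl], subst sum.atLeastLessThan_shift_0)
      (auto simp: atLeast0LessThan add.commute)
  also have "\<dots> = (\<Sum>j<r + 1. \<Sum>b<n.
      (if j \<le> i then coeff (shift_mat z Q $$ (a,b)) (i - j) * coeff (X b) j else 0))"
    by (intro sum.cong refl) (auto simp: T X)
  also have "\<dots> = (\<Sum>j\<le>i. \<Sum>b<n. coeff (shift_mat z Q $$ (a,b)) (i - j) * coeff (X b) j)"
    using i by (intro sum.mono_neutral_cong_right) auto
  also have "\<dots> = (\<Sum>b<n. \<Sum>j\<le>i. coeff (X b) j * coeff (shift_mat z Q $$ (a,b)) (i - j))"
    by (subst sum.swap) (simp add: mult.commute)
  also have "\<dots> = coeff (\<Sum>b<n. X b * shift_mat z Q $$ (a,b)) i"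
    by (simp add: coeff_sum coeff_mult)
  finally show ?thesis by (simp add: mult.commute)
qed

lemma index_div_mod_less:
  assumes "l < (r + 1) * (n :: nat)"
  shows "l div n \<le> r" "l mod n < n" "l = l div n * n + l mod n"
proof -
  have n: "n > 0" using assms by (cases n) auto
  show "l div n \<le> r" using less_mult_imp_div_less[OF assms] by simp
  show "l mod n < n" using n by simp
  show "l = l div n * n + l mod n" by simp
qed

text \<open>The multiples of \<open>X\<close> by \<open>1, x - z, \<dots>, (x - z)\<^sup>r\<close> give \<open>r + 1\<close> independent kernel vectors. When the
  Smith form has a diagonal entry divisible by \<open>(x - z)\<^bsup>r+1\<^esup>\<close>, the corresponding column of the
  inverse of its right factor is such an \<open>X\<close>.\<close>

lemma rank_block_toeplitz_le:
  assumes Q: "Q \<in> carrier_mat n n"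
    and X: "\<And>a. a < n \<Longrightarrow> [:-z, 1:] ^ (r + 1) dvd (\<Sum>b<n. Q $$ (a,b) * X b)"
    and nz: "b0 < n" "poly (X b0) z \<noteq> 0"
  shows "vec_space.rank ((r + 1) * n) (block_toeplitz n r Q z) \<le> (r + 1) * (n - 1)"
proof -
  let ?N = "(r + 1) * n" and ?T = "block_toeplitz n r Q z"
  define Y where "Y = (\<lambda>b. pcompose (X b) [:z, 1:])"
  define u where "u = (\<lambda>s l. coeff (monom 1 s * Y (l mod n)) (l div n))"
  have T: "?T \<in> carrier_mat ?N ?N" unfolding block_toeplitz_def by simp
  have QY: "monom 1 (r + 1) dvd (\<Sum>b<n. shift_mat z Q $$ (a,b) * Y b)" if a: "a < n" for a
  proof -
    obtain g where g: "(\<Sum>b<n. Q $$ (a,b) * X b) = [:-z, 1:] ^ (r + 1) * g"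
      using X[OF a] by auto
    have "(\<Sum>b<n. shift_mat z Q $$ (a,b) * Y b) = pcompose (\<Sum>b<n. Q $$ (a,b) * X b) [:z, 1:]"
      unfolding pcompose_sum pcompose_mult Y_def
      by (rule sum.cong) (use a Q in \<open>auto simp: shift_mat_index\<close>)
    also have "\<dots> = [:0, 1:] ^ (r + 1) * pcompose g [:z, 1:]"
      unfolding g pcompose_mult pcompose_linear_power ..
    also have "[:0, 1:] ^ (r + 1) = (monom 1 (r + 1) :: complex poly)" 
      by (simp only: monom_altdef smult_1_left)
    finally show ?thesis by simp
  qed
  have "vec_space.rank ?N ?T + (r + 1) \<le> ?N"
  proof (rule rank_add_nullity_le[OF T, where u = u])
    fix s l assume s: "s < r + 1" and l: "l < ?N"
    note dm = index_div_mod_less[OF l]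
    have "(\<Sum>k<?N. ?T $$ (l div n * n + l mod n, k) * u s k) =
        coeff (\<Sum>b<n. shift_mat z Q $$ (l mod n, b) * (monom 1 s * Y b)) (l div n)"
      by (rule block_toeplitz_mult[OF Q dm(1,2)]) (simp add: u_def)
    also have "(\<Sum>b<n. shift_mat z Q $$ (l mod n, b) * (monom 1 s * Y b)) =
        monom 1 s * (\<Sum>b<n. shift_mat z Q $$ (l mod n, b) * Y b)"
      unfolding sum_distrib_left by (rule sum.cong) (auto simp: ac_simps)
    also have "coeff \<dots> (l div n) = 0"
      using QY[OF dm(2)] dm(1) unfolding monom_1_dvd_iff' by (simp add: coeff_monom_mult)
    finally show "(\<Sum>k<?N. ?T $$ (l, k) * u s k) = 0" by simp
  next
    fix c s assume zero: "\<And>l. l < ?N \<Longrightarrow> (\<Sum>s<r + 1. c s * u s l) = 0" and s: "s < r + 1"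
    define C where "C = (\<Sum>s<r + 1. monom (c s) s)"
    have "coeff (C * Y b0) j = 0" if j: "j < r + 1" for j
    proof -
      have l: "j * n + b0 < ?N" by (rule block_index_less) (use j nz in auto)
      have "coeff (C * Y b0) j = (\<Sum>s<r + 1. c s * u s (j * n + b0))"
        unfolding C_def sum_distrib_right coeff_sum
        by (rule sum.cong) (use nz in \<open>auto simp: u_def coeff_monom_mult\<close>)
      then show ?thesis using zero[OF l] by simp
    qed
    then have "monom 1 (r + 1) dvd C * Y b0" unfolding monom_1_dvd_iff' by simp
    then have "[:-0, 1:] ^ (r + 1) dvd C * Y b0" 
      by (simp only: monom_altdef smult_1_left minus_zero)
    moreover have "poly (Y b0) 0 \<noteq> 0" using nz unfolding Y_def by (simp add: poly_pcompose)
    ultimately have "[:-0, 1:] ^ (r + 1) dvd C" by (rule linear_power_dvd_mult_cancel)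
    then have "monom 1 (r + 1) dvd C" by (simp only: monom_altdef smult_1_left minus_zero)
    then have "coeff C s = 0" using s unfolding monom_1_dvd_iff' by simp
    moreover have "coeff C s = c s" using s unfolding C_def by (simp add: coeff_sum sum.delta)
    ultimately show "c s = 0" by simp
  qed
  then show ?thesis by (cases n) auto
qed

lemma mat_prod_index_sum:
  fixes A B :: "'a :: comm_ring_1 mat"
  assumes "A \<in> carrier_mat n m" "B \<in> carrier_mat m k" "a < n" "b < k"
  shows "(A * B) $$ (a,b) = (\<Sum>c<m. A $$ (a,c) * B $$ (c,b))"
  using assms by (simp add: scalar_prod_def atLeast0LessThan)

lemma mat_prod_apply_sum:
  fixes A B :: "'a :: comm_ring_1 mat"
  assumes "A \<in> carrier_mat n m" "B \<in> carrier_mat m k" "a < n"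
  shows "(\<Sum>b<k. (A * B) $$ (a,b) * X b) = (\<Sum>c<m. A $$ (a,c) * (\<Sum>b<k. B $$ (c,b) * X b))"
proof -
  have "(\<Sum>b<k. (A * B) $$ (a,b) * X b) = (\<Sum>b<k. \<Sum>c<m. A $$ (a,c) * (B $$ (c,b) * X b))"
    by (rule sum.cong) (use assms in \<open>auto simp: mat_prod_index_sum sum_distrib_right mult.assoc
      simp del: index_mult_mat\<close>)
  also have "\<dots> = (\<Sum>c<m. \<Sum>b<k. A $$ (a,c) * (B $$ (c,b) * X b))" by (rule sum.swap)
  finally show ?thesis by (simp add: sum_distrib_left)
qed

definition linear_on_vectors :: "((nat \<Rightarrow> complex poly) \<Rightarrow> complex) \<Rightarrow> bool" where
  "linear_on_vectors L \<longleftrightarrow>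
     (\<forall>(I :: nat set) c X. finite I \<longrightarrow>
       L (\<lambda>b. \<Sum>i\<in>I. [:c i:] * X i b) = (\<Sum>i\<in>I. c i * L (X i)))"

text \<open>Each root at \<open>0\<close> of the determinant contributes one linear condition, because an elementary
  factor \<open>W\<close> raises the nullity of \<open>X \<mapsto> Q X mod x\<^bsup>r+1\<^esup>\<close> by at most one: \<open>W X = 0\<close> modulo
  \<open>x\<^bsup>r+1\<^esup>\<close> leaves only the coefficient of \<open>x\<^sup>r\<close> in \<open>f \<bullet> X\<close> undetermined.\<close>

lemma solutions_determined_by_constraints:
  assumes "Q \<in> carrier_mat n n" "det Q = [:0, 1:] ^ m * h" "poly h 0 \<noteq> 0"
  shows "\<exists>L. (\<forall>k<m. linear_on_vectors (L k)) \<and>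
    (\<forall>X. (\<forall>a<n. [:0, 1:] ^ (r + 1) dvd (\<Sum>b<n. Q $$ (a,b) * X b)) \<longrightarrow> (\<forall>k<m. L k X = 0) \<longrightarrow>
       (\<forall>b<n. [:0, 1:] ^ (r + 1) dvd X b))"
  using assms(1,2)
proof (induction m arbitrary: Q)
  case 0
  note Q = 0(1)
  have claim: "[:0, 1:] ^ (r + 1) dvd X b"
    if X: "\<forall>a<n. [:0, 1:] ^ (r + 1) dvd (\<Sum>b<n. Q $$ (a,b) * X b)" and b: "b < n" for X b
  proof -
    have "(\<Sum>a<n. adj_mat Q $$ (b,a) * (\<Sum>c<n. Q $$ (a,c) * X c)) =
        (\<Sum>c<n. (adj_mat Q * Q) $$ (b,c) * X c)"
      by (rule mat_prod_apply_sum[symmetric]) (use adj_mat[OF Q] Q b in auto)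
    also have "\<dots> = (\<Sum>c<n. (if b = c then det Q * X c else 0))"
      unfolding adj_mat(3)[OF Q] by (rule sum.cong) (use b in auto)
    also have "\<dots> = X b * h" using b 0(2) by (simp add: mult.commute)
    finally have "X b * h = (\<Sum>a<n. adj_mat Q $$ (b,a) * (\<Sum>c<n. Q $$ (a,c) * X c))" by simp
    moreover have "[:0, 1:] ^ (r + 1) dvd \<dots>"
      by (rule dvd_sum, rule dvd_mult) (use X in blast)
    ultimately have "[:-0, 1:] ^ (r + 1) dvd X b * h" by simp
    then have "[:-0, 1:] ^ (r + 1) dvd X b"
      by (rule linear_power_dvd_mult_cancel) (use assms(3) in simp)
    then show ?thesis by simp
  qed
  show ?case by (intro exI[of _ "\<lambda>_ _. 0"] conjI allI impI) (simp, blast intro: claim)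
next
  case (Suc m)
  note Q = Suc.prems(1)
  have root: "poly (det Q) 0 = 0" unfolding Suc.prems(2) by simp
  obtain v where v: "\<exists>b<n. v b \<noteq> 0" 
    "\<And>a. a < n \<Longrightarrow> [:-0, 1:] dvd (\<Sum>b<n. Q $$ (a,b) * [:v b:])"
    by (rule det_root_kernel_vector[OF Q root]) (rule that)
  then obtain p where p: "p < n" "v p \<noteq> 0" by auto
  define f where "f = (\<lambda>b. if b = p then 1 / v p else 0)"
  have fv: "(\<Sum>b<n. f b * v b) = 1"
    using p by (simp add: f_def if_distrib[of "\<lambda>x. x * _"] cong: if_cong)
  have "\<forall>a. \<exists>t. a < n \<longrightarrow> (\<Sum>b<n. Q $$ (a,b) * [:v b:]) = [:-0, 1:] * t"
    using v(2) unfolding dvd_def by blast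
  then obtain R where R: "\<And>a. a < n \<Longrightarrow> (\<Sum>b<n. Q $$ (a,b) * [:v b:]) = [:-0, 1:] * R a"
    by metis
  obtain H where H: "H \<in> carrier_mat n n" "Q = H * elementary_factor n v f 0"
    by (rule split_off_root[OF Q fv, of 0 R]) (erule R, rule that)
  define W where "W = elementary_factor n v f 0"
  have W: "W \<in> carrier_mat n n" unfolding W_def by simp
  have "det H * [:0, 1:] = [:0, 1:] ^ Suc m * h"
    using det_mult[OF H(1) W] det_elementary_factor[OF fv, of 0] Suc.prems(2) H(2)
    unfolding W_def by simp
  then have "[:0, 1:] * det H = [:0, 1:] * ([:0, 1:] ^ m * h)"
    by (simp only: power_Suc mult.assoc mult.commute[of "det H"])
  then have dH: "det H = [:0, 1:] ^ m * h"
    by (subst (asm) mult_left_cancel) auto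
  obtain L where lin: "\<And>k. k < m \<Longrightarrow> linear_on_vectors (L k)"
    and det_by: "\<And>X b. (\<forall>a<n. [:0, 1:] ^ (r + 1) dvd (\<Sum>b<n. H $$ (a,b) * X b)) \<Longrightarrow>
       (\<forall>k<m. L k X = 0) \<Longrightarrow> b < n \<Longrightarrow> [:0, 1:] ^ (r + 1) dvd X b"
    using Suc.IH[OF H(1) dH] by blast
  define WX where "WX = (\<lambda>X a. \<Sum>b<n. W $$ (a,b) * X b)"
  define fX where "fX = (\<lambda>X. \<Sum>b<n. [:f b:] * X b)"
  define L' where "L' = (\<lambda>k X. if k < m then L k (WX X) else coeff (fX X) r)"
  have WXsum: "WX (\<lambda>b. \<Sum>i\<in>I. [:c i:] * X i b) = (\<lambda>a. \<Sum>i\<in>I. [:c i:] * WX (X i) a)"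
    for I :: "nat set" and c X
    unfolding WX_def sum_distrib_left by (subst sum.swap) (simp add: ac_simps)
  have fXsum: "fX (\<lambda>b. \<Sum>i\<in>I. [:c i:] * X i b) = (\<Sum>i\<in>I. [:c i:] * fX (X i))"
    for I :: "nat set" and c X
    unfolding fX_def sum_distrib_left by (subst sum.swap) (simp add: ac_simps)
  have "linear_on_vectors (L' k)" for k
  proof (cases "k < m")
    case True
    then show ?thesis using lin[OF True] WXsum
      unfolding linear_on_vectors_def L'_def by simp
  next
    case False
    then show ?thesis using fXsum
      unfolding linear_on_vectors_def L'_def by (simp add: coeff_sum)
  qed
  moreover have "[:0, 1:] ^ (r + 1) dvd X b"
    if X: "\<forall>a<n. [:0, 1:] ^ (r + 1) dvd (\<Sum>b<n. Q $$ (a,b) * X b)"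
      and l: "\<forall>k<Suc m. L' k X = 0" and b: "b < n" for X b
  proof -
    have "\<forall>a<n. [:0, 1:] ^ (r + 1) dvd (\<Sum>b<n. H $$ (a,b) * WX X b)"
      using X mat_prod_apply_sum[OF H(1) W, of _ X] unfolding WX_def H(2)[folded W_def] by simp
    moreover have "\<forall>k<m. L k (WX X) = 0"
      using l unfolding L'_def by (metis less_SucI)
    ultimately have dW: "[:0, 1:] ^ (r + 1) dvd WX X a" if "a < n" for a
      using det_by that by blast
    have WXa: "WX X a = X a + ([:0, 1:] - 1) * [:v a:] * fX X" if a: "a < n" for a
    proof -
      have "WX X a = (\<Sum>b<n. (if a = b then X b else 0) + ([:0, 1:] - 1) * [:v a:] * ([:f b:] * X b))"
        unfolding WX_def W_def elementary_factor_def
        by (rule sum.cong) (use a in \<open>auto simp: algebra_simps\<close>)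
      also have "\<dots> = X a + ([:0, 1:] - 1) * [:v a:] * fX X"
        unfolding sum.distrib fX_def sum_distrib_left using a by simp
      finally show ?thesis .
    qed
    note fv' = constant_pairing[OF fv]
    have ring: "g * (x + (t - 1) * y * F) = g * x + (t - 1) * F * (g * y)"
      for g x t y F :: "complex poly" by (simp add: algebra_simps)
    have "(\<Sum>a<n. [:f a:] * WX X a) =
        (\<Sum>a<n. [:f a:] * X a + ([:0, 1:] - 1) * fX X * ([:f a:] * [:v a:]))"
      by (rule sum.cong[OF refl], simp only: lessThan_iff WXa ring)
    also have "\<dots> = fX X + ([:0, 1:] - 1) * fX X * (\<Sum>a<n. [:f a:] * [:v a:])"
      unfolding sum.distrib sum_distrib_left fX_def by simp
    also have "\<dots> = [:0, 1:] * fX X" unfolding fv' by (simp add: algebra_simps)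
    finally have "[:0, 1:] * fX X = (\<Sum>a<n. [:f a:] * WX X a)" by simp
    moreover have "[:0, 1:] ^ (r + 1) dvd (\<Sum>a<n. [:f a:] * WX X a)"
      using dW by (intro dvd_sum dvd_mult) auto
    ultimately have "[:0, 1:] * [:0, 1:] ^ r dvd [:0, 1:] * fX X" by simp
    then have "[:0, 1:] ^ r dvd fX X" by (subst (asm) dvd_times_left_cancel_iff) auto
    then have "monom 1 r dvd fX X" by (simp only: monom_altdef smult_1_left)
    moreover have "coeff (fX X) r = 0"
      using l unfolding L'_def by (metis lessI less_irrefl)
    ultimately have "monom 1 (r + 1) dvd fX X"
      unfolding monom_1_dvd_iff' by (auto simp: less_Suc_eq)
    then have "[:0, 1:] ^ (r + 1) dvd fX X" by (simp only: monom_altdef smult_1_left)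
    then have "[:0, 1:] ^ (r + 1) dvd WX X b - ([:0, 1:] - 1) * [:v b:] * fX X"
      using dW[OF b] by (intro dvd_diff dvd_mult)
    then show ?thesis using WXa[OF b] by simp
  qed
  ultimately show ?case by (intro exI[of _ L']) blast
qed

text \<open>If the determinant vanished at \<open>z\<close> to an order \<open>m \<le> r\<close> only, then \<open>m\<close> linear conditions would
  leave no nonzero kernel vector; but the rank bound gives a kernel of dimension at least \<open>r + 1\<close>,
  in which \<open>m\<close> conditions cannot force zero.\<close>

lemma det_dvd_if_rank_le:
  assumes Q: "Q \<in> carrier_mat n n" and n: "0 < n"
    and rank: "vec_space.rank ((r + 1) * n) (block_toeplitz n r Q z) \<le> (r + 1) * (n - 1)"
  shows "[:-z, 1:] ^ (r + 1) dvd det Q"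
proof (rule ccontr)
  assume ndvd: "\<not> ?thesis"
  let ?N = "(r + 1) * n" and ?T = "block_toeplitz n r Q z"
  define m where "m = order z (det Q)"
  have nz: "det Q \<noteq> 0" using ndvd by auto
  have m: "m < r + 1" using ndvd nz unfolding m_def order_divides by auto
  obtain g where g: "det Q = [:-z, 1:] ^ m * g" "poly g z \<noteq> 0"
    using order_decomp[OF nz, of z] unfolding m_def by (metis poly_eq_0_iff_dvd)
  have dS: "det (shift_mat z Q) = [:0, 1:] ^ m * pcompose g [:z, 1:]"
    unfolding det_shift_mat g(1) pcompose_mult pcompose_linear_power ..
  have "poly (pcompose g [:z, 1:]) 0 \<noteq> 0" using g(2) by (simp add: poly_pcompose)
  moreover have "shift_mat z Q \<in> carrier_mat n n" using Q by simp
  ultimately obtain L where lin: "\<And>k. k < m \<Longrightarrow> linear_on_vectors (L k)"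
    and det_by: "\<And>X b. (\<forall>a<n. [:0, 1:] ^ (r + 1) dvd (\<Sum>b<n. shift_mat z Q $$ (a,b) * X b)) \<Longrightarrow>
       (\<forall>k<m. L k X = 0) \<Longrightarrow> b < n \<Longrightarrow> [:0, 1:] ^ (r + 1) dvd X b"
    using solutions_determined_by_constraints[OF _ dS, of n r] by blast
  define U where "U = (\<lambda>l b. if l mod n = b then monom 1 (l div n) else (0 :: complex poly))"
  have T: "?T \<in> carrier_mat ?N ?N" unfolding block_toeplitz_def by simp
  have "(r + 1) * (n - 1) + (r + 1) = ?N" using n by (cases n) auto
  then have rk: "vec_space.rank ?N ?T + m < ?N" using rank m by linarith
  obtain w where w: "\<exists>l<?N. w l \<noteq> 0" "\<And>i. i < ?N \<Longrightarrow> (\<Sum>l<?N. ?T $$ (i,l) * w l) = 0"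
    "\<And>k. k < m \<Longrightarrow> (\<Sum>l<?N. L k (U l) * w l) = 0"
    by (rule kernel_vector_with_constraints[OF T rk, of "\<lambda>k l. L k (U l)"]) (rule that)
  define X where "X = (\<lambda>b. \<Sum>l<?N. [:w l:] * U l b)"
  have Xc: "coeff (X b) j = w (j * n + b)" if "j \<le> r" "b < n" for j b
  proof -
    have jb: "j * n + b < ?N" by (rule block_index_less[OF that])
    have "coeff (X b) j = (\<Sum>l<?N. if l = j * n + b then w l else 0)"
      unfolding X_def coeff_sum
      by (rule sum.cong) (use that in \<open>auto simp: U_def\<close>)
    then show ?thesis using jb by simp
  qed
  have "monom 1 (r + 1) dvd (\<Sum>b<n. shift_mat z Q $$ (a,b) * X b)" if a: "a < n" for a
    unfolding monom_1_dvd_iff'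
  proof (intro allI impI)
    fix i assume i: "i < r + 1"
    have "i * n + a < ?N" by (rule block_index_less) (use i a in auto)
    then show "coeff (\<Sum>b<n. shift_mat z Q $$ (a,b) * X b) i = 0"
      using block_toeplitz_mult[OF Q _ a, of i r X w z] Xc w(2) i by simp
  qed
  then have "\<forall>a<n. [:0, 1:] ^ (r + 1) dvd (\<Sum>b<n. shift_mat z Q $$ (a,b) * X b)"
    by (simp only: monom_altdef smult_1_left) simp
  moreover have "L k X = 0" if "k < m" for k
    using lin[OF that] w(3)[OF that] unfolding linear_on_vectors_def X_def
    by (simp add: mult.commute)
  ultimately have "[:0, 1:] ^ (r + 1) dvd X b" if "b < n" for b
    using det_by that by blast
  then have "monom 1 (r + 1) dvd X b" if "b < n" for b
    using that by (simp only: monom_altdef smult_1_left)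
  then have "w (j * n + b) = 0" if "j \<le> r" "b < n" for j b
    using Xc[OF that] that unfolding monom_1_dvd_iff' by (metis Suc_eq_plus1 le_imp_less_Suc)
  then have "w l = 0" if "l < ?N" for l
    using index_div_mod_less[OF that] by metis
  then show False using w(1) by auto
qed

lemma smith_form_imp_rank_le:
  assumes "smith_form n Q ds" "d \<in> set ds" "[:-z, 1:] ^ (r + 1) dvd d"
  shows "vec_space.rank ((r + 1) * n) (block_toeplitz n r Q z) \<le> (r + 1) * (n - 1)"
proof -
  obtain E F where u: "unimodular_mat_poly n E" "unimodular_mat_poly n F"
    and QE: "Q = E * mat_diag n (\<lambda>i. if i < length ds then ds ! i else 0) * F"
    and len: "length ds \<le> n"
    using assms(1) unfolding smith_form_def by auto
  let ?D = "mat_diag n (\<lambda>i. if i < length ds then ds ! i else 0)"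
  have E: "E \<in> carrier_mat n n" and F: "F \<in> carrier_mat n n" and D: "?D \<in> carrier_mat n n"
    using u unimodular_carrier by auto
  have Q: "Q \<in> carrier_mat n n" unfolding QE using E F D by auto
  obtain F' where F': "unimodular_mat_poly n F'" "F * F' = 1\<^sub>m n"
    using unimodular_inverse[OF u(2)] by blast
  have F'c: "F' \<in> carrier_mat n n" using F'(1) unimodular_carrier by auto
  obtain i where i: "i < length ds" "d = ds ! i" using assms(2) by (metis in_set_conv_nth)
  have i_n: "i < n" using i len by simp
  define X where "X = (\<lambda>b. F' $$ (b,i))"
  have FX: "(\<Sum>b<n. F $$ (a,b) * X b) = (if a = i then 1 else 0)" if "a < n" for a
    using mat_prod_index_sum[OF F F'c that i_n] F'(2) that i_n unfolding X_def by simp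
  have "[:-z, 1:] ^ (r + 1) dvd (\<Sum>b<n. Q $$ (a,b) * X b)" if a: "a < n" for a
  proof -
    have ED: "E * ?D \<in> carrier_mat n n" using E D by auto
    have "(\<Sum>b<n. Q $$ (a,b) * X b) = (\<Sum>c<n. (E * ?D) $$ (a,c) * (if c = i then 1 else 0))"
      unfolding QE mat_prod_apply_sum[OF ED F a] by (rule sum.cong) (use FX in auto)
    also have "\<dots> = (E * ?D) $$ (a,i)"
      using i_n by (simp add: if_distrib[of "\<lambda>x. _ * x"] cong: if_cong)
    also have "\<dots> = E $$ (a,i) * d"
      using a i_n i unfolding mat_diag_mult_right[OF E] by simp
    finally show ?thesis using assms(3) by simp
  qed
  moreover have "\<exists>b<n. poly (X b) z \<noteq> 0"
  proof (rule ccontr)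
    assume "\<not> ?thesis"
    then have "poly (\<Sum>b<n. F $$ (i,b) * X b) z = 0" by (simp add: poly_sum)
    then show False unfolding FX[OF i_n] by simp
  qed
  ultimately show ?thesis using rank_block_toeplitz_le[OF Q] by blast
qed

section \<open>Moving roots at a cost proportional to the distance\<close>

lemma mat_polys_iff:
  "Q \<in> mat_polys n k \<longleftrightarrow>
     Q \<in> carrier_mat n n \<and> (\<forall>a<n. \<forall>b<n. \<forall>i>k. coeff (Q $$ (a,b)) i = 0)"
proof (cases "Q \<in> carrier_mat n n")
  case True
  have "coeff_mat Q i = 0\<^sub>m n n \<longleftrightarrow> (\<forall>a<n. \<forall>b<n. coeff (Q $$ (a,b)) i = 0)" for i
    using True unfolding coeff_mat_def by (auto simp: mat_eq_iff)
  then show ?thesis using True unfolding mat_polys_def by blast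
qed (auto simp: mat_polys_def)

lemma mat_polys_carrier: "Q \<in> mat_polys n k \<Longrightarrow> Q \<in> carrier_mat n n"
  by (simp add: mat_polys_iff)

definition coeffs_close :: "nat \<Rightarrow> real \<Rightarrow> complex poly mat \<Rightarrow> complex poly mat \<Rightarrow> bool" where
  "coeffs_close n \<delta> A B \<longleftrightarrow>
     (\<forall>a<n. \<forall>b<n. \<forall>i. cmod (coeff (B $$ (a,b)) i - coeff (A $$ (a,b)) i) \<le> \<delta>)"

definition coeffs_bounded :: "nat \<Rightarrow> real \<Rightarrow> complex poly mat \<Rightarrow> bool" where
  "coeffs_bounded n K A \<longleftrightarrow> (\<forall>a<n. \<forall>b<n. \<forall>i. cmod (coeff (A $$ (a,b)) i) \<le> K)"

lemma coeffs_close_refl: "0 \<le> \<delta> \<Longrightarrow> coeffs_close n \<delta> A A"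
  unfolding coeffs_close_def by auto

lemma coeffs_close_mono: "coeffs_close n \<delta> A B \<Longrightarrow> \<delta> \<le> \<epsilon> \<Longrightarrow> coeffs_close n \<epsilon> A B"
  unfolding coeffs_close_def by (blast intro: order_trans)

lemma coeffs_close_trans:
  assumes "coeffs_close n \<delta> A B" "coeffs_close n \<epsilon> B C"
  shows "coeffs_close n (\<delta> + \<epsilon>) A C"
  unfolding coeffs_close_def
proof (intro allI impI)
  fix a b i assume ab: "a < n" "b < n"
  have "cmod (coeff (C $$ (a,b)) i - coeff (A $$ (a,b)) i) \<le>
      cmod (coeff (B $$ (a,b)) i - coeff (A $$ (a,b)) i) +
      cmod (coeff (C $$ (a,b)) i - coeff (B $$ (a,b)) i)"
    using norm_triangle_ineq[of "coeff (B $$ (a,b)) i - coeff (A $$ (a,b)) i"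
        "coeff (C $$ (a,b)) i - coeff (B $$ (a,b)) i"] by simp
  also have "\<dots> \<le> \<delta> + \<epsilon>"
    using assms ab unfolding coeffs_close_def by (intro add_mono) auto
  finally show "cmod (coeff (C $$ (a,b)) i - coeff (A $$ (a,b)) i) \<le> \<delta> + \<epsilon>" .
qed

lemma coeffs_bounded_close:
  assumes "coeffs_bounded n K A" "coeffs_close n \<delta> A B"
  shows "coeffs_bounded n (K + \<delta>) B"
  unfolding coeffs_bounded_def
proof (intro allI impI)
  fix a b i assume ab: "a < n" "b < n"
  have "cmod (coeff (B $$ (a,b)) i) \<le> cmod (coeff (A $$ (a,b)) i) +
      cmod (coeff (B $$ (a,b)) i - coeff (A $$ (a,b)) i)"
    using norm_triangle_sub[of "coeff (B $$ (a,b)) i" "coeff (A $$ (a,b)) i"] by simp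
  also have "\<dots> \<le> K + \<delta>"
    using assms ab unfolding coeffs_close_def coeffs_bounded_def by (intro add_mono) auto
  finally show "cmod (coeff (B $$ (a,b)) i) \<le> K + \<delta>" .
qed

lemma coeffs_bounded_exists:
  assumes "Q \<in> mat_polys n k"
  obtains K where "0 \<le> K" "coeffs_bounded n K Q"
proof -
  let ?K = "\<Sum>a<n. \<Sum>b<n. \<Sum>i\<le>k. cmod (coeff (Q $$ (a,b)) i)"
  have "cmod (coeff (Q $$ (a,b)) i) \<le> ?K" if ab: "a < n" "b < n" for a b i
  proof (cases "i \<le> k")
    case True
    have "cmod (coeff (Q $$ (a,b)) i) \<le> (\<Sum>i\<le>k. cmod (coeff (Q $$ (a,b)) i))"
      using True by (intro member_le_sum) auto
    also have "\<dots> \<le> (\<Sum>b<n. \<Sum>i\<le>k. cmod (coeff (Q $$ (a,b)) i))"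
      using ab by (intro member_le_sum[of b "{..<n}"]) (auto intro: sum_nonneg)
    also have "\<dots> \<le> ?K"
      using ab by (intro member_le_sum[of a "{..<n}"]) (auto intro!: sum_nonneg)
    finally show ?thesis .
  next
    case False
    then show ?thesis using assms ab unfolding mat_polys_iff by (auto intro!: sum_nonneg)
  qed
  moreover have "0 \<le> ?K" by (intro sum_nonneg) auto
  ultimately show thesis using that unfolding coeffs_bounded_def by blast
qed

text \<open>Dividing by \<open>x - \<mu>\<close> is Horner's scheme, which enlarges coefficients by a factor
  that depends only on the degree and on \<open>\<bar>\<mu>\<bar>\<close>.\<close>

lemma linear_quotient_coeff_bound:
  fixes q :: "complex poly"
  assumes deg: "\<And>i. i > k \<Longrightarrow> coeff ([:-\<mu>, 1:] * q) i = 0"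
    and bound: "\<And>i. cmod (coeff ([:-\<mu>, 1:] * q) i) \<le> c" and M: "cmod \<mu> \<le> M"
  shows "cmod (coeff q i) \<le> c * (1 + M) ^ k" "i \<ge> k \<Longrightarrow> coeff q i = 0"
proof -
  have c: "0 \<le> c" using bound[of 0] norm_ge_zero order_trans by blast
  have M0: "0 \<le> M" using M norm_ge_zero order_trans by blast
  have z: "coeff q i = 0" if "i \<ge> k" for i
  proof (cases "q = 0")
    case False
    have "degree ([:-\<mu>, 1:] * q) = Suc (degree q)"
      using False by (subst degree_mult_eq) auto
    moreover have "degree ([:-\<mu>, 1:] * q) \<le> k"
      using deg by (intro degree_le) auto
    ultimately show ?thesis using that by (intro coeff_eq_0) auto
  qed simp
  then show "i \<ge> k \<Longrightarrow> coeff q i = 0" .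
  have "cmod (coeff q (k - j)) \<le> c * (1 + M) ^ j" if "j \<le> k" for j
    using that
  proof (induction j)
    case 0 then show ?case using z[of k] c by simp
  next
    case (Suc j)
    let ?i = "k - Suc j"
    have e: "k - j = Suc ?i" using Suc.prems by simp
    have "coeff q ?i = coeff ([:-\<mu>, 1:] * q) (Suc ?i) + \<mu> * coeff q (Suc ?i)" by simp
    then have "cmod (coeff q ?i) \<le> cmod (coeff ([:-\<mu>, 1:] * q) (Suc ?i)) + cmod (\<mu> * coeff q (Suc ?i))"
      by (metis norm_triangle_ineq)
    also have "\<dots> \<le> c + M * (c * (1 + M) ^ j)"
    proof (rule add_mono)
      show "cmod (coeff ([:-\<mu>, 1:] * q) (Suc ?i)) \<le> c" by (rule bound)
      show "cmod (\<mu> * coeff q (Suc ?i)) \<le> M * (c * (1 + M) ^ j)"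
        using Suc.IH Suc.prems M M0 e unfolding norm_mult by (intro mult_mono) auto
    qed
    also have "\<dots> \<le> c * (1 + M) ^ j + M * (c * (1 + M) ^ j)"
      using c M0 by (intro add_right_mono) (simp add: mult_le_cancel_left1)
    also have "\<dots> = c * (1 + M) ^ Suc j" by (simp add: algebra_simps)
    finally show ?case .
  qed note horner = this
  show "cmod (coeff q i) \<le> c * (1 + M) ^ k"
  proof (cases "i \<le> k")
    case True
    have "cmod (coeff q i) \<le> c * (1 + M) ^ (k - i)" using horner[of "k - i"] True by simp
    also have "\<dots> \<le> c * (1 + M) ^ k"
      using c M0 by (intro mult_left_mono power_increasing) auto
    finally show ?thesis .
  next
    case False then show ?thesis using z[of i] c M0 by simp
  qed
qed

text \<open>The spanning vector \<open>u\<close> may be zero, so a trivial kernel is included.\<close>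

definition kernel_at_most_line :: "nat \<Rightarrow> complex poly mat \<Rightarrow> complex \<Rightarrow> bool" where
  "kernel_at_most_line n Q z \<longleftrightarrow>
     (\<exists>u. \<forall>w. (\<forall>a<n. (\<Sum>b<n. poly (Q $$ (a,b)) z * w b) = 0) \<longrightarrow> (\<exists>c. \<forall>b<n. w b = c * u b))"

text \<open>For the kernel at \<open>z\<close> to stay at most one-dimensional when another root is moved to \<open>z\<close> along \<open>v\<close>, the
  functional \<open>f\<close> must not vanish on the vector \<open>u\<close> that spans the kernel so far. Normalising the
  largest entry of \<open>v\<close> to \<open>1\<close> keeps \<open>f\<close> bounded.\<close>

lemma normalized_dual_functional:
  fixes u v :: "nat \<Rightarrow> complex"
  assumes "\<exists>b<n. v b \<noteq> 0"
  obtains v' f t where "t \<noteq> 0" "\<And>b. v' b = t * v b" "\<And>b. b < n \<Longrightarrow> cmod (v' b) \<le> 1"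
    "(\<Sum>b<n. f b * v' b) = 1" "\<And>b. b < n \<Longrightarrow> cmod (f b) \<le> 2"
    "(\<Sum>b<n. f b * u b) \<noteq> 0 \<or> (\<forall>b<n. u b = 0)"
proof -
  have fin: "finite ((\<lambda>b. cmod (v b)) ` {..<n})" "(\<lambda>b. cmod (v b)) ` {..<n} \<noteq> {}"
    using assms by auto
  obtain p where "p < n" "cmod (v p) = Max ((\<lambda>b. cmod (v b)) ` {..<n})"
    using Max_in[OF fin] by auto
  then have p: "p < n" "\<And>b. b < n \<Longrightarrow> cmod (v b) \<le> cmod (v p)"
    using Max_ge[OF fin(1)] by auto
  have vp: "v p \<noteq> 0" using assms p(2) by force
  define v' where "v' = (\<lambda>b. v b / v p)"
  have v'p: "v' p = 1" using vp unfolding v'_def by simp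
  have v'1: "cmod (v' b) \<le> 1" if "b < n" for b
    using p(2)[OF that] vp unfolding v'_def by (simp add: norm_divide divide_le_eq)
  have "\<exists>f. (\<Sum>b<n. f b * v' b) = 1 \<and> (\<forall>b<n. cmod (f b) \<le> 2) \<and>
      ((\<Sum>b<n. f b * u b) \<noteq> 0 \<or> (\<forall>b<n. u b = 0))"
  proof (cases "u p \<noteq> 0 \<or> (\<forall>b<n. u b = 0)")
    case True
    show ?thesis
      by (rule exI[of _ "\<lambda>b. if b = p then 1 else 0"])
        (use True p v'p in \<open>auto simp: if_distrib[of "\<lambda>x. x * _"] cong: if_cong\<close>)
  next
    case False
    then obtain q where q: "q < n" "u q \<noteq> 0" and up: "u p = 0" by auto
    have qp: "q \<noteq> p" using q up by auto
    \<comment> \<open>The functional \<open>e\<^sub>p + (e\<^sub>q - v'\<^sub>q e\<^sub>p)\<close>: the correction vanishes on \<open>v'\<close> but not on \<open>u\<close>.\<close>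
    define f where "f = (\<lambda>b. (if b = p then 1 - v' q else 0) + (if b = q then 1 else 0))"
    have fs: "(\<Sum>b<n. f b * w b) = (1 - v' q) * w p + w q" for w
      using p(1) q(1) unfolding f_def
      by (simp add: distrib_right sum.distrib if_distrib[of "\<lambda>x. x * _"] cong: if_cong)
    have "cmod (f b) \<le> 2" if "b < n" for b
      using norm_triangle_ineq4[of 1 "v' q"] v'1[OF q(1)] qp unfolding f_def by auto
    then show ?thesis using fs v'p up q(2) by (intro exI[of _ f]) auto
  qed
  then obtain f where f: "(\<Sum>b<n. f b * v' b) = 1" "\<And>b. b < n \<Longrightarrow> cmod (f b) \<le> 2"
      "(\<Sum>b<n. f b * u b) \<noteq> 0 \<or> (\<forall>b<n. u b = 0)" by blast
  show thesis
  proof (rule that[of "1 / v p" v' f])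
    show "1 / v p \<noteq> 0" using vp by simp
    show "v' b = 1 / v p * v b" for b unfolding v'_def by simp
  qed (use v'1 f in blast)+
qed

text \<open>Replacing the elementary factor at \<open>\<mu>\<close> by the one at \<open>z\<close> adds the rank-one matrix
  \<open>(\<mu> - z) R f\<close>, of degree at most \<open>k\<close> because \<open>R = Q v / (x - \<mu>)\<close>. For \<open>\<mu> \<noteq> z\<close> its value at \<open>z\<close> is
  \<open>Q(z)\<close> times the projection \<open>I - v f\<close>; as \<open>f\<close> does not vanish on the old kernel, unless that is
  trivial, the new kernel is spanned by \<open>v\<close>.\<close>

lemma move_root:
  fixes K M :: real
  assumes Q: "Q \<in> mat_polys n k" and K: "coeffs_bounded n K Q" and M: "cmod \<mu> \<le> M"
    and dQ: "det Q = [:-\<mu>, 1:] * g" and line: "kernel_at_most_line n Q z"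
  obtains Q' where "Q' \<in> mat_polys n k" "det Q' = [:-z, 1:] * g" "kernel_at_most_line n Q' z"
    "coeffs_close n (2 * real n * K * (1 + M) ^ k * cmod (\<mu> - z)) Q Q'"
proof (cases "\<mu> = z")
  case True
  then show thesis using that[of Q] assms by (auto intro: coeffs_close_refl)
next
  case False
  note Qc = mat_polys_carrier[OF Q]
  obtain u where u: "\<And>w. (\<And>a. a < n \<Longrightarrow> (\<Sum>b<n. poly (Q $$ (a,b)) z * w b) = 0) \<Longrightarrow>
      \<exists>c. \<forall>b<n. w b = c * u b"
    using line unfolding kernel_at_most_line_def by blast
  have root: "poly (det Q) \<mu> = 0" unfolding dQ by simp
  obtain v0 where v0: "\<exists>b<n. v0 b \<noteq> 0"
    "\<And>a. a < n \<Longrightarrow> [:-\<mu>, 1:] dvd (\<Sum>b<n. Q $$ (a,b) * [:v0 b:])"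
    by (rule det_root_kernel_vector[OF Qc root]) (rule that)
  obtain v f t where vf: "t \<noteq> 0" "\<And>b. v b = t * v0 b" "\<And>b. b < n \<Longrightarrow> cmod (v b) \<le> 1"
    "(\<Sum>b<n. f b * v b) = 1" "\<And>b. b < n \<Longrightarrow> cmod (f b) \<le> 2"
    "(\<Sum>b<n. f b * u b) \<noteq> 0 \<or> (\<forall>b<n. u b = 0)"
    by (rule normalized_dual_functional[OF v0(1), of u]) (rule that)
  have "\<exists>t. (\<Sum>b<n. Q $$ (a,b) * [:v b:]) = [:-\<mu>, 1:] * t" if "a < n" for a
  proof -
    have e: "(\<Sum>b<n. Q $$ (a,b) * [:v b:]) = [:t:] * (\<Sum>b<n. Q $$ (a,b) * [:v0 b:])"
      unfolding sum_distrib_left by (rule sum.cong) (auto simp: vf(2) mult.commute)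
    have "[:-\<mu>, 1:] dvd (\<Sum>b<n. Q $$ (a,b) * [:v b:])"
      unfolding e using v0(2)[OF that] by (rule dvd_mult)
    then show ?thesis unfolding dvd_def .
  qed
  then have "\<forall>a. \<exists>t. a < n \<longrightarrow> (\<Sum>b<n. Q $$ (a,b) * [:v b:]) = [:-\<mu>, 1:] * t" by blast
  then obtain R where R: "\<And>a. a < n \<Longrightarrow> (\<Sum>b<n. Q $$ (a,b) * [:v b:]) = [:-\<mu>, 1:] * R a"
    by metis
  obtain H where H: "H \<in> carrier_mat n n" "Q = H * elementary_factor n v f \<mu>"
    and HQ': "\<And>\<nu>. H * elementary_factor n v f \<nu> =
       mat n n (\<lambda>(a,b). Q $$ (a,b) + [:\<mu> - \<nu>:] * R a * [:f b:])"
    by (rule split_off_root[OF Qc vf(4), of \<mu> R]) (erule R, rule that)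
  define Q' where "Q' = H * elementary_factor n v f z"
  have Q'e: "Q' $$ (a,b) = Q $$ (a,b) + [:\<mu> - z:] * R a * [:f b:]" if "a < n" "b < n" for a b
    unfolding Q'_def HQ' using that by simp
  have Q'c: "Q' \<in> carrier_mat n n" unfolding Q'_def using H(1) by simp
  have "det H * [:-\<mu>, 1:] = [:-\<mu>, 1:] * g"
    using det_mult[OF H(1) elementary_factor_carrier] det_elementary_factor[OF vf(4)] H(2) dQ
    by metis
  then have "[:-\<mu>, 1:] * det H = [:-\<mu>, 1:] * g" by (simp only: mult.commute)
  then have "det H = g" by (subst (asm) mult_left_cancel) auto
  then have dQ': "det Q' = [:-z, 1:] * g"
    unfolding Q'_def using det_mult[OF H(1) elementary_factor_carrier]
      det_elementary_factor[OF vf(4)] by (metis mult.commute)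
  have Qv: "coeff ([:-\<mu>, 1:] * R a) i = (\<Sum>b<n. coeff (Q $$ (a,b)) i * v b)" if "a < n" for a i
    unfolding R[OF that, symmetric] coeff_sum by (rule sum.cong) auto
  have bnd: "cmod (coeff ([:-\<mu>, 1:] * R a) i) \<le> real n * K" if a: "a < n" for a i
  proof -
    have "cmod (coeff ([:-\<mu>, 1:] * R a) i) \<le> (\<Sum>b<n. cmod (coeff (Q $$ (a,b)) i * v b))"
      unfolding Qv[OF a] by (rule norm_sum)
    also have "\<dots> \<le> (\<Sum>b<n. K * 1)"
      unfolding norm_mult
      by (intro sum_mono mult_mono)
        (use K a vf(3) in \<open>auto simp: coeffs_bounded_def intro: order_trans[OF norm_ge_zero]\<close>)
    finally show ?thesis by simp
  qed
  have zero: "coeff ([:-\<mu>, 1:] * R a) i = 0" if a: "a < n" and i: "i > k" for a i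
    unfolding Qv[OF a] using Q a i unfolding mat_polys_iff by simp
  have Rb: "cmod (coeff (R a) i) \<le> real n * K * (1 + M) ^ k" if a: "a < n" for a i
    by (rule linear_quotient_coeff_bound(1)[OF _ _ M]) (use zero bnd a in auto)
  have Rz: "coeff (R a) i = 0" if a: "a < n" and i: "k < i" for a i
    by (rule linear_quotient_coeff_bound(2)[OF _ _ M]) (use zero bnd a i in auto)
  have Q'mp: "Q' \<in> mat_polys n k"
    unfolding mat_polys_iff
  proof (intro conjI Q'c allI impI)
    fix a b i assume "a < n" "b < n" "k < i"
    then show "coeff (Q' $$ (a,b)) i = 0"
      using Q Rz[of a i] unfolding mat_polys_iff by (simp add: Q'e)
  qed
  have close: "coeffs_close n (2 * real n * K * (1 + M) ^ k * cmod (\<mu> - z)) Q Q'"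
    unfolding coeffs_close_def
  proof (intro allI impI)
    fix a b i assume ab: "a < n" "b < n"
    have "coeff (Q' $$ (a,b)) i - coeff (Q $$ (a,b)) i = (\<mu> - z) * (coeff (R a) i * f b)"
      using Q'e[OF ab] by simp
    then have "cmod (coeff (Q' $$ (a,b)) i - coeff (Q $$ (a,b)) i) =
        cmod (\<mu> - z) * (cmod (coeff (R a) i) * cmod (f b))"
      by (simp only: norm_mult)
    also have "\<dots> \<le> cmod (\<mu> - z) * ((real n * K * (1 + M) ^ k) * 2)"
      using Rb[OF ab(1), of i] vf(5)[OF ab(2)]
      by (intro mult_left_mono mult_mono) (auto intro: order_trans[OF norm_ge_zero])
    finally show "cmod (coeff (Q' $$ (a,b)) i - coeff (Q $$ (a,b)) i)
        \<le> 2 * real n * K * (1 + M) ^ k * cmod (\<mu> - z)"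
      by (simp add: mult_ac)
  qed
  have "\<exists>c. \<forall>b<n. w b = c * v b"
    if w: "\<And>a. a < n \<Longrightarrow> (\<Sum>b<n. poly (Q' $$ (a,b)) z * w b) = 0" for w
  proof -
    define s where "s = (\<Sum>b<n. f b * w b)"
    have "(\<Sum>b<n. poly (Q $$ (a,b)) z * (w b - s * v b)) = 0" if a: "a < n" for a
    proof -
      have "poly (\<Sum>b<n. Q $$ (a,b) * [:v b:]) z = poly ([:-\<mu>, 1:] * R a) z" using R[OF a] by simp
      then have Qvz: "(\<Sum>b<n. poly (Q $$ (a,b)) z * v b) = (z - \<mu>) * poly (R a) z"
        by (simp add: poly_sum algebra_simps)
      have "0 = (\<Sum>b<n. poly (Q $$ (a,b)) z * w b + ((\<mu> - z) * poly (R a) z) * (f b * w b))"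
        unfolding w[OF a, symmetric]
        by (rule sum.cong) (use a in \<open>auto simp: Q'e algebra_simps\<close>)
      also have "\<dots> = (\<Sum>b<n. poly (Q $$ (a,b)) z * w b) + (\<mu> - z) * poly (R a) z * s"
        unfolding sum.distrib s_def sum_distrib_left ..
      also have "\<dots> = (\<Sum>b<n. poly (Q $$ (a,b)) z * w b) - s * (\<Sum>b<n. poly (Q $$ (a,b)) z * v b)"
        unfolding Qvz by (simp add: algebra_simps)
      also have "\<dots> = (\<Sum>b<n. poly (Q $$ (a,b)) z * (w b - s * v b))"
        unfolding sum_distrib_left sum_subtractf[symmetric]
        by (rule sum.cong) (auto simp: algebra_simps)
      finally show ?thesis by simp
    qed
    then obtain c where c: "\<forall>b<n. w b - s * v b = c * u b"
      using u[of "\<lambda>b. w b - s * v b"] by blast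
    have "c * (\<Sum>b<n. f b * u b) = (\<Sum>b<n. f b * (w b - s * v b))"
      unfolding sum_distrib_left by (rule sum.cong) (use c in auto)
    also have "\<dots> = (\<Sum>b<n. f b * w b) - s * (\<Sum>b<n. f b * v b)"
      unfolding sum_distrib_left sum_subtractf[symmetric]
      by (rule sum.cong) (auto simp: algebra_simps)
    also have "\<dots> = 0" using vf(4) by (simp add: s_def)
    finally have "c * (\<Sum>b<n. f b * u b) = 0" .
    then have "c = 0 \<or> (\<forall>b<n. u b = 0)" using vf(6) by (metis mult_eq_0_iff)
    then have "w b = s * v b" if "b < n" for b using c that by auto
    then show ?thesis by blast
  qed
  then have "kernel_at_most_line n Q' z"
    unfolding kernel_at_most_line_def by (intro exI[of _ v] allI impI) simp
  then show thesis by (rule that[OF Q'mp dQ' _ close])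
qed

text \<open>The perturbations add up, and \<open>K\<close> bounds the coefficients throughout, so that one constant \<open>C\<close>
  serves for all moves.\<close>

lemma move_roots:
  fixes K K' C \<eta> :: real
  assumes "Q \<in> mat_polys n k" "coeffs_bounded n K' Q" "kernel_at_most_line n Q z"
    and "det Q = (\<Prod>\<mu>\<leftarrow>ms. [:-\<mu>, 1:]) * g"
    and "\<And>\<mu>. \<mu> \<in> set ms \<Longrightarrow> cmod (\<mu> - z) \<le> \<eta>" "0 \<le> \<eta>" "\<eta> \<le> 1" "0 \<le> K'"
    and C: "C = 2 * real n * K * (2 + cmod z) ^ k" "0 \<le> K" "K' + length ms * (C * \<eta>) \<le> K"
  shows "\<exists>Q'. Q' \<in> mat_polys n k \<and> det Q' = [:-z, 1:] ^ length ms * g \<and>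
    kernel_at_most_line n Q' z \<and> coeffs_close n (length ms * (C * \<eta>)) Q Q'"
  using assms(1-5,8,11)
proof (induction ms arbitrary: Q K' g)
  case Nil
  then show ?case by (intro exI[of _ Q]) (auto intro: coeffs_close_refl)
next
  case (Cons \<mu> ms)
  let ?g = "(\<Prod>\<mu>\<leftarrow>ms. [:-\<mu>, 1:]) * g"
  have d: "det Q = [:-\<mu>, 1:] * ?g" using Cons.prems(4) by (simp only: list.map prod_list.Cons mult.assoc)
  have \<mu>: "cmod (\<mu> - z) \<le> \<eta>" using Cons.prems(5) by simp
  then have M: "cmod \<mu> \<le> 1 + cmod z" using norm_triangle_sub[of \<mu> z] assms(7) by linarith
  have C0: "0 \<le> C * \<eta>" unfolding C(1) using C(2) assms(6) by simp
  have l0: "0 \<le> length ms * (C * \<eta>)" using C0 by simp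
  have K'K: "K' \<le> K" using Cons.prems(7) C0 l0 by (simp add: algebra_simps)
  obtain Q1 where Q1: "Q1 \<in> mat_polys n k" "det Q1 = [:-z, 1:] * ?g" "kernel_at_most_line n Q1 z"
    "coeffs_close n (2 * real n * K' * (1 + (1 + cmod z)) ^ k * cmod (\<mu> - z)) Q Q1"
    by (rule move_root[OF Cons.prems(1,2) M d Cons.prems(3)]) (rule that)
  have "2 * real n * K' * (1 + (1 + cmod z)) ^ k * cmod (\<mu> - z) \<le> C * \<eta>"
    unfolding C(1) using K'K Cons.prems(6) \<mu> C(2)
    by (intro mult_mono) (auto intro: mult_left_mono)
  then have cl: "coeffs_close n (C * \<eta>) Q Q1" using Q1(4) coeffs_close_mono by blast
  have b1: "coeffs_bounded n (K' + C * \<eta>) Q1"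
    using coeffs_bounded_close[OF Cons.prems(2) cl] .
  have d1: "det Q1 = (\<Prod>\<mu>\<leftarrow>ms. [:-\<mu>, 1:]) * ([:-z, 1:] * g)"
    unfolding Q1(2) by (simp only: mult_ac)
  have le: "K' + C * \<eta> + length ms * (C * \<eta>) \<le> K"
    using Cons.prems(7) by (simp add: algebra_simps)
  obtain Q' where Q': "Q' \<in> mat_polys n k" "det Q' = [:-z, 1:] ^ length ms * ([:-z, 1:] * g)"
    "kernel_at_most_line n Q' z" "coeffs_close n (length ms * (C * \<eta>)) Q1 Q'"
    using Cons.IH[OF Q1(1) b1 Q1(3) d1 _ _ le] Cons.prems(5,6) C0 by auto
  have "det Q' = [:-z, 1:] ^ length (\<mu> # ms) * g"
    unfolding Q'(2) by (simp only: list.size power_Suc mult_ac add_0_right add_Suc_right)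
  moreover have "coeffs_close n (length (\<mu> # ms) * (C * \<eta>)) Q Q'"
    using coeffs_close_trans[OF cl Q'(4)] by (simp add: algebra_simps)
  ultimately show ?case using Q' by blast
qed

text \<open>The coefficients of \<open>Q(x + t)\<close> are Taylor coefficients of \<open>Q\<close> at \<open>t\<close> and so are continuous in \<open>t\<close>.\<close>

lemma eventually_shift_close:
  assumes Q: "Q \<in> mat_polys n k" and \<delta>: "0 < \<delta>"
  shows "eventually (\<lambda>x. coeffs_close n \<delta> Q (shift_mat x Q)) (at 0)"
proof -
  have "eventually (\<lambda>x. cmod (coeff (shift_mat x Q $$ (a,b)) i - coeff (Q $$ (a,b)) i) < \<delta>) (at 0)"
    if ab: "a < n" "b < n" for a b i
  proof -
    let ?f = "\<lambda>x. poly ((pderiv ^^ i) (Q $$ (a,b))) x / fact i"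
    have "isCont ?f 0" by (intro continuous_intros) auto
    then have "(?f \<longlongrightarrow> ?f 0) (at 0)" unfolding isCont_def .
    then have "eventually (\<lambda>x. dist (?f x) (?f 0) < \<delta>) (at 0)"
      using \<delta> tendstoD by blast
    then show ?thesis
      using shift_mat_index[OF mat_polys_carrier[OF Q] ab]
      unfolding taylor_coeff by (simp add: dist_norm)
  qed
  then have "eventually (\<lambda>x. \<forall>a\<in>{..<n}. \<forall>b\<in>{..<n}. \<forall>i\<in>{..k}.
      cmod (coeff (shift_mat x Q $$ (a,b)) i - coeff (Q $$ (a,b)) i) < \<delta>) (at 0)"
    by (auto simp: eventually_ball_finite_distrib)
  then show ?thesis
  proof (rule eventually_mono)
    fix x
    assume small: "\<forall>a\<in>{..<n}. \<forall>b\<in>{..<n}. \<forall>i\<in>{..k}.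
      cmod (coeff (shift_mat x Q $$ (a,b)) i - coeff (Q $$ (a,b)) i) < \<delta>"
    have "cmod (coeff (shift_mat x Q $$ (a,b)) i - coeff (Q $$ (a,b)) i) \<le> \<delta>"
      if ab: "a < n" "b < n" for a b i
    proof (cases "i \<le> k")
      case True then show ?thesis using small ab by (simp add: less_imp_le)
    next
      case False
      have "degree (Q $$ (a,b)) \<le> k"
        using Q ab unfolding mat_polys_iff by (intro degree_le) auto
      then have "coeff (pcompose (Q $$ (a,b)) [:x, 1:]) i = 0" "coeff (Q $$ (a,b)) i = 0"
        using False by (auto intro!: coeff_eq_0 simp: degree_pcompose)
      then show ?thesis
        using \<delta> shift_mat_index[OF mat_polys_carrier[OF Q] ab] by simp
    qed
    then show "coeffs_close n \<delta> Q (shift_mat x Q)" unfolding coeffs_close_def by blast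
  qed
qed

lemma shift_mat_mat_polys:
  assumes "Q \<in> mat_polys n k" shows "shift_mat x Q \<in> mat_polys n k"
  unfolding mat_polys_iff
proof (intro conjI allI impI)
  show "shift_mat x Q \<in> carrier_mat n n" using mat_polys_carrier[OF assms] by simp
  fix a b i assume ab: "a < n" "b < n" and i: "k < i"
  have "degree (Q $$ (a,b)) \<le> k"
    using assms ab unfolding mat_polys_iff by (intro degree_le) auto
  then show "coeff (shift_mat x Q $$ (a,b)) i = 0"
    using i shift_mat_index[OF mat_polys_carrier[OF assms] ab] by (auto intro!: coeff_eq_0 simp: degree_pcompose)
qed

lemma kernel_at_most_line_if_regular:
  assumes Q: "Q \<in> carrier_mat n n" and "poly (det Q) z \<noteq> 0"
  shows "kernel_at_most_line n Q z"
proof -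
  interpret ph: comm_ring_hom "\<lambda>p :: complex poly. poly p z" by standard auto
  let ?M = "map_mat (\<lambda>p. poly p z) Q"
  have d: "det ?M \<noteq> 0" using assms by simp
  have M: "?M \<in> carrier_mat n n" using Q by simp
  have "\<forall>b<n. w b = 0 * (0 :: complex)"
    if w: "\<forall>a<n. (\<Sum>b<n. poly (Q $$ (a,b)) z * w b) = 0" for w
  proof (rule ccontr)
    assume nz: "\<not> ?thesis"
    have "?M *\<^sub>v vec n w = 0\<^sub>v n"
      using w Q by (intro eq_vecI) (auto simp: scalar_prod_def atLeast0LessThan)
    moreover have "vec n w \<noteq> 0\<^sub>v n" using nz by (auto simp: vec_eq_iff)
    ultimately have "det ?M = 0" using det_0_iff_vec_prod_zero[OF M] vec_carrier by blast
    then show False using d by simp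
  qed
  then show ?thesis unfolding kernel_at_most_line_def by (intro exI[of _ "\<lambda>_. 0"]) auto
qed

definition regular_approximable :: "nat \<Rightarrow> nat \<Rightarrow> complex \<Rightarrow> nat \<Rightarrow> complex poly mat \<Rightarrow> bool" where
  "regular_approximable n k z m Q \<longleftrightarrow> (\<forall>\<eta>>0. \<exists>Q1 ms g.
     Q1 \<in> mat_polys n k \<and> coeffs_close n \<eta> Q Q1 \<and> length ms = m \<and>
     det Q1 = (\<Prod>\<mu>\<leftarrow>ms. [:-\<mu>, 1:]) * g \<and> g \<noteq> 0 \<and> (\<forall>\<mu>\<in>set ms. cmod (\<mu> - z) \<le> \<eta>))"

text \<open>A shift of the variable by a small generic amount makes the matrix regular at \<open>z\<close>, so its kernel
  there is trivial; then the roots near \<open>z\<close> are moved to \<open>z\<close> one after the other. A root at \<open>z\<close> itself, spread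
  over several invariant polynomials, is covered as well: the shift moves it off \<open>z\<close>, and the moves
  bring it back with a kernel that is at most a line.\<close>

lemma gather_roots:
  assumes Q: "Q \<in> mat_polys n k" and \<delta>: "0 < \<delta>"
    and near: "regular_approximable n k z m Q"
  obtains Q' g where "Q' \<in> mat_polys n k" "coeffs_close n \<delta> Q Q'"
    "det Q' = [:-z, 1:] ^ m * g" "g \<noteq> 0" "kernel_at_most_line n Q' z"
proof -
  obtain K0 where K0: "0 \<le> K0" "coeffs_bounded n K0 Q" using coeffs_bounded_exists[OF Q] by blast
  define K where "K = K0 + 1"
  define C where "C = 2 * real n * K * (2 + cmod z) ^ k"
  have C: "0 \<le> C" unfolding C_def K_def using K0 by simp
  \<comment> \<open>Approximating and shifting cost \<open>2 \<eta>\<close>, and each of the \<open>m\<close> moves costs at most \<open>2 C \<eta>\<close>.\<close>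
  define D where "D = 2 + m * (C * 2)"
  have D: "2 \<le> D" unfolding D_def using C by simp
  define \<eta> where "\<eta> = min \<delta> 1 / D"
  have \<eta>: "0 < \<eta>" "\<eta> \<le> 1/2" using \<delta> D unfolding \<eta>_def by (auto simp: field_simps min_def)
  have budget: "2 * \<eta> + m * (C * (2 * \<eta>)) \<le> min \<delta> 1"
  proof -
    have "2 * \<eta> + m * (C * (2 * \<eta>)) = D * \<eta>" unfolding D_def by (simp add: algebra_simps)
    also have "\<dots> = min \<delta> 1" unfolding \<eta>_def using D by simp
    finally show ?thesis by simp
  qed
  obtain Q1 ms g where Q1: "Q1 \<in> mat_polys n k" "coeffs_close n \<eta> Q Q1" "length ms = m"
      "det Q1 = (\<Prod>\<mu>\<leftarrow>ms. [:-\<mu>, 1:]) * g" "g \<noteq> 0" "\<forall>\<mu>\<in>set ms. cmod (\<mu> - z) \<le> \<eta>"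
    using near \<eta>(1) unfolding regular_approximable_def by blast
  have d1: "det Q1 \<noteq> 0" unfolding Q1(4) using Q1(5) by (auto simp: prod_list_zero_iff)
  have e1: "eventually (\<lambda>x. poly (pcompose (det Q1) [:z, 1:]) x \<noteq> 0) (at 0)"
  proof -
    have "pcompose (det Q1) [:z, 1:] \<noteq> 0" using d1 by (auto simp: pcompose_eq_0_iff)
    then have fin: "finite {x. poly (pcompose (det Q1) [:z, 1:]) x = 0}" by (rule poly_roots_finite)
    define S where "S = {x. poly (pcompose (det Q1) [:z, 1:]) x = 0} - {0}"
    have "open (- S)" using fin unfolding S_def by (intro open_Compl finite_imp_closed) auto
    then have "eventually (\<lambda>x. x \<in> - S) (nhds 0)"
      by (rule eventually_nhds_in_open) (simp add: S_def)
    then show ?thesis unfolding eventually_at_filter by eventually_elim (auto simp: S_def)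
  qed
  have e2: "eventually (\<lambda>x :: complex. cmod x \<le> \<eta>) (at 0)"
    unfolding eventually_at using \<eta>(1) by (intro exI[of _ \<eta>]) auto
  obtain x where x: "poly (pcompose (det Q1) [:z, 1:]) x \<noteq> 0" "cmod x \<le> \<eta>"
    "coeffs_close n \<eta> Q1 (shift_mat x Q1)"
    using eventually_happens'[OF _ eventually_conj[OF e1 eventually_conj[OF e2
      eventually_shift_close[OF Q1(1) \<eta>(1)]]]] by auto
  define Q2 where "Q2 = shift_mat x Q1"
  have Q2: "Q2 \<in> mat_polys n k" unfolding Q2_def using shift_mat_mat_polys[OF Q1(1)] .
  have Q2cl: "coeffs_close n (2 * \<eta>) Q Q2"
    using coeffs_close_trans[OF Q1(2) x(3)] unfolding Q2_def by simp
  have line: "kernel_at_most_line n Q2 z"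
  proof (rule kernel_at_most_line_if_regular[OF mat_polys_carrier[OF Q2]])
    show "poly (det Q2) z \<noteq> 0"
      using x(1) unfolding Q2_def det_shift_mat by (simp add: poly_pcompose add.commute)
  qed
  define ms' where "ms' = map (\<lambda>\<mu>. \<mu> - x) ms"
  have "pcompose (\<Prod>\<mu>\<leftarrow>ms. [:-\<mu>, 1:]) [:x, 1:] = (\<Prod>\<mu>\<leftarrow>ms'. [:-\<mu>, 1:])"
    unfolding ms'_def
  proof (induction ms)
    case (Cons \<mu> ms)
    have "pcompose [:-\<mu>, 1:] [:x, 1:] = [:-(\<mu> - x), 1:]" by (simp add: pcompose_pCons)
    then show ?case using Cons by (simp only: list.map prod_list.Cons pcompose_mult)
  qed (simp add: pcompose_1)
  then have d2: "det Q2 = (\<Prod>\<mu>\<leftarrow>ms'. [:-\<mu>, 1:]) * pcompose g [:x, 1:]"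
    unfolding Q2_def det_shift_mat Q1(4) pcompose_mult by simp
  have ms'z: "cmod (\<mu> - z) \<le> 2 * \<eta>" if "\<mu> \<in> set ms'" for \<mu>
  proof -
    obtain \<mu>0 where m0: "\<mu>0 \<in> set ms" "\<mu> = \<mu>0 - x" using \<open>\<mu> \<in> set ms'\<close> unfolding ms'_def by auto
    have "cmod (\<mu> - z) \<le> cmod (\<mu>0 - z) + cmod x"
      unfolding m0(2) using norm_triangle_ineq4[of "\<mu>0 - z" x] by (simp add: algebra_simps)
    then show ?thesis using Q1(6) m0(1) x(2) by fastforce
  qed
  have len: "length ms' = m" unfolding ms'_def using Q1(3) by simp
  have b2: "coeffs_bounded n (K0 + 2 * \<eta>) Q2" using coeffs_bounded_close[OF K0(2) Q2cl] .
  have "K0 + 2 * \<eta> + length ms' * (C * (2 * \<eta>)) \<le> K"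
    using budget unfolding len K_def by linarith
  from move_roots[OF Q2 b2 line d2 ms'z _ _ _ C_def _ this] \<eta> K0 len
  obtain Q' where Q': "Q' \<in> mat_polys n k" "det Q' = [:-z, 1:] ^ m * pcompose g [:x, 1:]"
    "kernel_at_most_line n Q' z" "coeffs_close n (m * (C * (2 * \<eta>))) Q2 Q'"
    unfolding K_def by auto
  have "coeffs_close n \<delta> Q Q'"
    using coeffs_close_mono[OF coeffs_close_trans[OF Q2cl Q'(4)], of \<delta>] budget by simp
  moreover have "pcompose g [:x, 1:] \<noteq> 0" using Q1(5) by (auto simp: pcompose_eq_0_iff)
  ultimately show thesis using that Q' by blast
qed

text \<open>Two invariant polynomials vanishing at \<open>z\<close> would give two independent kernel vectors, so a single
  invariant polynomial carries the whole power of \<open>x - z\<close> in the determinant.\<close>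

lemma elementary_divisor_if_kernel_line:
  assumes Q: "Q \<in> carrier_mat n n" and line: "kernel_at_most_line n Q z"
    and dQ: "det Q = [:-z, 1:] ^ m * g" "g \<noteq> 0" and m: "1 \<le> m"
  obtains j where "m \<le> j" "elementary_divisor n Q ([:-z, 1:] ^ j)"
proof -
  obtain ds where ds: "smith_form n Q ds" by (rule smith_form_exists[OF Q])
  obtain E F where u: "unimodular_mat_poly n E" "unimodular_mat_poly n F"
    and QE: "Q = E * mat_diag n (\<lambda>i. if i < length ds then ds ! i else 0) * F"
    and len: "length ds \<le> n" and monic: "\<forall>d\<in>set ds. lead_coeff d = 1"
    using ds unfolding smith_form_def by auto
  define dd where "dd = (\<lambda>i. if i < length ds then ds ! i else 0)"
  define D where "D = mat_diag n dd"
  have E: "E \<in> carrier_mat n n" and F: "F \<in> carrier_mat n n" and D: "D \<in> carrier_mat n n"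
    unfolding D_def using u unimodular_carrier by auto
  have QED: "Q = E * D * F" unfolding QE D_def dd_def ..
  obtain e f where ef: "e \<noteq> 0" "det E = [:e:]" "f \<noteq> 0" "det F = [:f:]"
    using u unfolding unimodular_mat_poly_def by auto
  have detD: "det D = (\<Prod>i<n. dd i)"
  proof -
    have "det D = prod_list (diag_mat D)"
      by (rule det_upper_triangular[OF _ D]) (auto simp: D_def mat_diag_def)
    then show ?thesis unfolding prod_list_diag_prod D_def
      by (simp add: mat_diag_def atLeast0LessThan)
  qed
  have ED: "E * D \<in> carrier_mat n n" using E D by auto
  have detQ: "det Q = [:e * f:] * (\<Prod>i<n. dd i)"
    unfolding QED det_mult[OF ED F] det_mult[OF E D] ef detD by (simp add: mult_ac)
  have nz: "det Q \<noteq> 0" unfolding dQ(1) using dQ(2) by simp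
  have ddnz: "dd i \<noteq> 0" if "i < n" for i
    using nz that unfolding detQ by (auto simp: prod_zero_iff)
  have lenn: "length ds = n" using ddnz[of "length ds"] len unfolding dd_def by fastforce
  obtain F' where F': "unimodular_mat_poly n F'" "F * F' = 1\<^sub>m n"
    using unimodular_inverse[OF u(2)] by blast
  have F'c: "F' \<in> carrier_mat n n" using F'(1) unimodular_carrier by auto
  \<comment> \<open>The columns \<open>i\<close> of the inverse of \<open>F\<close> with \<open>d\<^sub>i(z) = 0\<close> are independent kernel vectors at \<open>z\<close>.\<close>
  have FX: "(\<Sum>b<n. F $$ (a,b) * F' $$ (b,i)) = (if a = i then 1 else 0)" if "a < n" "i < n" for a i
    using mat_prod_index_sum[OF F F'c that] F'(2) that by simp
  have kerv: "(\<Sum>b<n. poly (Q $$ (a,b)) z * poly (F' $$ (b,i)) z) = 0"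
    if a: "a < n" and i: "i < n" "poly (dd i) z = 0" for a i
  proof -
    have "(\<Sum>b<n. Q $$ (a,b) * F' $$ (b,i)) = (\<Sum>c<n. (E * D) $$ (a,c) * (if c = i then 1 else 0))"
      unfolding QED mat_prod_apply_sum[OF ED F a] by (rule sum.cong) (use FX i in auto)
    also have "\<dots> = (E * D) $$ (a,i)"
      using i by (simp add: if_distrib[of "\<lambda>x. _ * x"] cong: if_cong)
    also have "\<dots> = E $$ (a,i) * dd i"
      using a i unfolding D_def mat_diag_mult_right[OF E] by simp
    finally have "poly (\<Sum>b<n. Q $$ (a,b) * F' $$ (b,i)) z = 0" using i(2) by simp
    then show ?thesis by (simp add: poly_sum)
  qed
  obtain u where u: "\<And>w. (\<And>a. a < n \<Longrightarrow> (\<Sum>b<n. poly (Q $$ (a,b)) z * w b) = 0) \<Longrightarrow>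
      \<exists>c. \<forall>b<n. w b = c * u b"
    using line unfolding kernel_at_most_line_def by blast
  have uniq: "i = i'" if i: "i < n" "poly (dd i) z = 0" and i': "i' < n" "poly (dd i') z = 0" for i i'
  proof (rule ccontr)
    assume ne: "i \<noteq> i'"
    obtain c where c: "\<forall>b<n. poly (F' $$ (b,i)) z = c * u b" using u[of "\<lambda>b. poly (F' $$ (b,i)) z"] kerv i by blast
    obtain c' where c': "\<forall>b<n. poly (F' $$ (b,i')) z = c' * u b" using u[of "\<lambda>b. poly (F' $$ (b,i')) z"] kerv i' by blast
    define s where "s = (\<lambda>a. \<Sum>b<n. poly (F $$ (a,b)) z * u b)"
    have "c * s a = poly (\<Sum>b<n. F $$ (a,b) * F' $$ (b,i)) z" for a
      unfolding s_def sum_distrib_left poly_sum by (rule sum.cong) (use c in auto)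
    then have cs: "c * s i = 1" "c * s i' = 0" using FX i i' ne by auto
    have "c' * s a = poly (\<Sum>b<n. F $$ (a,b) * F' $$ (b,i')) z" for a
      unfolding s_def sum_distrib_left poly_sum by (rule sum.cong) (use c' in auto)
    then have "c' * s i' = 1" using FX i' by auto
    then show False using cs by auto
  qed
  have "poly (det Q) z = 0" unfolding dQ(1) using m by (simp add: power_0_left)
  then obtain i where i: "i < n" "poly (dd i) z = 0"
    unfolding detQ using ef by (auto simp: poly_prod)
  define q where "q = [:e * f:] * (\<Prod>l\<in>{..<n} - {i}. dd l)"
  have "poly q z \<noteq> 0" unfolding q_def using ef uniq i by (auto simp: poly_prod)
  moreover have "[:-z, 1:] ^ m dvd dd i * q"
  proof -
    have "(\<Prod>l<n. dd l) = dd i * (\<Prod>l\<in>{..<n} - {i}. dd l)"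
      using i(1) by (simp add: prod.remove)
    then have "dd i * q = det Q" unfolding q_def detQ by (simp only: mult_ac)
    then show ?thesis unfolding dQ(1) by simp
  qed
  ultimately have dvd: "[:-z, 1:] ^ m dvd dd i" using linear_power_dvd_mult_cancel by blast
  define d where "d = ds ! i"
  have d: "d \<in> set ds" "d \<noteq> 0" "dd i = d" using i lenn ddnz[OF i(1)] unfolding d_def dd_def by auto
  define j where "j = order z d"
  have "m \<le> j" using dvd d unfolding j_def by (simp add: order_divides)
  moreover have "elementary_divisor n Q ([:-z, 1:] ^ j)"
    unfolding elementary_divisor_def
  proof (intro exI[of _ ds] conjI ds bexI[OF _ d(1)] exI[of _ "{x. poly d x = 0}"]
      exI[of _ "\<lambda>x. order x d"])
    show "finite {x. poly d x = 0}" using d(2) by (rule poly_roots_finite)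
    show "\<forall>\<mu>\<in>{x. poly d x = 0}. 1 \<le> order \<mu> d" using d(2) order_root[of d] by (auto simp: Suc_le_eq)
    show "d = (\<Prod>\<mu>\<in>{x. poly d x = 0}. [:-\<mu>, 1:] ^ order \<mu> d)"
      using complex_poly_decompose[of d] monic d(1) by simp
    show "\<exists>\<mu>\<in>{x. poly d x = 0}. [:-z, 1:] ^ j = [:-\<mu>, 1:] ^ order \<mu> d"
      using i(2) d(3) unfolding j_def by (intro bexI[of _ z]) auto
  qed
  ultimately show thesis using that by blast
qed

section \<open>Factorisations of singular matrix polynomials with complementary degrees\<close>

text \<open>The entries of column \<open>l\<close> of \<open>B\<close> have degree less than \<open>\<sigma> l\<close>, so \<open>\<sigma> l = 0\<close> stands for a zero column, and
  \<open>\<Sum>l<q. \<sigma> l\<close> decreases even when a constant column is reduced to zero.\<close>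

definition bounded_factorization ::
  "nat \<Rightarrow> complex poly mat \<Rightarrow> (nat \<Rightarrow> nat) \<Rightarrow> (nat \<Rightarrow> nat \<Rightarrow> complex poly) \<Rightarrow>
     (nat \<Rightarrow> nat \<Rightarrow> complex poly) \<Rightarrow> bool" where
  "bounded_factorization q Q \<sigma> B C \<longleftrightarrow>
     (\<forall>i<Suc q. \<forall>j<Suc q. Q $$ (i,j) = (\<Sum>l<q. B i l * C l j)) \<and>
     (\<forall>i<Suc q. \<forall>l<q. \<forall>m\<ge>\<sigma> l. coeff (B i l) m = 0)"

text \<open>The Smith form of a singular matrix has a zero on the diagonal, so \<open>Q\<close> factors through rank
  \<open>q = n - 1\<close>.\<close>

lemma singular_imp_factorization:
  assumes Q: "Q \<in> carrier_mat (Suc q) (Suc q)" and "det Q = 0"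
  shows "\<exists>\<sigma> B C. bounded_factorization q Q \<sigma> B C"
proof -
  let ?n = "Suc q"
  obtain ds where ds: "smith_form ?n Q ds" by (rule smith_form_exists[OF Q])
  obtain E F where u: "unimodular_mat_poly ?n E" "unimodular_mat_poly ?n F"
    and QE: "Q = E * mat_diag ?n (\<lambda>i. if i < length ds then ds ! i else 0) * F"
    and monic: "\<forall>d\<in>set ds. lead_coeff d = 1"
    using ds unfolding smith_form_def by auto
  define dd where "dd = (\<lambda>i. if i < length ds then ds ! i else 0)"
  define D where "D = mat_diag ?n dd"
  have E: "E \<in> carrier_mat ?n ?n" and F: "F \<in> carrier_mat ?n ?n" and D: "D \<in> carrier_mat ?n ?n"
    unfolding D_def using u unimodular_carrier by auto
  have QED: "Q = E * D * F" unfolding QE D_def dd_def ..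
  obtain e f where ef: "e \<noteq> 0" "det E = [:e:]" "f \<noteq> 0" "det F = [:f:]"
    using u unfolding unimodular_mat_poly_def by auto
  have ED: "E * D \<in> carrier_mat ?n ?n" using E D by auto
  have "det D = prod_list (diag_mat D)"
    by (rule det_upper_triangular[OF _ D]) (auto simp: D_def mat_diag_def)
  then have "det D = (\<Prod>i\<in>{0..<?n}. dd i)" unfolding prod_list_diag_prod D_def
    by (simp add: mat_diag_def)
  moreover have "det D = 0"
    using assms(2) ef unfolding QED det_mult[OF ED F] det_mult[OF E D] by simp
  ultimately have "(\<Prod>i\<in>{0..<?n}. dd i) = 0" by simp
  then obtain i where "i \<in> {0..<?n}" "dd i = 0"
    unfolding prod_zero_iff[OF finite_atLeastLessThan] by blast
  then have i: "i < ?n" "dd i = 0" by auto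
  have "\<not> i < length ds"
  proof
    assume il: "i < length ds"
    then have "lead_coeff (dd i) = 1" using monic unfolding dd_def by simp
    then show False using i(2) by simp
  qed
  then have "\<not> q < length ds" using i(1) by simp
  then have ddq: "dd q = 0" unfolding dd_def by simp
  define B where "B = (\<lambda>i l. (E * D) $$ (i,l))"
  define C where "C = (\<lambda>l j. F $$ (l,j))"
  define \<sigma> where "\<sigma> = (\<lambda>l. Suc (\<Sum>i<?n. degree (B i l)))"
  have "Q $$ (i,j) = (\<Sum>l<q. B i l * C l j)" if ij: "i < ?n" "j < ?n" for i j
  proof -
    have "Q $$ (i,j) = (\<Sum>l<?n. B i l * C l j)"
      unfolding QED B_def C_def by (rule mat_prod_index_sum[OF ED F ij])
    moreover have "B i q = 0"
      unfolding B_def D_def mat_diag_mult_right[OF E] using ij ddq by simp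
    ultimately show ?thesis by simp
  qed
  moreover have "coeff (B i l) m = 0" if "i < ?n" "m \<ge> \<sigma> l" for i l m
  proof (rule coeff_eq_0)
    have "degree (B i l) \<le> (\<Sum>i<?n. degree (B i l))"
      using that(1) by (intro member_le_sum) auto
    then show "degree (B i l) < m" using that(2) unfolding \<sigma>_def by simp
  qed
  ultimately have "bounded_factorization q Q \<sigma> B C"
    unfolding bounded_factorization_def by blast
  then show ?thesis by blast
qed

text \<open>The predictable degree property: a violation makes the leading columns of \<open>B\<close> dependent, and
  the column of largest degree among those involved can then be replaced by one of smaller
  degree.\<close>

lemma bounded_factorization_reduce:
  assumes fac: "bounded_factorization q Q \<sigma> B C" and Q: "Q \<in> mat_polys (Suc q) k"
    and viol: "l1 < q" "j < Suc q" "1 \<le> \<sigma> l1" "coeff (C l1 j) e1 \<noteq> 0" "k + 1 < e1 + \<sigma> l1"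
  obtains l0 B' C' where "l0 < q" "1 \<le> \<sigma> l0"
    "bounded_factorization q Q (\<sigma>(l0 := \<sigma> l0 - 1)) B' C'"
proof -
  let ?n = "Suc q"
  have prodQ: "Q $$ (i,j) = (\<Sum>l<q. B i l * C l j)" if "i < ?n" "j < ?n" for i j
    using fac that unfolding bounded_factorization_def by blast
  have Bb: "coeff (B i l) m = 0" if "i < ?n" "l < q" "\<sigma> l \<le> m" for i l m
    using fac that unfolding bounded_factorization_def by blast
  define V where "V = {(l,e). l < q \<and> 1 \<le> \<sigma> l \<and> coeff (C l j) e \<noteq> 0}"
  have "V \<subseteq> (SIGMA l:{..<q}. {..degree (C l j)})"
    unfolding V_def by (auto intro: le_degree)
  then have finV: "finite V" by (rule finite_subset) auto
  have V1: "(l1,e1) \<in> V" using viol unfolding V_def by auto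
  define m where "m = Max ((\<lambda>(l,e). e + \<sigma> l) ` V)"
  have mge: "e + \<sigma> l \<le> m" if "(l,e) \<in> V" for l e
    unfolding m_def using that finV by (intro Max_ge) force+
  have mk: "k + 1 < m" using mge[OF V1] viol by simp
  have "m \<in> (\<lambda>(l,e). e + \<sigma> l) ` V" unfolding m_def using finV V1 by (intro Max_in) auto
  then obtain l2 e2 where le2: "(l2,e2) \<in> V" "m = e2 + \<sigma> l2" by auto
  define \<gamma> where "\<gamma> = (\<lambda>l. if 1 \<le> \<sigma> l \<and> \<sigma> l \<le> m then coeff (C l j) (m - \<sigma> l) else 0)"
  have g2: "\<gamma> l2 \<noteq> 0" "l2 < q" using le2 unfolding \<gamma>_def V_def by auto
  \<comment> \<open>Only the products of top coefficients reach the coefficient of \<open>x\<^bsup>m-1\<^esup>\<close>, and \<open>m - 1 > k\<close>.\<close>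
  have top: "(\<Sum>l<q. coeff (B i l) (\<sigma> l - 1) * \<gamma> l) = 0" if i: "i < ?n" for i
  proof -
    have "coeff (B i l * C l j) (m - 1) = coeff (B i l) (\<sigma> l - 1) * \<gamma> l" if l: "l < q" for l
    proof -
      have term0: "coeff (B i l) a * coeff (C l j) (m - 1 - a) = 0"
        if a: "a \<le> m - 1" "a \<noteq> \<sigma> l - 1 \<or> \<not> (1 \<le> \<sigma> l \<and> \<sigma> l \<le> m)" for a
      proof (cases "\<sigma> l \<le> a")
        case True then show ?thesis using Bb[OF i l] by simp
      next
        case False
        have "coeff (C l j) (m - 1 - a) = 0"
        proof (rule ccontr)
          assume "coeff (C l j) (m - 1 - a) \<noteq> 0"
          then have "(l, m - 1 - a) \<in> V" using l False unfolding V_def by auto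
          then have "m - 1 - a + \<sigma> l \<le> m" by (rule mge)
          then show False using a False mk by linarith
        qed
        then show ?thesis by simp
      qed
      have "coeff (B i l * C l j) (m - 1) =
          (\<Sum>a\<le>m - 1. coeff (B i l) a * coeff (C l j) (m - 1 - a))" by (rule coeff_mult)
      also have "\<dots> = (\<Sum>a\<le>m - 1. if a = \<sigma> l - 1 then coeff (B i l) (\<sigma> l - 1) * \<gamma> l else 0)"
      proof (rule sum.cong[OF refl])
        fix a assume a: "a \<in> {..m - 1}"
        show "coeff (B i l) a * coeff (C l j) (m - 1 - a) =
            (if a = \<sigma> l - 1 then coeff (B i l) (\<sigma> l - 1) * \<gamma> l else 0)"
          using term0[of a] a by (cases "a = \<sigma> l - 1 \<and> 1 \<le> \<sigma> l \<and> \<sigma> l \<le> m") (auto simp: \<gamma>_def)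
      qed
      also have "\<dots> = coeff (B i l) (\<sigma> l - 1) * \<gamma> l"
        by (auto simp: \<gamma>_def)
      finally show ?thesis .
    qed
    then have "(\<Sum>l<q. coeff (B i l) (\<sigma> l - 1) * \<gamma> l) = coeff (Q $$ (i,j)) (m - 1)"
      unfolding prodQ[OF i viol(2)] coeff_sum by simp
    also have "\<dots> = 0"
    proof -
      have "coeff_mat Q (m - 1) = 0\<^sub>m ?n ?n" and Qc: "Q \<in> carrier_mat ?n ?n"
        using Q mk unfolding mat_polys_def by auto
      then have "coeff_mat Q (m - 1) $$ (i,j) = 0" using i viol(2) by simp
      then show ?thesis using i viol(2) Qc unfolding coeff_mat_def by simp
    qed
    finally show ?thesis .
  qed
  define G where "G = {l. l < q \<and> \<gamma> l \<noteq> 0}"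
  have finG: "finite G" and G2: "l2 \<in> G" using g2 unfolding G_def by auto
  have "Max (\<sigma> ` G) \<in> \<sigma> ` G" using finG G2 by (intro Max_in) auto
  then obtain l0 where l0: "l0 \<in> G" "\<sigma> l0 = Max (\<sigma> ` G)" by auto
  have smax: "\<sigma> l \<le> \<sigma> l0" if "l \<in> G" for l
    unfolding l0(2) using finG that by (intro Max_ge) auto
  have l0q: "l0 < q" and g0: "\<gamma> l0 \<noteq> 0" using l0 unfolding G_def by auto
  have s1: "1 \<le> \<sigma> l" if "l \<in> G" for l using that unfolding G_def \<gamma>_def by (auto split: if_splits)
  define h where "h = (\<lambda>l. if l \<in> G then monom (\<gamma> l / \<gamma> l0) (\<sigma> l0 - \<sigma> l) else 0)"
  have h0: "h l0 = 1" unfolding h_def using l0 g0 by (simp add: one_poly_eq_simps monom_0)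
  define B' where "B' = (\<lambda>i l. if l = l0 then (\<Sum>l<q. h l * B i l) else B i l)"
  define C' where "C' = (\<lambda>l j. if l = l0 then C l0 j else C l j - h l * C l0 j)"
  have "Q $$ (i,j) = (\<Sum>l<q. B' i l * C' l j)" if ij: "i < ?n" "j < ?n" for i j
  proof -
    have split: "(\<Sum>l<q. g l) = g l0 + (\<Sum>l\<in>{..<q} - {l0}. g l)" for g :: "nat \<Rightarrow> complex poly"
      using l0q by (simp add: sum.remove)
    have "(\<Sum>l<q. B' i l * C' l j) = (\<Sum>l<q. h l * B i l) * C l0 j +
        (\<Sum>l\<in>{..<q} - {l0}. B i l * (C l j - h l * C l0 j))"
      unfolding split[of "\<lambda>l. B' i l * C' l j"]
      by (intro arg_cong2[of _ _ _ _ plus] sum.cong) (auto simp: B'_def C'_def)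
    also have "(\<Sum>l\<in>{..<q} - {l0}. B i l * (C l j - h l * C l0 j)) =
        (\<Sum>l\<in>{..<q} - {l0}. B i l * C l j) - (\<Sum>l\<in>{..<q} - {l0}. h l * B i l) * C l0 j"
      unfolding sum_distrib_right sum_subtractf[symmetric]
      by (rule sum.cong) (auto simp: algebra_simps)
    also have "(\<Sum>l<q. h l * B i l) = B i l0 + (\<Sum>l\<in>{..<q} - {l0}. h l * B i l)"
      unfolding split[of "\<lambda>l. h l * B i l"] h0 by simp
    finally have "(\<Sum>l<q. B' i l * C' l j) = B i l0 * C l0 j + (\<Sum>l\<in>{..<q} - {l0}. B i l * C l j)"
      by (simp add: algebra_simps)
    also have "\<dots> = Q $$ (i,j)" unfolding prodQ[OF ij] split[of "\<lambda>l. B i l * C l j"] ..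
    finally show ?thesis by simp
  qed
  moreover have "coeff (B' i l) p = 0" if il: "i < ?n" "l < q" and p: "(\<sigma>(l0 := \<sigma> l0 - 1)) l \<le> p" for i l p
  proof (cases "l = l0")
    case False then show ?thesis using Bb[OF il] p unfolding B'_def by simp
  next
    case True
    have p': "\<sigma> l0 - 1 \<le> p" using p True by simp
    have "coeff (h l * B i l) p = (if p = \<sigma> l0 - 1 then coeff (B i l) (\<sigma> l - 1) * \<gamma> l / \<gamma> l0 else 0)"
      if l: "l < q" for l
    proof (cases "l \<in> G")
      case False
      then have "\<gamma> l = 0" using l unfolding G_def by simp
      then show ?thesis using False unfolding h_def by simp
    next
      case lG: True
      note s = smax[OF lG] s1[OF lG]
      have c: "coeff (h l * B i l) p = \<gamma> l / \<gamma> l0 * coeff (B i l) (p - (\<sigma> l0 - \<sigma> l))"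
        using lG p' s unfolding h_def by (simp add: coeff_monom_mult)
      show ?thesis
      proof (cases "p = \<sigma> l0 - 1")
        case True
        then have "p - (\<sigma> l0 - \<sigma> l) = \<sigma> l - 1" using s by simp
        then show ?thesis using c True by simp
      next
        case False
        then have "\<sigma> l \<le> p - (\<sigma> l0 - \<sigma> l)" using s p' by simp
        then show ?thesis using c False Bb[OF il(1) l] by simp
      qed
    qed
    then have "coeff (B' i l0) p =
        (\<Sum>l<q. if p = \<sigma> l0 - 1 then coeff (B i l) (\<sigma> l - 1) * \<gamma> l / \<gamma> l0 else 0)"
      unfolding B'_def by (simp add: coeff_sum)
    also have "\<dots> = (if p = \<sigma> l0 - 1 then (\<Sum>l<q. coeff (B i l) (\<sigma> l - 1) * \<gamma> l) / \<gamma> l0 else 0)"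
      by (simp add: sum_divide_distrib)
    also have "\<dots> = 0" unfolding top[OF il(1)] by simp
    finally show ?thesis using True by simp
  qed
  ultimately have "bounded_factorization q Q (\<sigma>(l0 := \<sigma> l0 - 1)) B' C'"
    unfolding bounded_factorization_def by blast
  then show thesis by (rule that[OF l0q s1[OF l0(1)]])
qed

text \<open>A factorisation with the least sum of degree bounds admits no reduction, hence its degrees are
  complementary: every column of \<open>B\<close> of degree \<open>d\<close> meets a row of \<open>C\<close> of degree at most \<open>k - d\<close>. Therefore
  \<open>B\<close> and \<open>C\<close> can be varied independently within these bounds without leaving degree \<open>k\<close>.\<close>

lemma singular_degree_factorization:
  assumes Q: "Q \<in> mat_polys (Suc q) k" and "det Q = 0"
  obtains B C d where "\<And>i j. i < Suc q \<Longrightarrow> j < Suc q \<Longrightarrow> Q $$ (i,j) = (\<Sum>l<q. B i l * C l j)"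
    "\<And>l. l < q \<Longrightarrow> d l \<le> k"
    "\<And>i l. i < Suc q \<Longrightarrow> l < q \<Longrightarrow> degree (B i l) \<le> d l"
    "\<And>l j. l < q \<Longrightarrow> j < Suc q \<Longrightarrow> degree (C l j) \<le> k - d l"
proof -
  let ?n = "Suc q"
  have Qc: "Q \<in> carrier_mat ?n ?n" using Q unfolding mat_polys_def by auto
  define P where "P = (\<lambda>\<sigma>. \<exists>B C. bounded_factorization q Q \<sigma> B C)"
  obtain \<sigma>0 where "P \<sigma>0" using singular_imp_factorization[OF Qc assms(2)] unfolding P_def by blast
  then obtain \<sigma> where \<sigma>: "P \<sigma>" "\<And>\<sigma>'. P \<sigma>' \<Longrightarrow> (\<Sum>l<q. \<sigma> l) \<le> (\<Sum>l<q. \<sigma>' l)"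
    using ex_has_least_nat[of P \<sigma>0 "\<lambda>\<sigma>. \<Sum>l<q. \<sigma> l"] by blast
  obtain B C where fac: "bounded_factorization q Q \<sigma> B C" using \<sigma>(1) unfolding P_def by blast
  have Cb: "coeff (C l j) e = 0" if lj: "l < q" "j < ?n" "1 \<le> \<sigma> l" "k + 1 < e + \<sigma> l" for l j e
  proof (rule ccontr)
    assume "coeff (C l j) e \<noteq> 0"
    then obtain l0 B' C' where r: "l0 < q" "1 \<le> \<sigma> l0"
      "bounded_factorization q Q (\<sigma>(l0 := \<sigma> l0 - 1)) B' C'"
      using bounded_factorization_reduce[OF fac Q lj(1-3) _ lj(4)] by metis
    then have "(\<Sum>l<q. \<sigma> l) \<le> (\<Sum>l<q. (\<sigma>(l0 := \<sigma> l0 - 1)) l)"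
      using \<sigma>(2) unfolding P_def by blast
    moreover have "(\<Sum>l<q. (\<sigma>(l0 := \<sigma> l0 - 1)) l) < (\<Sum>l<q. \<sigma> l)"
      using r(1,2) by (intro sum_strict_mono_ex1) auto
    ultimately show False by simp
  qed
  define good where "good = (\<lambda>l. 1 \<le> \<sigma> l \<and> \<sigma> l \<le> k + 1)"
  define B' where "B' = (\<lambda>i l. if good l then B i l else 0)"
  define C' where "C' = (\<lambda>l j. if good l then C l j else 0)"
  define d where "d = (\<lambda>l. if good l then \<sigma> l - 1 else 0)"
  show thesis
  proof (rule that[of B' C' d])
    fix i j assume ij: "i < ?n" "j < ?n"
    have "B i l * C l j = B' i l * C' l j" if l: "l < q" for l
    proof (cases "good l")
      case False
      consider "\<sigma> l = 0" | "1 \<le> \<sigma> l" "k + 1 < \<sigma> l" using False unfolding good_def by linarith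
      then have "B i l = 0 \<or> C l j = 0"
      proof cases
        case 1
        then have "B i l = 0" using fac ij(1) l unfolding bounded_factorization_def
          by (intro poly_eqI) simp
        then show ?thesis ..
      next
        case 2
        then have "C l j = 0" using Cb[OF l ij(2)] by (intro poly_eqI) simp
        then show ?thesis ..
      qed
      then show ?thesis using False unfolding B'_def by auto
    qed (simp add: B'_def C'_def)
    then show "Q $$ (i,j) = (\<Sum>l<q. B' i l * C' l j)"
      using fac ij unfolding bounded_factorization_def by simp
  next
    fix l assume "l < q" then show "d l \<le> k" unfolding d_def good_def by auto
  next
    fix i l assume il: "i < ?n" "l < q"
    show "degree (B' i l) \<le> d l"
    proof (cases "good l")
      case True
      have "coeff (B i l) m = 0" if "\<sigma> l - 1 < m" for m
        using fac il that unfolding bounded_factorization_def by simp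
      then show ?thesis using True unfolding B'_def d_def by (auto intro!: degree_le)
    qed (simp add: B'_def)
  next
    fix l j assume lj: "l < q" "j < ?n"
    show "degree (C' l j) \<le> k - d l"
    proof (cases "good l")
      case True
      have "coeff (C l j) e = 0" if "k - (\<sigma> l - 1) < e" for e
        using Cb[OF lj] True that unfolding good_def by simp
      then show ?thesis using True unfolding C'_def d_def by (auto intro!: degree_le)
    qed (simp add: C'_def)
  qed
qed

section \<open>The derivative of the determinant\<close>

text \<open>Expansion along the first row: the minor of its last entry is triangular with diagonal \<open>-1\<close>, and
  its sign cancels that of the cofactor.\<close>

lemma det_bidiagonal_bordered:
  fixes p c :: "nat \<Rightarrow> 'a :: idom"
  shows "det (mat (Suc q) (Suc q) (\<lambda>(a,l).
      if l < q then (if a = l then p l else if a = Suc l then -1 else 0) else c a)) =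
    (\<Sum>a<Suc q. c a * (\<Prod>l<a. p l))"
proof (induction q arbitrary: p c)
  case 0
  show ?case by (subst det_single) auto
next
  case (Suc q)
  define M where "M = mat (Suc (Suc q)) (Suc (Suc q)) (\<lambda>(a,l).
      if l < Suc q then (if a = l then p l else if a = Suc l then -1 else 0) else c a)"
  have M: "M \<in> carrier_mat (Suc (Suc q)) (Suc (Suc q))" unfolding M_def by simp
  have del0: "mat_delete M 0 0 = mat (Suc q) (Suc q) (\<lambda>(a,l).
      if l < q then (if a = l then p (Suc l) else if a = Suc l then -1 else 0) else c (Suc a))"
    unfolding M_def mat_delete_def by (rule eq_matI) auto
  have d0: "det (mat_delete M 0 0) = (\<Sum>a<Suc q. c (Suc a) * (\<Prod>l<a. p (Suc l)))"
    unfolding del0 by (rule Suc.IH)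
  have d1: "det (mat_delete M 0 (Suc q)) = (-1) ^ Suc q"
  proof -
    let ?U = "mat_delete M 0 (Suc q)"
    have U: "?U \<in> carrier_mat (Suc q) (Suc q)" using mat_delete_carrier[OF M] by simp
    have e: "?U $$ (a,l) = (if Suc a = l then p l else if a = l then -1 else 0)"
      if "a < Suc q" "l < Suc q" for a l
      using that unfolding M_def mat_delete_def by auto
    have "upper_triangular ?U" using U by (intro upper_triangularI) (auto simp: e)
    then have "det ?U = prod_list (diag_mat ?U)" using det_upper_triangular U by blast
    also have "\<dots> = (\<Prod>a\<in>{0..<Suc q}. -1)"
      unfolding prod_list_diag_prod using U by (intro prod.cong) (auto simp: e)
    finally show ?thesis by simp
  qed
  have "det M = (\<Sum>l<Suc (Suc q). M $$ (0,l) * cofactor M 0 l)"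
    by (rule laplace_expansion_row[OF M]) simp
  also have "\<dots> = M $$ (0,0) * cofactor M 0 0 + M $$ (0,Suc q) * cofactor M 0 (Suc q)"
  proof -
    have "(\<Sum>l<Suc (Suc q). M $$ (0,l) * cofactor M 0 l) =
        (\<Sum>l\<in>{0, Suc q}. M $$ (0,l) * cofactor M 0 l)"
      by (rule sum.mono_neutral_right) (auto simp: M_def)
    then show ?thesis by simp
  qed
  also have "\<dots> = p 0 * det (mat_delete M 0 0) + c 0"
    unfolding cofactor_def d1 by (simp add: M_def power_mult_distrib[symmetric])
  also have "\<dots> = (\<Sum>a<Suc (Suc q). c a * (\<Prod>l<a. p l))"
    unfolding d0 sum_distrib_left
    by (subst sum.lessThan_Suc_shift[of _ "Suc q"])
      (simp add: prod.lessThan_Suc_shift mult_ac del: sum.lessThan_Suc prod.lessThan_Suc)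
  finally show ?case unfolding M_def .
qed

text \<open>The determinant of \<open>A + s E\<close> as a polynomial in the outer variable \<open>s\<close>.\<close>

definition pencil_det ::
  "nat \<Rightarrow> (nat \<Rightarrow> nat \<Rightarrow> complex poly) \<Rightarrow> (nat \<Rightarrow> nat \<Rightarrow> complex poly) \<Rightarrow> complex poly poly" where
  "pencil_det n A E = det (mat n n (\<lambda>(a,b). [:A a b, E a b:]))"

text \<open>The derivative of the determinant at \<open>A\<close> in direction \<open>E\<close>; it is linear in \<open>E\<close>.\<close>

definition det_derivative ::
  "nat \<Rightarrow> (nat \<Rightarrow> nat \<Rightarrow> complex poly) \<Rightarrow> (nat \<Rightarrow> nat \<Rightarrow> complex poly) \<Rightarrow> complex poly" where
  "det_derivative n A E = coeff (pencil_det n A E) 1"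

lemma poly_pencil_det:
  "poly (pencil_det n A E) S = det (mat n n (\<lambda>(a,b). A a b + S * E a b))"
proof -
  interpret ph: comm_ring_hom "\<lambda>p :: complex poly poly. poly p S" by standard auto
  let ?M = "mat n n (\<lambda>(a,b). [:A a b, E a b:])"
  have "poly (pencil_det n A E) S = det (map_mat (\<lambda>p. poly p S) ?M)"
    unfolding pencil_det_def by simp
  also have "map_mat (\<lambda>p. poly p S) ?M = mat n n (\<lambda>(a,b). A a b + S * E a b)"
    by (rule eq_matI) auto
  finally show ?thesis .
qed

lemma coeff_prod_linear:
  fixes a e :: "'i \<Rightarrow> 'a :: comm_ring_1"
  assumes "finite I"
  shows "coeff (\<Prod>i\<in>I. [:a i, e i:]) 0 = (\<Prod>i\<in>I. a i)"
    "coeff (\<Prod>i\<in>I. [:a i, e i:]) 1 = (\<Sum>i\<in>I. e i * (\<Prod>j\<in>I - {i}. a j))"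
proof -
  have "coeff (\<Prod>i\<in>I. [:a i, e i:]) 0 = (\<Prod>i\<in>I. a i) \<and>
    coeff (\<Prod>i\<in>I. [:a i, e i:]) 1 = (\<Sum>i\<in>I. e i * (\<Prod>j\<in>I - {i}. a j))"
    using assms
  proof (induction I rule: finite_induct)
    case (insert x I)
    have "(\<Sum>i\<in>I. e i * (\<Prod>j\<in>insert x I - {i}. a j)) = a x * (\<Sum>i\<in>I. e i * (\<Prod>j\<in>I - {i}. a j))"
      unfolding sum_distrib_left
    proof (rule sum.cong[OF refl])
      fix i assume i: "i \<in> I"
      have "insert x I - {i} = insert x (I - {i})" using i insert.hyps by auto
      then show "e i * (\<Prod>j\<in>insert x I - {i}. a j) = a x * (e i * (\<Prod>j\<in>I - {i}. a j))"
        using insert.hyps by (simp add: mult_ac)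
    qed
    moreover have "insert x I - {x} = I" using insert.hyps by auto
    ultimately show ?case using insert.IH insert.hyps by (simp add: algebra_simps)
  qed simp
  then show "coeff (\<Prod>i\<in>I. [:a i, e i:]) 0 = (\<Prod>i\<in>I. a i)"
    "coeff (\<Prod>i\<in>I. [:a i, e i:]) 1 = (\<Sum>i\<in>I. e i * (\<Prod>j\<in>I - {i}. a j))" by auto
qed

lemma coeff_signof_mult:
  "coeff (signof p * x) i = signof p * coeff (x :: 'a :: comm_ring_1 poly) i"
  by (cases "sign p = 1") (auto simp: sign_def)

lemma det_derivative_formula:
  "det_derivative n A E = (\<Sum>p\<in>{p. p permutes {0..<n}}. signof p *
     (\<Sum>i\<in>{0..<n}. E i (p i) * (\<Prod>j\<in>{0..<n} - {i}. A j (p j))))"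
proof -
  have "pencil_det n A E = (\<Sum>p\<in>{p. p permutes {0..<n}}. signof p *
      (\<Prod>i\<in>{0..<n}. [:A i (p i), E i (p i):]))"
    unfolding pencil_det_def
    by (subst det_def'[of _ n]) (auto intro!: sum.cong prod.cong simp: permutes_in_image)
  then show ?thesis unfolding det_derivative_def
    by (simp add: coeff_sum coeff_signof_mult coeff_prod_linear(2)[unfolded One_nat_def])
qed

lemma coeff_pencil_det_0: "coeff (pencil_det n A E) 0 = det (mat n n (\<lambda>(a,b). A a b))"
proof -
  have "coeff (pencil_det n A E) 0 = poly (pencil_det n A E) 0" by (simp add: poly_0_coeff_0)
  then show ?thesis unfolding poly_pencil_det by simp
qed

lemma det_derivative_sum:
  assumes "finite S"
  shows "det_derivative n A (\<lambda>a b. \<Sum>m\<in>S. [:c m:] * E m a b) =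
    (\<Sum>m\<in>S. [:c m:] * det_derivative n A (E m))"
proof -
  define X where "X = (\<lambda>m p. \<Sum>i\<in>{0..<n}. E m i (p i) * (\<Prod>j\<in>{0..<n} - {i}. A j (p j)))"
  let ?P = "{p. p permutes {0..<n}}"
  have "(\<Sum>i\<in>{0..<n}. (\<Sum>m\<in>S. [:c m:] * E m i (p i)) * (\<Prod>j\<in>{0..<n} - {i}. A j (p j))) =
      (\<Sum>m\<in>S. [:c m:] * X m p)" for p
    unfolding X_def sum_distrib_left sum_distrib_right
    by (subst sum.swap) (simp only: mult.assoc)
  then have "det_derivative n A (\<lambda>a b. \<Sum>m\<in>S. [:c m:] * E m a b) =
      (\<Sum>p\<in>?P. signof p * (\<Sum>m\<in>S. [:c m:] * X m p))"
    unfolding det_derivative_formula by (simp only:)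
  also have "\<dots> = (\<Sum>p\<in>?P. \<Sum>m\<in>S. [:c m:] * (signof p * X m p))"
    by (simp only: sum_distrib_left mult.left_commute)
  also have "\<dots> = (\<Sum>m\<in>S. \<Sum>p\<in>?P. [:c m:] * (signof p * X m p))" by (rule sum.swap)
  also have "\<dots> = (\<Sum>m\<in>S. [:c m:] * det_derivative n A (E m))"
    unfolding det_derivative_formula X_def sum_distrib_left ..
  finally show ?thesis .
qed

lemma degree_signof: "degree (signof p :: complex poly) = 0"
  by (cases "sign p = 1") (auto simp: sign_def)

lemma degree_det_derivative:
  assumes "\<And>a b. a < n \<Longrightarrow> b < n \<Longrightarrow> degree (A a b) \<le> k"
    and "\<And>a b. a < n \<Longrightarrow> b < n \<Longrightarrow> degree (E a b) \<le> k"
  shows "degree (det_derivative n A E) \<le> k * n"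
  unfolding det_derivative_formula
proof (intro degree_sum_le)
  fix p assume "p \<in> {p. p permutes {0..<n}}"
  then have p: "p permutes {0..<n}" by simp
  have pn: "p i < n" if "i < n" for i using permutes_in_image[OF p, of i] that by simp
  have "degree (E i (p i) * (\<Prod>j\<in>{0..<n} - {i}. A j (p j))) \<le> k * n" if i: "i < n" for i
  proof -
    have "degree (E i (p i) * (\<Prod>j\<in>{0..<n} - {i}. A j (p j))) \<le>
        degree (E i (p i)) + degree (\<Prod>j\<in>{0..<n} - {i}. A j (p j))" by (rule degree_mult_le)
    also have "\<dots> \<le> k + (\<Sum>j\<in>{0..<n} - {i}. degree (A j (p j)))"
      using assms(2)[OF i pn[OF i]]
        degree_prod_sum_le[of "{0..<n} - {i}" "\<lambda>j. A j (p j)"] by (simp add: comp_def)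
    also have "\<dots> \<le> k + (\<Sum>j\<in>{0..<n} - {i}. k)"
      using assms(1) pn by (intro add_left_mono sum_mono) auto
    also have "\<dots> = k * n" using i by (cases n) auto
    finally show ?thesis .
  qed
  then have "degree (\<Sum>i\<in>{0..<n}. E i (p i) * (\<Prod>j\<in>{0..<n} - {i}. A j (p j))) \<le> k * n"
    by (intro degree_sum_le) auto
  then show "degree (signof p * (\<Sum>i\<in>{0..<n}. E i (p i) * (\<Prod>j\<in>{0..<n} - {i}. A j (p j)))) \<le> k * n"
    using degree_mult_le[of "signof p" "\<Sum>i\<in>{0..<n}. E i (p i) * (\<Prod>j\<in>{0..<n} - {i}. A j (p j))"]
      degree_signof[of p] by linarith
qed (simp add: finite_permutations)

text \<open>The left kernel of this bidiagonal matrix with \<open>q\<close> columns is spanned by the vector with entries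
  \<open>x\<^bsup>d 0 + \<dots> + d (a - 1)\<^esup>\<close>, so consecutive degrees differ by a column degree only.\<close>

definition bidiagonal :: "(nat \<Rightarrow> nat) \<Rightarrow> nat \<Rightarrow> nat \<Rightarrow> complex poly" where
  "bidiagonal d a l = (if a = l then monom 1 (d l) else if a = Suc l then -1 else 0)"

text \<open>With \<open>E = u v\<close> of rank one, \<open>B C + s E\<close> is the product of \<open>B\<close> bordered by the column \<open>s u\<close> and \<open>C\<close>
  bordered by the row \<open>v\<close>, so its determinant is an explicit product.\<close>

lemma det_derivative_model:
  assumes ij: "i < Suc q" "j < Suc q"
  shows "det_derivative (Suc q) (\<lambda>a b. \<Sum>l<q. bidiagonal d a l * bidiagonal d' b l)
      (\<lambda>a b. if a = i \<and> b = j then w else 0) =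
    w * (\<Prod>l<i. monom 1 (d l)) * (\<Prod>l<j. monom 1 (d' l))"
proof -
  let ?n = "Suc q"
  define B where "B = mat ?n ?n (\<lambda>(a,l). if l < q
      then (if a = l then [:monom 1 (d l):] else if a = Suc l then -1 else 0)
      else (if a = i then [:0, w:] else 0))"
  define C where "C = mat ?n ?n (\<lambda>(b,l). if l < q
      then (if b = l then [:monom 1 (d' l):] else if b = Suc l then -1 else 0)
      else (if b = j then 1 else (0 :: complex poly poly)))"
  have B: "B \<in> carrier_mat ?n ?n" and C: "C \<in> carrier_mat ?n ?n" unfolding B_def C_def by auto
  have Bl: "B $$ (a,l) = [:bidiagonal d a l:]" "C $$ (a,l) = [:bidiagonal d' a l:]"
    if "a < ?n" "l < q" for a l
    using that unfolding B_def C_def bidiagonal_def by (auto simp: one_pCons)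
  have Bq: "B $$ (a,q) = (if a = i then [:0, w:] else 0)" "C $$ (a,q) = (if a = j then 1 else 0)"
    if "a < ?n" for a using that unfolding B_def C_def by auto
  have const_sum: "(\<Sum>l<m. [:x l:]) = [:\<Sum>l<m. x l:]" for x :: "nat \<Rightarrow> complex poly" and m
    by (induction m) auto
  have "mat ?n ?n (\<lambda>(a,b). [:\<Sum>l<q. bidiagonal d a l * bidiagonal d' b l,
      if a = i \<and> b = j then w else 0:]) = B * C\<^sup>T" (is "?M = _")
  proof (rule eq_matI)
    fix a b assume "a < dim_row (B * C\<^sup>T)" "b < dim_col (B * C\<^sup>T)"
    then have ab: "a < ?n" "b < ?n" using B C by auto
    have "(B * C\<^sup>T) $$ (a,b) = (\<Sum>l<?n. B $$ (a,l) * C\<^sup>T $$ (l,b))"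
      by (rule mat_prod_index_sum[OF B _ ab]) (use C in simp)
    also have "\<dots> = (\<Sum>l<?n. B $$ (a,l) * C $$ (b,l))"
      by (rule sum.cong) (use ab C in auto)
    also have "\<dots> = (\<Sum>l<q. [:bidiagonal d a l * bidiagonal d' b l:]) +
        (if a = i then [:0, w:] else 0) * (if b = j then 1 else 0)"
      using ab by (simp add: Bl Bq mult.commute)
    finally show "?M $$ (a,b) = (B * C\<^sup>T) $$ (a,b)"
      using ab by (simp add: const_sum mult.commute)
  qed (use B C in auto)
  then have "pencil_det ?n (\<lambda>a b. \<Sum>l<q. bidiagonal d a l * bidiagonal d' b l)
      (\<lambda>a b. if a = i \<and> b = j then w else 0) = det B * det C"
    unfolding pencil_det_def using det_mult[OF B, of "C\<^sup>T"] det_transpose[OF C] C by simp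
  moreover have "det B = [:0, w:] * (\<Prod>l<i. [:monom 1 (d l):])"
  proof -
    have "det B = (\<Sum>a<?n. (if a = i then [:0, w:] else 0) * (\<Prod>l<a. [:monom 1 (d l):]))"
      unfolding B_def by (rule det_bidiagonal_bordered)
    also have "\<dots> = (\<Sum>a<?n. if a = i then [:0, w:] * (\<Prod>l<i. [:monom 1 (d l):]) else 0)"
      by (rule sum.cong) auto
    finally show ?thesis using ij by simp
  qed
  moreover have "det C = (\<Prod>l<j. [:monom 1 (d' l):])"
  proof -
    have "det C = (\<Sum>a<?n. (if a = j then 1 else 0) * (\<Prod>l<a. [:monom 1 (d' l):]))"
      unfolding C_def by (rule det_bidiagonal_bordered)
    also have "\<dots> = (\<Sum>a<?n. if a = j then (\<Prod>l<j. [:monom 1 (d' l):]) else 0)"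
      by (rule sum.cong) auto
    finally show ?thesis using ij by simp
  qed
  moreover have "(\<Prod>l<m. [:x l:]) = [:\<Prod>l<m. x l:]" for x :: "nat \<Rightarrow> complex poly" and m
    by (induction m) (auto simp: one_pCons)
  ultimately show ?thesis unfolding det_derivative_def by (simp add: mult_ac)
qed

text \<open>Consecutive partial sums differ by at most \<open>K\<close>, so the intervals of length \<open>K\<close> that start at them leave
  no gap.\<close>

lemma partial_sum_gap:
  fixes d :: "nat \<Rightarrow> nat"
  assumes "\<And>l. l < q \<Longrightarrow> d l \<le> K" "m \<le> (\<Sum>l<q. d l) + K"
  shows "\<exists>i\<le>q. (\<Sum>l<i. d l) \<le> m \<and> m \<le> (\<Sum>l<i. d l) + K"
  using assms
proof (induction q)
  case (Suc q)
  show ?case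
  proof (cases "(\<Sum>l<Suc q. d l) \<le> m")
    case True then show ?thesis using Suc.prems(2) by blast
  next
    case False
    then have "m \<le> (\<Sum>l<q. d l) + K" using Suc.prems(1)[of q] by simp
    then show ?thesis using Suc.IH Suc.prems(1) le_SucI by (metis less_SucI)
  qed
qed auto

text \<open>The exponents available on either side have gaps of at most \<open>k\<close>, and the free exponent \<open>e\<close> fills
  the gaps.\<close>

lemma model_reaches_every_degree:
  assumes d: "\<And>l. l < q \<Longrightarrow> d l \<le> k" and m: "m \<le> k * Suc q"
  shows "\<exists>i\<le>q. \<exists>j\<le>q. \<exists>e\<le>k. (\<Sum>l<i. d l) + (\<Sum>l<j. k - d l) + e = m"
proof -
  let ?a = "\<Sum>l<q. d l"
  have "?a + (\<Sum>l<q. k - d l) = (\<Sum>l<q. k)"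
    unfolding sum.distrib[symmetric] by (rule sum.cong) (use d in auto)
  then have "m \<le> (\<Sum>l<q. k - d l) + (?a + k)" using m by (simp add: mult.commute)
  moreover have "k - d l \<le> ?a + k" for l by (rule order_trans[OF diff_le_self]) simp
  ultimately obtain j where
    j: "j \<le> q" "(\<Sum>l<j. k - d l) \<le> m" "m \<le> (\<Sum>l<j. k - d l) + (?a + k)"
    using partial_sum_gap[of q "\<lambda>l. k - d l" "?a + k" m] by blast
  define m' where "m' = m - (\<Sum>l<j. k - d l)"
  have "m' \<le> ?a + k" using j unfolding m'_def by linarith
  then obtain i where i: "i \<le> q" "(\<Sum>l<i. d l) \<le> m'" "m' \<le> (\<Sum>l<i. d l) + k"
    using partial_sum_gap[of q d k m'] d by blast
  define e where "e = m' - (\<Sum>l<i. d l)"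
  have "e \<le> k" "(\<Sum>l<i. d l) + (\<Sum>l<j. k - d l) + e = m"
    using i j unfolding e_def m'_def by linarith+
  then show ?thesis using i(1) j(1) by blast
qed

definition polynomial_in :: "(complex \<Rightarrow> complex) \<Rightarrow> bool" where
  "polynomial_in f \<longleftrightarrow> (\<exists>p. \<forall>t. f t = poly p t)"

lemma polynomial_in_const: "polynomial_in (\<lambda>_. c)"
  unfolding polynomial_in_def by (rule exI[of _ "[:c:]"]) simp

lemma polynomial_in_id: "polynomial_in (\<lambda>t. t)"
  unfolding polynomial_in_def by (rule exI[of _ "[:0, 1:]"]) simp

lemma polynomial_in_add: "polynomial_in f \<Longrightarrow> polynomial_in g \<Longrightarrow> polynomial_in (\<lambda>t. f t + g t)"
  unfolding polynomial_in_def by (metis poly_add)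

lemma polynomial_in_diff: "polynomial_in f \<Longrightarrow> polynomial_in g \<Longrightarrow> polynomial_in (\<lambda>t. f t - g t)"
  unfolding polynomial_in_def by (metis poly_diff)

lemma polynomial_in_mult: "polynomial_in f \<Longrightarrow> polynomial_in g \<Longrightarrow> polynomial_in (\<lambda>t. f t * g t)"
  unfolding polynomial_in_def by (metis poly_mult)

lemma polynomial_in_sum:
  "(\<And>i. i \<in> I \<Longrightarrow> polynomial_in (f i)) \<Longrightarrow> polynomial_in (\<lambda>t. \<Sum>i\<in>I. f i t)"
  by (induction I rule: infinite_finite_induct)
    (auto intro: polynomial_in_const polynomial_in_add)

lemma polynomial_in_prod:
  "(\<And>i. i \<in> I \<Longrightarrow> polynomial_in (f i)) \<Longrightarrow> polynomial_in (\<lambda>t. \<Prod>i\<in>I. f i t)"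
  by (induction I rule: infinite_finite_induct)
    (auto intro: polynomial_in_const polynomial_in_mult)

lemma polynomial_in_tendsto:
  assumes "polynomial_in f" shows "(f \<longlongrightarrow> f a) (at a)"
proof -
  obtain p where "f = poly p" using assms unfolding polynomial_in_def by (metis ext)
  then show ?thesis using poly_isCont[of a p] unfolding isCont_def by simp
qed

lemma polynomial_in_eventually_nonzero:
  assumes "polynomial_in f" "f b \<noteq> 0"
  shows "eventually (\<lambda>t. f t \<noteq> 0) (at a)"
proof -
  obtain p where p: "f = poly p" using assms unfolding polynomial_in_def by (metis ext)
  define S where "S = {x. poly p x = 0} - {a}"
  have "p \<noteq> 0" using assms(2) p by auto
  then have "open (- S)" unfolding S_def
    by (intro open_Compl finite_imp_closed) (simp add: poly_roots_finite)
  then have "eventually (\<lambda>x. x \<in> - S) (nhds a)"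
    by (rule eventually_nhds_in_open) (simp add: S_def)
  then show ?thesis unfolding eventually_at_filter p by eventually_elim (auto simp: S_def)
qed

definition polynomial_family :: "(complex \<Rightarrow> complex poly) \<Rightarrow> bool" where
  "polynomial_family F \<longleftrightarrow> (\<forall>i. polynomial_in (\<lambda>t. coeff (F t) i))"

lemma polynomial_family_const: "polynomial_family (\<lambda>_. p)"
  unfolding polynomial_family_def by (simp add: polynomial_in_const)

lemma polynomial_family_add:
  "polynomial_family F \<Longrightarrow> polynomial_family G \<Longrightarrow> polynomial_family (\<lambda>t. F t + G t)"
  unfolding polynomial_family_def by (simp add: polynomial_in_add)

lemma polynomial_family_mult:
  "polynomial_family F \<Longrightarrow> polynomial_family G \<Longrightarrow> polynomial_family (\<lambda>t. F t * G t)"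
  unfolding polynomial_family_def coeff_mult
  by (intro allI polynomial_in_sum polynomial_in_mult) auto

lemma polynomial_family_scalar: "polynomial_in f \<Longrightarrow> polynomial_family (\<lambda>t. [:f t:])"
  unfolding polynomial_family_def
proof
  fix i assume "polynomial_in f"
  then show "polynomial_in (\<lambda>t. coeff [:f t:] i)"
    by (cases i) (simp_all add: polynomial_in_const)
qed

lemma polynomial_family_sum:
  "(\<And>i. i \<in> I \<Longrightarrow> polynomial_family (F i)) \<Longrightarrow> polynomial_family (\<lambda>t. \<Sum>i\<in>I. F i t)"
  by (induction I rule: infinite_finite_induct)
    (auto intro: polynomial_family_const polynomial_family_add)

lemma polynomial_family_prod:
  "(\<And>i. i \<in> I \<Longrightarrow> polynomial_family (F i)) \<Longrightarrow> polynomial_family (\<lambda>t. \<Prod>i\<in>I. F i t)"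
  by (induction I rule: infinite_finite_induct)
    (auto intro: polynomial_family_const polynomial_family_mult)

lemma polynomial_family_det_derivative:
  assumes "\<And>a b. polynomial_family (\<lambda>t. A t a b)"
  shows "polynomial_family (\<lambda>t. det_derivative n (A t) E)"
  unfolding det_derivative_formula
  by (intro polynomial_family_sum polynomial_family_mult polynomial_family_prod
      polynomial_family_const assms)

lemma polynomial_in_det:
  assumes "\<And>a b. a < n \<Longrightarrow> b < n \<Longrightarrow> polynomial_in (\<lambda>t. f t a b)"
  shows "polynomial_in (\<lambda>t. det (mat n n (\<lambda>(a,b). f t a b)))"
proof -
  have "det (mat n n (\<lambda>(a,b). f t a b)) =
      (\<Sum>p\<in>{p. p permutes {0..<n}}. signof p * (\<Prod>i\<in>{0..<n}. f t i (p i)))" for t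
    by (subst det_def'[of _ n]) (auto intro!: sum.cong prod.cong simp: permutes_in_image)
  moreover have "polynomial_in (\<lambda>t. \<Sum>p\<in>{p. p permutes {0..<n}}. signof p * (\<Prod>i\<in>{0..<n}. f t i (p i)))"
    by (intro polynomial_in_sum polynomial_in_mult polynomial_in_prod polynomial_in_const assms)
      (auto simp: permutes_in_image)
  ultimately show ?thesis by simp
qed

lemma polynomial_family_poly_const: "polynomial_family (\<lambda>s. poly G [:s:])"
proof (induction G)
  case (pCons a G)
  have "polynomial_family (\<lambda>s. a + [:s:] * poly G [:s:])"
    by (intro polynomial_family_add polynomial_family_mult polynomial_family_const
      polynomial_family_scalar polynomial_in_id pCons.IH)
  then show ?case by simp
qed (simp add: polynomial_family_const)

lemma polynomial_family_eventually_close: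
  assumes F: "polynomial_family F" and \<kappa>: "0 < \<kappa>"
  shows "eventually (\<lambda>t. \<forall>i\<le>N. cmod (coeff (F t) i - coeff (F a) i) < \<kappa>) (at a)"
proof -
  have "eventually (\<lambda>t. cmod (coeff (F t) i - coeff (F a) i) < \<kappa>) (at a)" for i
    using tendstoD[OF polynomial_in_tendsto \<kappa>] F
    unfolding polynomial_family_def dist_norm by blast
  then have "eventually (\<lambda>t. \<forall>i\<in>{..N}. cmod (coeff (F t) i - coeff (F a) i) < \<kappa>) (at a)"
    by (simp add: eventually_ball_finite_distrib)
  then show ?thesis by (rule eventually_mono) auto
qed

text \<open>At a root \<open>\<mu>\<close> of \<open>p\<close> the value \<open>\<bar>D\<bar> \<bar>\<mu> - z\<bar>\<^sup>N\<close> equals the error, which is at most a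
  constant multiple of \<open>\<kappa> (1 + \<bar>\<mu> - z\<bar>)\<^sup>N\<close>; the bound on the degree makes this work for large \<open>\<mu>\<close>
  as well.\<close>

lemma roots_near_full_multiplicity:
  fixes D z :: complex
  assumes D: "D \<noteq> 0" and \<eta>: "0 < \<eta>"
  shows "\<exists>\<kappa>>0. \<forall>p. degree p \<le> N \<longrightarrow>
      (\<forall>i\<le>N. cmod (coeff p i - coeff ([:D:] * [:-z, 1:] ^ N) i) \<le> \<kappa>) \<longrightarrow>
      degree p = N \<and> p \<noteq> 0 \<and> (\<forall>\<mu>. poly p \<mu> = 0 \<longrightarrow> cmod (\<mu> - z) \<le> \<eta>)"
proof -
  \<comment> \<open>This is a lower bound for \<open>x / (1 + x)\<close> when \<open>x \<ge> \<eta>\<close>.\<close>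
  define \<rho> where "\<rho> = \<eta> / (1 + \<eta>)"
  have \<rho>: "0 < \<rho>" unfolding \<rho>_def using \<eta> by simp
  define c where "c = (real N + 1) * (1 + cmod z) ^ N"
  have c: "0 < c" unfolding c_def by (intro mult_pos_pos zero_less_power) (auto simp: add_pos_nonneg)
  define \<kappa> where "\<kappa> = min (cmod D / 2) (cmod D * \<rho> ^ N / (2 * c))"
  have \<kappa>: "0 < \<kappa>" "\<kappa> < cmod D" "\<kappa> * c \<le> cmod D * \<rho> ^ N / 2"
  proof -
    show "0 < \<kappa>" unfolding \<kappa>_def using D \<rho> c by simp
    show "\<kappa> < cmod D" unfolding \<kappa>_def using D by (simp add: min_less_iff_disj)
    have "\<kappa> * c \<le> cmod D * \<rho> ^ N / (2 * c) * c"
      unfolding \<kappa>_def using c by (intro mult_right_mono) auto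
    then show "\<kappa> * c \<le> cmod D * \<rho> ^ N / 2" using c by simp
  qed
  show ?thesis
  proof (intro exI[of _ \<kappa>] conjI[OF \<kappa>(1)] allI impI)
    fix p
    assume deg: "degree p \<le> N"
      and all_close: "\<forall>i\<le>N. cmod (coeff p i - coeff ([:D:] * [:-z, 1:] ^ N) i) \<le> \<kappa>"
    have close: "cmod (coeff p i - coeff ([:D:] * [:-z, 1:] ^ N) i) \<le> \<kappa>" if "i \<le> N" for i
      using all_close that by blast
    define e where "e = p - [:D:] * [:-z, 1:] ^ N"
    have topD: "coeff ([:D:] * [:-z, 1:] ^ N) N = D" by (simp add: coeff_linear_power)
    have "coeff p N \<noteq> 0"
    proof
      assume p0: "coeff p N = 0"
      have "cmod D \<le> \<kappa>" using close[OF order_refl] unfolding topD p0 by simp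
      then show False using \<kappa> by simp
    qed
    then have 1: "degree p = N" "p \<noteq> 0" using deg le_degree[of p N] by auto
    have dege: "degree e \<le> N"
      unfolding e_def using deg by (intro degree_diff_le) (auto simp: degree_linear_power)
    have "cmod (\<mu> - z) \<le> \<eta>" if root: "poly p \<mu> = 0" for \<mu>
    proof (rule ccontr)
      define x where "x = cmod (\<mu> - z)"
      assume "\<not> ?thesis"
      then have x: "\<eta> < x" unfolding x_def by simp
      have "poly e \<mu> = - (D * (\<mu> - z) ^ N)" unfolding e_def using root by (simp add: poly_power)
      then have eq: "cmod (poly e \<mu>) = cmod D * x ^ N"
        unfolding x_def by (simp add: norm_mult norm_power)
      have \<mu>1: "1 + cmod \<mu> \<le> (1 + cmod z) * (1 + x)"
      proof -
        have "cmod \<mu> \<le> cmod z + x" unfolding x_def using norm_triangle_sub[of \<mu> z] by simp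
        also have "1 + (cmod z + x) \<le> (1 + cmod z) * (1 + x)"
          using x \<eta> by (simp add: algebra_simps)
        finally show ?thesis by simp
      qed
      have "poly e \<mu> = (\<Sum>i\<le>N. coeff e i * \<mu> ^ i)"
        unfolding poly_altdef using dege
        by (intro sum.mono_neutral_left) (auto simp: coeff_eq_0)
      then have "cmod (poly e \<mu>) \<le> (\<Sum>i\<le>N. cmod (coeff e i * \<mu> ^ i))" by (simp add: norm_sum)
      also have "\<dots> \<le> (\<Sum>i\<le>N. \<kappa> * (1 + cmod \<mu>) ^ N)"
      proof (rule sum_mono)
        fix i assume i: "i \<in> {..N}"
        have "cmod \<mu> ^ i \<le> (1 + cmod \<mu>) ^ i" by (intro power_mono) auto
        also have "\<dots> \<le> (1 + cmod \<mu>) ^ N" using i by (intro power_increasing) auto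
        finally have "cmod \<mu> ^ i \<le> (1 + cmod \<mu>) ^ N" .
        then show "cmod (coeff e i * \<mu> ^ i) \<le> \<kappa> * (1 + cmod \<mu>) ^ N"
          unfolding norm_mult norm_power using close[of i] i \<kappa>(1)
          by (intro mult_mono) (auto simp: e_def)
      qed
      also have "\<dots> = (real N + 1) * \<kappa> * (1 + cmod \<mu>) ^ N" by simp
      also have "\<dots> \<le> (real N + 1) * \<kappa> * ((1 + cmod z) * (1 + x)) ^ N"
        using \<mu>1 \<kappa>(1) by (intro mult_left_mono power_mono) auto
      also have "\<dots> = \<kappa> * c * (1 + x) ^ N" unfolding c_def power_mult_distrib by simp
      also have "\<dots> \<le> cmod D * \<rho> ^ N / 2 * (1 + x) ^ N"
        using \<kappa>(3) x \<eta> by (intro mult_right_mono) auto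
      also have "\<dots> = cmod D / 2 * (\<rho> * (1 + x)) ^ N" unfolding power_mult_distrib by simp
      also have "\<dots> \<le> cmod D / 2 * x ^ N"
      proof -
        have "\<rho> * (1 + x) \<le> x" unfolding \<rho>_def using x \<eta> by (simp add: field_simps)
        then show ?thesis using \<rho> x \<eta> by (intro mult_left_mono power_mono) auto
      qed
      finally have "cmod D * x ^ N \<le> cmod D / 2 * x ^ N" unfolding eq .
      moreover have "0 < cmod D * x ^ N" using D x \<eta> by simp
      ultimately show False by simp
    qed
    then show "degree p = N \<and> p \<noteq> 0 \<and> (\<forall>\<mu>. poly p \<mu> = 0 \<longrightarrow> cmod (\<mu> - z) \<le> \<eta>)"
      using 1 by blast
  qed
qed

section \<open>Perturbing singular matrix polynomials\<close>

lemma degree_bidiagonal: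
  "degree (bidiagonal d a l) \<le> d l"
  unfolding bidiagonal_def by (auto simp: degree_monom_eq)

text \<open>Padded to a square matrix, the left factor has a zero column.\<close>

lemma det_product_through_smaller:
  fixes B C :: "nat \<Rightarrow> nat \<Rightarrow> 'a :: idom"
  shows "det (mat (Suc q) (Suc q) (\<lambda>(a,b). \<Sum>l<q. B a l * C l b)) = 0"
proof -
  let ?n = "Suc q"
  define M where "M = mat ?n ?n (\<lambda>(a,l). if l < q then B a l else 0)"
  define M' where "M' = mat ?n ?n (\<lambda>(l,b). C l b)"
  have M: "M \<in> carrier_mat ?n ?n" "M' \<in> carrier_mat ?n ?n" unfolding M_def M'_def by auto
  have "det M = (\<Sum>i<?n. M $$ (i,q) * cofactor M i q)"
    by (rule laplace_expansion_column[OF M(1)]) simp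
  also have "\<dots> = 0" by (rule sum.neutral) (auto simp: M_def)
  finally have "det M = 0" .
  then have "det (M * M') = 0" using det_mult[OF M] by simp
  moreover have "M * M' = mat ?n ?n (\<lambda>(a,b). \<Sum>l<q. B a l * C l b)" (is "_ = ?R")
  proof (rule eq_matI)
    fix a b assume "a < dim_row ?R" "b < dim_col ?R"
    then have ab: "a < ?n" "b < ?n" by auto
    have "(M * M') $$ (a,b) = (\<Sum>l<?n. M $$ (a,l) * M' $$ (l,b))"
      by (rule mat_prod_index_sum[OF M ab])
    also have "\<dots> = (\<Sum>l<q. B a l * C l b)" using ab by (simp add: M_def M'_def)
    finally show "(M * M') $$ (a,b) = ?R $$ (a,b)" using ab by simp
  qed (use M in auto)
  ultimately show ?thesis by simp
qed

text \<open>Along the segment from a factorisation of \<open>Q\<close> to the bidiagonal model all products are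
  singular, and surjectivity of the derivative of the determinant, being the nonvanishing of a
  polynomial in \<open>t\<close> that is \<open>1\<close> at the model, holds for all small \<open>t \<noteq> 0\<close>.\<close>

lemma singular_perturbation_surjective_derivative:
  assumes Q: "Q \<in> mat_polys (Suc q) k" and dQ: "det Q = 0" and \<delta>: "0 < \<delta>"
  obtains A E D where "D \<noteq> 0" 
    "\<And>a b. degree (A a b) \<le> k" "\<And>a b. degree (E a b) \<le> k"
    "det (mat (Suc q) (Suc q) (\<lambda>(a,b). A a b)) = 0"
    "det_derivative (Suc q) A E = [:D:] * [:-z, 1:] ^ (k * Suc q)"
    "coeffs_close (Suc q) \<delta> Q (mat (Suc q) (Suc q) (\<lambda>(a,b). A a b))"
proof -
  let ?n = "Suc q" and ?N = "k * Suc q"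
  obtain B0 C0 d where fac: "\<And>i j. i < ?n \<Longrightarrow> j < ?n \<Longrightarrow> Q $$ (i,j) = (\<Sum>l<q. B0 i l * C0 l j)"
    and dk: "\<And>l. l < q \<Longrightarrow> d l \<le> k"
    and B0d: "\<And>i l. i < ?n \<Longrightarrow> l < q \<Longrightarrow> degree (B0 i l) \<le> d l"
    and C0d: "\<And>l j. l < q \<Longrightarrow> j < ?n \<Longrightarrow> degree (C0 l j) \<le> k - d l"
    using singular_degree_factorization[OF Q dQ] by blast
  define B where "B = (\<lambda>a l. if a < ?n then B0 a l else 0)"
  define C where "C = (\<lambda>l b. if b < ?n then C0 l b else 0)"
  have Bd: "degree (B a l) \<le> d l" if "l < q" for a l using B0d that unfolding B_def by auto
  have Cd: "degree (C l b) \<le> k - d l" if "l < q" for b l using C0d that unfolding C_def by auto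
  define d' where "d' = (\<lambda>l. k - d l)"
  define BB where "BB = (\<lambda>t a l. [:1 - t:] * B a l + [:t:] * bidiagonal d a l)"
  define CC where "CC = (\<lambda>t l b. [:1 - t:] * C l b + [:t:] * bidiagonal d' b l)"
  define A where "A = (\<lambda>t a b. \<Sum>l<q. BB t a l * CC t l b)"
  have fam: "polynomial_family (\<lambda>t. A t a b)" for a b
    unfolding A_def BB_def CC_def
    by (intro polynomial_family_sum polynomial_family_mult polynomial_family_add
      polynomial_family_const polynomial_family_scalar polynomial_in_diff polynomial_in_const
      polynomial_in_id)
  have Adeg: "degree (A t a b) \<le> k" for t a b
    unfolding A_def
  proof (intro degree_sum_le)
    fix l assume "l \<in> {..<q}"
    then have l: "l < q" by simp
    have comb: "degree ([:x:] * p + [:y:] * p') \<le> m" if "degree p \<le> m" "degree p' \<le> m"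
      for x y :: complex and p p' m
      using that by (intro degree_add_le) (auto intro: order_trans[OF degree_smult_le])
    have "degree (BB t a l) \<le> d l" "degree (CC t l b) \<le> d' l"
      unfolding BB_def CC_def d'_def
      by (intro comb Bd[OF l] Cd[OF l] degree_bidiagonal, intro comb Cd[OF l], rule order_trans[OF degree_bidiagonal], simp)
    then have "degree (BB t a l * CC t l b) \<le> d l + d' l"
      using degree_mult_le[of "BB t a l" "CC t l b"] by linarith
    then show "degree (BB t a l * CC t l b) \<le> k" using dk[OF l] unfolding d'_def by simp
  qed simp
  have A0: "A 0 a b = Q $$ (a,b)" if "a < ?n" "b < ?n" for a b
    unfolding A_def BB_def CC_def B_def C_def using that fac by (simp add: one_pCons[symmetric])
  have A1: "A 1 = (\<lambda>a b. \<Sum>l<q. bidiagonal d a l * bidiagonal d' b l)"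
    unfolding A_def BB_def CC_def by (simp add: one_pCons[symmetric])
  \<comment> \<open>Directions whose derivatives at the model are the monomials of degree up to \<open>k n\<close>.\<close>
  have "\<forall>m. \<exists>i j e. m \<le> ?N \<longrightarrow> i \<le> q \<and> j \<le> q \<and> e \<le> k \<and> (\<Sum>l<i. d l) + (\<Sum>l<j. d' l) + e = m"
    using model_reaches_every_degree[of q d k] dk unfolding d'_def by blast
  then obtain i j e where ije: "\<And>m. m \<le> ?N \<Longrightarrow> i m \<le> q \<and> j m \<le> q \<and> e m \<le> k \<and>
      (\<Sum>l<i m. d l) + (\<Sum>l<j m. d' l) + e m = m" by metis
  define EE where "EE = (\<lambda>m a b. if a = i m \<and> b = j m then monom 1 (e m) else (0 :: complex poly))"
  have prod_monom: "(\<Prod>l<x. monom (1 :: complex) (f l)) = monom 1 (\<Sum>l<x. f l)"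
    for x :: nat and f
    by (induction x) (auto simp: mult_monom)
  have L1: "det_derivative ?n (A 1) (EE m) = monom 1 m" if m: "m \<le> ?N" for m
  proof -
    have "det_derivative ?n (A 1) (EE m) =
        monom 1 (e m) * (\<Prod>l<i m. monom 1 (d l)) * (\<Prod>l<j m. monom 1 (d' l))"
      unfolding A1 EE_def by (rule det_derivative_model) (use ije[OF m] in auto)
    also have "\<dots> = monom 1 (e m + (\<Sum>l<i m. d l) + (\<Sum>l<j m. d' l))"
      by (simp add: prod_monom mult_monom)
    also have "e m + (\<Sum>l<i m. d l) + (\<Sum>l<j m. d' l) = m" using ije[OF m] by linarith
    finally show ?thesis .
  qed
  define M where "M = (\<lambda>t. mat (Suc ?N) (Suc ?N) (\<lambda>(x,m). coeff (det_derivative ?n (A t) (EE m)) x))"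
  have Mc: "M t \<in> carrier_mat (Suc ?N) (Suc ?N)" for t unfolding M_def by simp
  have polyM: "polynomial_in (\<lambda>t. det (M t))"
    unfolding M_def
    using polynomial_family_det_derivative[of A ?n, OF fam] 
    by (intro polynomial_in_det) (simp add: polynomial_family_def)
  have "M 1 = 1\<^sub>m (Suc ?N)"
    unfolding M_def by (rule eq_matI) (auto simp: L1 less_Suc_eq_le)
  then have "det (M 1) \<noteq> 0" by simp
  then have ev1: "eventually (\<lambda>t. det (M t) \<noteq> 0) (at 0)"
    by (rule polynomial_in_eventually_nonzero[OF polyM])
  have ev2: "eventually (\<lambda>t. \<forall>a\<in>{..<?n}. \<forall>b\<in>{..<?n}. \<forall>x\<le>k.
      cmod (coeff (A t a b) x - coeff (A 0 a b) x) < \<delta>) (at 0)"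
    using polynomial_family_eventually_close[OF fam \<delta>]
    by (simp add: eventually_ball_finite_distrib)
  obtain t where t: "det (M t) \<noteq> 0" "\<forall>a\<in>{..<?n}. \<forall>b\<in>{..<?n}. \<forall>x\<le>k.
      cmod (coeff (A t a b) x - coeff (A 0 a b) x) < \<delta>"
    using eventually_happens'[OF _ eventually_conj[OF ev1 ev2]] by auto
  define tgt where "tgt = vec (Suc ?N) (\<lambda>x. coeff ([:-z, 1:] ^ ?N) x)"
  define c where "c = adj_mat (M t) *\<^sub>v tgt"
  have tgt: "tgt \<in> carrier_vec (Suc ?N)" unfolding tgt_def by simp
  have adj: "adj_mat (M t) \<in> carrier_mat (Suc ?N) (Suc ?N)" by (rule adj_mat(1)[OF Mc])
  have cc: "c \<in> carrier_vec (Suc ?N)" unfolding c_def using adj tgt by auto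
  have Mcv: "M t *\<^sub>v c = det (M t) \<cdot>\<^sub>v tgt"
  proof -
    have "M t *\<^sub>v c = (M t * adj_mat (M t)) *\<^sub>v tgt"
      unfolding c_def using Mc adj tgt by (simp add: assoc_mult_mat_vec[of _ "Suc ?N" "Suc ?N"])
    also have "\<dots> = det (M t) \<cdot>\<^sub>v (1\<^sub>m (Suc ?N) *\<^sub>v tgt)"
      unfolding adj_mat(2)[OF Mc] using tgt
      by (intro eq_vecI) (auto simp: smult_scalar_prod_distrib[of _ "Suc ?N"])
    finally show ?thesis using tgt by simp
  qed
  define E where "E = (\<lambda>a b. \<Sum>m\<in>{..<Suc ?N}. [:c $ m:] * EE m a b)"
  have EEdeg: "degree (EE m a b) \<le> k" if "m < Suc ?N" for m a b
    using ije[of m] that unfolding EE_def by (auto simp: degree_monom_eq)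
  have Edeg: "degree (E a b) \<le> k" for a b
    unfolding E_def using EEdeg
    by (intro degree_sum_le) (auto intro: order_trans[OF degree_smult_le])
  have dEc: "coeff (det_derivative ?n (A t) E) x = det (M t) * coeff ([:-z, 1:] ^ ?N) x" for x
  proof (cases "x \<le> ?N")
    case True
    then have x: "x < Suc ?N" by simp
    have "coeff (det_derivative ?n (A t) E) x = (\<Sum>m<Suc ?N. M t $$ (x,m) * c $ m)"
      unfolding E_def det_derivative_sum[OF finite_lessThan] coeff_sum
      by (rule sum.cong) (use x in \<open>auto simp: M_def\<close>)
    also have "\<dots> = (M t *\<^sub>v c) $ x"
      using x Mc[of t] cc by (simp add: scalar_prod_def atLeast0LessThan del: sum.lessThan_Suc)
    also have "\<dots> = det (M t) * coeff ([:-z, 1:] ^ ?N) x"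
      unfolding Mcv using x by (simp add: tgt_def)
    finally show ?thesis .
  next
    case False
    have "degree (det_derivative ?n (A t) E) \<le> ?N"
      by (rule degree_det_derivative) (auto intro: Adeg Edeg)
    moreover have "degree ([:-z, 1:] ^ ?N) = ?N" by (rule degree_linear_power)
    ultimately show ?thesis using False by (simp add: coeff_eq_0)
  qed
  have close: "coeffs_close ?n \<delta> Q (mat ?n ?n (\<lambda>(a,b). A t a b))"
    unfolding coeffs_close_def
  proof (intro allI impI)
    fix a b x assume ab: "a < ?n" "b < ?n"
    have "cmod (coeff (A t a b) x - coeff (A 0 a b) x) \<le> \<delta>"
    proof (cases "x \<le> k")
      case True then show ?thesis using t(2) ab by (simp add: less_imp_le)
    next
      case False
      then have "coeff (A t a b) x = 0" "coeff (A 0 a b) x = 0"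
        using Adeg[of t a b] Adeg[of 0 a b] by (auto intro!: coeff_eq_0)
      then show ?thesis using \<delta> by simp
    qed
    then show "cmod (coeff (mat ?n ?n (\<lambda>(a,b). A t a b) $$ (a,b)) x - coeff (Q $$ (a,b)) x) \<le> \<delta>"
      using ab A0 by simp
  qed
  show thesis
  proof (rule that[of "det (M t)" "A t" E])
    show "det (M t) \<noteq> 0" by (rule t(1))
    show "det (mat ?n ?n (\<lambda>(a,b). A t a b)) = 0"
      unfolding A_def by (rule det_product_through_smaller)
    show "det_derivative ?n (A t) E = [:det (M t):] * [:-z, 1:] ^ ?N"
      by (rule poly_eqI) (simp add: dEc)
  qed (fact Adeg Edeg close)+
qed

text \<open>For a singular \<open>A\<close> the determinant of \<open>A + s E\<close> is \<open>s\<close> times a polynomial that tends to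
  the derivative of the determinant in direction \<open>E\<close> as \<open>s\<close> tends to \<open>0\<close>. Choosing \<open>E\<close> so that this
  derivative is a multiple of \<open>(x - z)\<^bsup>k n\<^esup>\<close>, all \<open>k n\<close> roots are near \<open>z\<close> for small \<open>s\<close>.\<close>

lemma singular_regular_approximable:
  assumes Q: "Q \<in> mat_polys (Suc q) k" and dQ: "det Q = 0"
  shows "regular_approximable (Suc q) k z (k * Suc q) Q"
  unfolding regular_approximable_def
proof (intro allI impI)
  fix \<eta> :: real assume \<eta>: "0 < \<eta>"
  let ?n = "Suc q" and ?N = "k * Suc q"
  have \<eta>2: "0 < \<eta> / 2" using \<eta> by simp
  obtain A E D where D: "D \<noteq> 0" and Adeg: "\<And>a b. degree (A a b) \<le> k"
    and Edeg: "\<And>a b. degree (E a b) \<le> k"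
    and detA: "det (mat ?n ?n (\<lambda>(a,b). A a b)) = 0"
    and der: "det_derivative ?n A E = [:D:] * [:-z, 1:] ^ ?N"
    and clA: "coeffs_close ?n (\<eta> / 2) Q (mat ?n ?n (\<lambda>(a,b). A a b))"
    by (rule singular_perturbation_surjective_derivative[OF Q dQ \<eta>2, of z]) (rule that)
  define G where "G = pencil_det ?n A E"
  have "coeff G 0 = 0" unfolding G_def coeff_pencil_det_0 detA ..
  then obtain G1 where G1: "G = pCons 0 G1" by (cases G) auto
  have G10: "coeff G1 0 = [:D:] * [:-z, 1:] ^ ?N"
    using der unfolding det_derivative_def G_def[symmetric] G1 by simp
  define F where "F = (\<lambda>s. poly G1 [:s:])"
  have F0: "F 0 = [:D:] * [:-z, 1:] ^ ?N"
    unfolding F_def G10[symmetric] by (simp add: poly_0_coeff_0)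
  have detF: "det (mat ?n ?n (\<lambda>(a,b). A a b + [:s:] * E a b)) = [:s:] * F s" for s
    using poly_pencil_det[of ?n A E "[:s:]"] unfolding G_def[symmetric] G1 F_def by simp
  have ABdeg: "degree (A a b + [:s:] * E a b) \<le> k" for s a b
    using Adeg[of a b] Edeg[of a b]
    by (intro degree_add_le) (auto intro: order_trans[OF degree_smult_le])
  have Fdeg: "degree (F s) \<le> ?N" if s: "s \<noteq> 0" for s
  proof -
    have "degree (det (mat ?n ?n (\<lambda>(a,b). A a b + [:s:] * E a b))) \<le> ?N"
      by (rule degree_det_le) (use ABdeg in auto)
    then show ?thesis unfolding detF using s by simp
  qed
  obtain \<kappa> where \<kappa>: "0 < \<kappa>" "\<forall>p. degree p \<le> ?N \<longrightarrow>
      (\<forall>i\<le>?N. cmod (coeff p i - coeff ([:D:] * [:-z, 1:] ^ ?N) i) \<le> \<kappa>) \<longrightarrow>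
      degree p = ?N \<and> p \<noteq> 0 \<and> (\<forall>\<mu>. poly p \<mu> = 0 \<longrightarrow> cmod (\<mu> - z) \<le> \<eta>)"
    using roots_near_full_multiplicity[OF D \<eta>, of ?N z] by blast
  have ev1: "eventually (\<lambda>s. \<forall>i\<le>?N. cmod (coeff (F s) i - coeff (F 0) i) < \<kappa>) (at 0)"
    by (rule polynomial_family_eventually_close[OF _ \<kappa>(1)])
      (simp add: F_def polynomial_family_poly_const)
  have fam2: "polynomial_family (\<lambda>s. A a b + [:s:] * E a b)" for a b
    by (intro polynomial_family_add polynomial_family_mult polynomial_family_const
      polynomial_family_scalar polynomial_in_id)
  have "eventually (\<lambda>s. \<forall>x\<le>k. cmod (coeff (A a b + [:s:] * E a b) x
      - coeff (A a b + [:0:] * E a b) x) < \<eta> / 2) (at 0)" for a b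
    by (rule polynomial_family_eventually_close[OF fam2 \<eta>2])
  then have ev2: "eventually (\<lambda>s. \<forall>a\<in>{..<?n}. \<forall>b\<in>{..<?n}. \<forall>x\<le>k.
      cmod (coeff (A a b + [:s:] * E a b) x - coeff (A a b + [:0:] * E a b) x) < \<eta> / 2) (at 0)"
    by (simp only: eventually_ball_finite_distrib finite_lessThan) simp
  have ev3: "eventually (\<lambda>s :: complex. s \<noteq> 0) (at 0)"
    by (simp add: eventually_at_filter)
  obtain s where s: "s \<noteq> 0" "\<forall>i\<le>?N. cmod (coeff (F s) i - coeff (F 0) i) < \<kappa>"
    "\<forall>a\<in>{..<?n}. \<forall>b\<in>{..<?n}. \<forall>x\<le>k.
      cmod (coeff (A a b + [:s:] * E a b) x - coeff (A a b + [:0:] * E a b) x) < \<eta> / 2"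
    using eventually_happens'[OF at_neq_bot eventually_conj[OF ev3 eventually_conj[OF ev1 ev2]]]
    by (elim exE conjE) (rule that)
  define Q1 where "Q1 = mat ?n ?n (\<lambda>(a,b). A a b + [:s:] * E a b)"
  have near: "cmod (coeff (F s) i - coeff ([:D:] * [:-z, 1:] ^ ?N) i) \<le> \<kappa>" if "i \<le> ?N" for i
    using s(2) that unfolding F0 by (simp add: less_imp_le)
  have Froots: "degree (F s) = ?N" "F s \<noteq> 0" "\<And>\<mu>. poly (F s) \<mu> = 0 \<Longrightarrow> cmod (\<mu> - z) \<le> \<eta>"
    using \<kappa>(2) Fdeg[OF s(1)] near by blast+
  have Q1mp: "Q1 \<in> mat_polys ?n k"
    unfolding mat_polys_iff
  proof (intro conjI allI impI)
    show "Q1 \<in> carrier_mat ?n ?n" unfolding Q1_def by simp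
    fix a b x assume ab: "a < ?n" "b < ?n" and x: "k < x"
    have "coeff (A a b + [:s:] * E a b) x = 0"
      by (rule coeff_eq_0) (rule le_less_trans[OF ABdeg x])
    then show "coeff (Q1 $$ (a,b)) x = 0" unfolding Q1_def using ab by simp
  qed
  have "coeffs_close ?n (\<eta> / 2) (mat ?n ?n (\<lambda>(a,b). A a b)) Q1"
    unfolding coeffs_close_def
  proof (intro allI impI)
    fix a b x assume ab: "a < ?n" "b < ?n"
    have "cmod (coeff (A a b + [:s:] * E a b) x - coeff (A a b) x) \<le> \<eta> / 2"
    proof (cases "x \<le> k")
      case True
      have "cmod (coeff (A a b + [:s:] * E a b) x - coeff (A a b + [:0:] * E a b) x) < \<eta> / 2"
        using s(3) ab True by blast
      then show ?thesis by simp
    next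
      case False
      then have "k < x" by simp
      then have z: "coeff (A a b + [:s:] * E a b) x = 0" "coeff (A a b) x = 0"
        using le_less_trans[OF ABdeg] le_less_trans[OF Adeg] by (blast intro: coeff_eq_0)+
      show ?thesis unfolding z using \<eta> by simp
    qed
    then show "cmod (coeff (Q1 $$ (a,b)) x - coeff (mat ?n ?n (\<lambda>(a,b). A a b) $$ (a,b)) x) \<le> \<eta> / 2"
      unfolding Q1_def using ab by simp
  qed
  from coeffs_close_trans[OF clA this] have close: "coeffs_close ?n \<eta> Q Q1" by simp
  obtain ms where ms: "mset ms = proots (F s)" using ex_mset by blast
  have "length ms = ?N"
    using Froots size_proots_complex[of "F s"] unfolding ms[symmetric] by simp
  moreover have "F s = [:lead_coeff (F s):] * (\<Prod>\<mu>\<leftarrow>ms. [:-\<mu>, 1:])"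
  proof -
    have "(\<Prod>\<mu>\<in>#proots (F s). [:-\<mu>, 1:]) = (\<Prod>\<mu>\<leftarrow>ms. [:-\<mu>, 1:])"
      unfolding ms[symmetric] by (simp add: prod_mset_prod_list[symmetric])
    then show ?thesis using complex_poly_decompose_multiset[of "F s"] by simp
  qed
  then have "det Q1 = (\<Prod>\<mu>\<leftarrow>ms. [:-\<mu>, 1:]) * ([:s:] * [:lead_coeff (F s):])"
    unfolding Q1_def detF by (metis mult.assoc mult.commute)
  moreover have "[:s:] * [:lead_coeff (F s):] \<noteq> 0" using s(1) Froots(2) by simp
  moreover have "cmod (\<mu> - z) \<le> \<eta>" if "\<mu> \<in> set ms" for \<mu>
  proof -
    have "\<mu> \<in># proots (F s)" using that unfolding ms[symmetric] by simp
    then have "poly (F s) \<mu> = 0" using Froots(2) by simp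
    then show ?thesis by (rule Froots(3))
  qed
  ultimately show "\<exists>Q1 ms g. Q1 \<in> mat_polys ?n k \<and> coeffs_close ?n \<eta> Q Q1 \<and> length ms = ?N \<and>
      det Q1 = (\<Prod>\<mu>\<leftarrow>ms. [:-\<mu>, 1:]) * g \<and> g \<noteq> 0 \<and> (\<forall>\<mu>\<in>set ms. cmod (\<mu> - z) \<le> \<eta>)"
    using Q1mp close by blast
qed

section \<open>The distance\<close>

lemma mat_polys_add:
  assumes "A \<in> mat_polys n k" "B \<in> mat_polys n k"
  shows "A + B \<in> mat_polys n k"
  using assms unfolding mat_polys_iff by auto

lemma mat_polys_diff:
  assumes "A \<in> mat_polys n k" "B \<in> mat_polys n k"
  shows "A - B \<in> mat_polys n k"
  using assms unfolding mat_polys_iff by auto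

text \<open>Expansion in the basis of matrices with a single entry \<open>x\<^sup>i\<close> compares an arbitrary norm
  with the largest coefficient.\<close>

lemma norm_bounded_by_coeffs:
  assumes N: "is_norm_on_mat_polys n k N"
  obtains c where "0 \<le> c"
    "\<And>X \<epsilon>. X \<in> mat_polys n k \<Longrightarrow> coeffs_bounded n \<epsilon> X \<Longrightarrow> N X \<le> c * \<epsilon>"
proof -
  define U where "U = (\<lambda>(a,b,i). mat n n (\<lambda>(a',b'). if a' = a \<and> b' = b then monom (1 :: complex) i else 0))"
  define I where "I = {..<n} \<times> {..<n} \<times> {..k}"
  have fin: "finite I" unfolding I_def by simp
  have Ump: "U t \<in> mat_polys n k" if "t \<in> I" for t
    using that unfolding U_def I_def mat_polys_iff by (auto simp: coeff_monom)
  have N0: "0 \<le> N X" if "X \<in> mat_polys n k" for X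
    using N that unfolding is_norm_on_mat_polys_def by blast
  define c where "c = (\<Sum>t\<in>I. N (U t))"
  have c: "0 \<le> c" unfolding c_def using Ump N0 by (intro sum_nonneg) auto
  have "N X \<le> c * \<epsilon>" if X: "X \<in> mat_polys n k" and b: "coeffs_bounded n \<epsilon> X" for X \<epsilon>
  proof -
    define x where "x = (\<lambda>(a,b,i). coeff (X $$ (a,b)) i)"
    define S where "S = (\<lambda>T. mat n n (\<lambda>(a,b). \<Sum>t\<in>T. [:x t:] * U t $$ (a,b)))"
    have S: "S T \<in> mat_polys n k \<and> N (S T) \<le> (\<Sum>t\<in>T. cmod (x t) * N (U t))"
      if "finite T" "T \<subseteq> I" for T
      using that
    proof (induction T rule: finite_induct)
      case empty
      have "S {} = 0\<^sub>m n n" unfolding S_def by (rule eq_matI) auto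
      moreover have "0\<^sub>m n n \<in> mat_polys n k" unfolding mat_polys_iff by auto
      ultimately show ?case using N unfolding is_norm_on_mat_polys_def by auto
    next
      case (insert t T)
      have t: "U t \<in> mat_polys n k" using insert.prems Ump by auto
      have IH: "S T \<in> mat_polys n k" "N (S T) \<le> (\<Sum>t\<in>T. cmod (x t) * N (U t))"
        using insert by auto
      have tU: "[:x t:] \<cdot>\<^sub>m U t \<in> mat_polys n k" using t unfolding mat_polys_iff by auto
      have "S (insert t T) = S T + [:x t:] \<cdot>\<^sub>m U t"
        unfolding S_def using insert.hyps mat_polys_carrier[OF t]
        by (intro eq_matI) (auto simp: add.commute)
      moreover have "S T + [:x t:] \<cdot>\<^sub>m U t \<in> mat_polys n k"
        using IH(1) tU by (rule mat_polys_add)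
      moreover have "N (S T + [:x t:] \<cdot>\<^sub>m U t) \<le> N (S T) + N ([:x t:] \<cdot>\<^sub>m U t)"
        using N IH(1) tU unfolding is_norm_on_mat_polys_def by blast
      moreover have "N ([:x t:] \<cdot>\<^sub>m U t) = cmod (x t) * N (U t)"
        using N t unfolding is_norm_on_mat_polys_def by blast
      ultimately show ?case using IH(2) insert.hyps by simp
    qed
    have Xc: "X \<in> carrier_mat n n" by (rule mat_polys_carrier[OF X])
    have "S I = X"
    proof (rule eq_matI)
      fix a b assume "a < dim_row X" "b < dim_col X"
      then have ab: "a < n" "b < n" using Xc by auto
      have "coeff (S I $$ (a,b)) i = coeff (X $$ (a,b)) i" for i
      proof -
        have "coeff (S I $$ (a,b)) i = (\<Sum>t\<in>I. coeff ([:x t:] * U t $$ (a,b)) i)"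
          unfolding S_def using ab by (simp add: coeff_sum)
        also have "\<dots> = (\<Sum>t\<in>I. if t = (a,b,i) then x t else 0)"
          by (rule sum.cong) (use ab in \<open>auto simp: U_def coeff_monom split: if_splits\<close>)
        also have "\<dots> = (if (a,b,i) \<in> I then x (a,b,i) else 0)" using fin by simp
        also have "\<dots> = coeff (X $$ (a,b)) i"
          using X ab unfolding mat_polys_iff x_def I_def by auto
        finally show ?thesis .
      qed
      then show "S I $$ (a,b) = X $$ (a,b)" by (rule poly_eqI)
    qed (use Xc in \<open>auto simp: S_def\<close>)
    then have "N X \<le> (\<Sum>t\<in>I. cmod (x t) * N (U t))" using S[OF fin] by auto
    also have "\<dots> \<le> (\<Sum>t\<in>I. \<epsilon> * N (U t))"
      using b N0[OF Ump] unfolding coeffs_bounded_def x_def I_def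
      by (intro sum_mono mult_right_mono) auto
    also have "\<dots> = c * \<epsilon>" unfolding c_def by (simp add: sum_distrib_left mult.commute)
    finally show ?thesis .
  qed
  then show thesis using that c by blast
qed

text \<open>A singular \<open>Q\<close> is first replaced by regular matrices with \<open>k n > r\<close> roots near \<open>z\<close>; a regular \<open>Q\<close>
  already has \<open>r + 1\<close> roots at \<open>z\<close>.\<close>

lemma elementary_divisor_dense:
  assumes Q: "Q \<in> mat_polys n k" and r: "r < k * n" and \<delta>: "0 < \<delta>"
    and dvd: "[:-z, 1:] ^ (r + 1) dvd det Q"
  obtains Q' j where "Q' \<in> mat_polys n k" "coeffs_close n \<delta> Q Q'" "r + 1 \<le> j"
    "elementary_divisor n Q' ([:-z, 1:] ^ j)"
proof -
  have "\<exists>m\<ge>r + 1. regular_approximable n k z m Q"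
  proof (cases "det Q = 0")
    case True
    obtain q where n: "n = Suc q" using r by (cases n) auto
    have "regular_approximable n k z (k * n) Q"
      using singular_regular_approximable Q True unfolding n by blast
    then show ?thesis using r by (intro exI[of _ "k * n"]) simp
  next
    case False
    obtain g where g: "det Q = [:-z, 1:] ^ (r + 1) * g" using dvd by (rule dvdE)
    have "(\<Prod>\<mu>\<leftarrow>replicate (r + 1) z. [:-\<mu>, 1:]) = [:-z, 1:] ^ (r + 1)"
      by (simp only: map_replicate prod_list_replicate)
    then have "det Q = (\<Prod>\<mu>\<leftarrow>replicate (r + 1) z. [:-\<mu>, 1:]) * g" using g by simp
    moreover have "g \<noteq> 0" using False g by auto
    ultimately show ?thesis using Q coeffs_close_refl unfolding regular_approximable_def
      by (intro exI[of _ "r + 1"] conjI allI impI exI[of _ Q] exI[of _ "replicate (r + 1) z"]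
          exI[of _ g]) auto
  qed
  then obtain m where m: "r + 1 \<le> m" and near: "regular_approximable n k z m Q" by blast
  obtain Q' g where Q': "Q' \<in> mat_polys n k" "coeffs_close n \<delta> Q Q'"
    "det Q' = [:-z, 1:] ^ m * g" "g \<noteq> 0" "kernel_at_most_line n Q' z"
    by (rule gather_roots[OF Q \<delta> near]) (rule that)
  have m1: "1 \<le> m" using m by simp
  obtain j where "m \<le> j" "elementary_divisor n Q' ([:-z, 1:] ^ j)"
    by (rule elementary_divisor_if_kernel_line[OF mat_polys_carrier[OF Q'(1)] Q'(5,3,4) m1])
      (rule that)
  then show thesis using m by (intro that[OF Q'(1,2)]) auto
qed

lemma elementary_divisor_imp_rank_le:
  assumes "elementary_divisor n Q ([:-z, 1:] ^ j)" "r + 1 \<le> j"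
  shows "vec_space.rank ((r + 1) * n) (block_toeplitz n r Q z) \<le> (r + 1) * (n - 1)"
proof -
  obtain ds d R c \<mu> where ds: "smith_form n Q ds" "d \<in> set ds" "finite R"
    "d = (\<Prod>\<mu>\<in>R. [:-\<mu>, 1:] ^ c \<mu>)" "\<mu> \<in> R" "[:-z, 1:] ^ j = [:-\<mu>, 1:] ^ c \<mu>"
    using assms(1) unfolding elementary_divisor_def by blast
  have "[:-\<mu>, 1:] ^ c \<mu> dvd d" unfolding ds(4) using ds(3,5) by (rule dvd_prodI)
  then have "[:-z, 1:] ^ j dvd d" unfolding ds(6) .
  then have "[:-z, 1:] ^ (r + 1) dvd d" using le_imp_power_dvd[OF assms(2)] dvd_trans by blast
  then show ?thesis by (rule smith_form_imp_rank_le[OF ds(1,2)])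
qed

theorem corollary4p3:
  fixes P :: "complex poly mat" and n k r :: nat and z\<^sub>0 :: complex
    and N :: "complex poly mat \<Rightarrow> real"
  assumes "mat_poly_of_degree n k P"
    and "1 \<le> r" and "r < k * n"
    and "is_norm_on_mat_polys n k N"
  shows "elementary_divisor_distance n k N P z\<^sub>0 r =
    (INF \<Delta> \<in> rank_deficient_perturbations n k P z\<^sub>0 r. ereal (N \<Delta>))"
proof -
  define ED where "ED = {\<Delta> \<in> mat_polys n k.
      \<exists>j\<ge>r + 1. elementary_divisor n (P + \<Delta>) ([:-z\<^sub>0, 1:] ^ j)}"
  let ?RD = "rank_deficient_perturbations n k P z\<^sub>0 r"
  have P: "P \<in> mat_polys n k" using assms(1) unfolding mat_poly_of_degree_def by simp
  have n: "0 < n" using assms(3) by (cases n) auto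
  have sub: "ED \<subseteq> ?RD"
    unfolding ED_def rank_deficient_perturbations_def
    using elementary_divisor_imp_rank_le by blast
  obtain c where c: "0 \<le> c"
    "\<And>X \<epsilon>. X \<in> mat_polys n k \<Longrightarrow> coeffs_bounded n \<epsilon> X \<Longrightarrow> N X \<le> c * \<epsilon>"
    using norm_bounded_by_coeffs[OF assms(4)] by blast
  have approx: "(INF \<Delta>\<in>ED. ereal (N \<Delta>)) \<le> ereal (N \<Delta>)" if \<Delta>: "\<Delta> \<in> ?RD" for \<Delta>
  proof (rule ereal_le_epsilon2)
    fix e :: real assume e: "0 < e"
    have \<Delta>m: "\<Delta> \<in> mat_polys n k"
      and rk: "vec_space.rank ((r + 1) * n) (block_toeplitz n r (P + \<Delta>) z\<^sub>0) \<le> (r + 1) * (n - 1)"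
      using \<Delta> unfolding rank_deficient_perturbations_def by auto
    have Q: "P + \<Delta> \<in> mat_polys n k" using P \<Delta>m by (rule mat_polys_add)
    define \<delta> where "\<delta> = e / (c + 1)"
    have \<delta>: "0 < \<delta>" "c * \<delta> \<le> e" using e c(1) unfolding \<delta>_def by (auto simp: field_simps)
    obtain Q' j where Q': "Q' \<in> mat_polys n k" "coeffs_close n \<delta> (P + \<Delta>) Q'" "r + 1 \<le> j"
      "elementary_divisor n Q' ([:-z\<^sub>0, 1:] ^ j)"
      by (rule elementary_divisor_dense[OF Q assms(3) \<delta>(1)
        det_dvd_if_rank_le[OF mat_polys_carrier[OF Q] n rk]]) (rule that)
    define X where "X = Q' - (P + \<Delta>)"
    have car: "P \<in> carrier_mat n n" "\<Delta> \<in> carrier_mat n n" "Q' \<in> carrier_mat n n"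
      using P \<Delta>m Q'(1) mat_polys_carrier by auto
    have X: "X \<in> mat_polys n k" unfolding X_def using Q'(1) Q by (rule mat_polys_diff)
    have "coeffs_bounded n \<delta> X"
      using Q'(2) car unfolding coeffs_close_def coeffs_bounded_def X_def by auto
    then have NX: "N X \<le> e" using c(2)[OF X] \<delta>(2) by fastforce
    have \<Delta>X: "\<Delta> + X \<in> mat_polys n k" using \<Delta>m X by (rule mat_polys_add)
    have "P + (\<Delta> + X) = Q'" unfolding X_def using car by (intro eq_matI) auto
    then have "\<Delta> + X \<in> ED" unfolding ED_def using \<Delta>X Q'(3,4) by auto
    then have "(INF \<Delta>\<in>ED. ereal (N \<Delta>)) \<le> ereal (N (\<Delta> + X))" by (rule INF_lower)
    also have "N (\<Delta> + X) \<le> N \<Delta> + N X"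
      using assms(4) \<Delta>m X unfolding is_norm_on_mat_polys_def by blast
    also have "\<dots> \<le> N \<Delta> + e" using NX by simp
    finally show "(INF \<Delta>\<in>ED. ereal (N \<Delta>)) \<le> ereal (N \<Delta>) + ereal e" by simp
  qed
  show ?thesis
  proof (rule antisym)
    show "elementary_divisor_distance n k N P z\<^sub>0 r \<le> (INF \<Delta>\<in>?RD. ereal (N \<Delta>))"
      unfolding elementary_divisor_distance_def ED_def[symmetric]
      by (rule INF_greatest) (rule approx)
    show "(INF \<Delta>\<in>?RD. ereal (N \<Delta>)) \<le> elementary_divisor_distance n k N P z\<^sub>0 r"
      unfolding elementary_divisor_distance_def ED_def[symmetric]
      by (rule INF_superset_mono[OF sub]) simp
  qed
qed

end
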